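(* A fifth-order linear equation in standard form $$y^{(5)}+c_4(x)\,y^{(4)}+c_3(x)\,y^{(3)}+c_2(x)\,y''+c_1(x)\,y'+c_0(x)\,y=0$$ has a maximal symmetry algebra if and only if its coefficients satisfy the three equations $$50\,c_2=30c_3c_4-8c_4^3+75c_3'-60c_4c_4'-50c_4'',$$ $$\begin{aligned}1250\,c_1={}&200c_3^2-18c_4^4+750c_4c_3'-580c_4^2c_4'-850(c_4')^2-10c_3(c_4^2+5c_4')\\&+1125c_3''-1400c_4c_4''-1000c_4^{(3)},\end{aligned}$$ $$\begin{aligned}6250\,c_0={}&200c_3^2c_4+14c_4^5-25c_4^2c_3'+40c_4^3c_4'-125c_3'c_4'-750c_4(c_4')^2+1125c_4c_3''-850c_4^2c_4''\\&-2750c_4'c_4''+1250c_3^{(3)}-2000c_4c_4^{(3)}-1250c_4^{(4)}-10c_3\left(11c_4^3-100c_3'+85c_4c_4'+75c_4''\right).\end{aligned}$$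
   Context: All coefficients $c_j=c_j(x)$ are smooth functions on an open interval; primes denote derivatives with respect to $x$. The symmetry algebra of an ordinary differential equation is the Lie algebra of its Lie point symmetries, i.e. vector fields $\xi(x,y)\partial_x+\eta(x,y)\partial_y$ satisfying the infinitesimal criterion of invariance for the equation. For a linear ordinary differential equation of order $n\ge 3$ the maximal possible dimension of this algebra is $n+4$ (so $9$ for $n=5$); the equation is said to have a maximal symmetry algebra if this dimension is attained. By known results of Lie and of Krause and Michel this is equivalent to the equation being reducible by a (local) invertible point transformation to $y^{(n)}=0$. *)

theory Defs
  imports "HOL-Analysis.Analysis" "HOL-Library.Function_Algebras"
begin

text \<open>Differentiability of order \<open>k\<close> and smoothness on an open subset of a
  finite-dimensional space.\<close>

primrec higher_differentiable_on ::
    "'a::real_normed_vector set \<Rightarrow> ('a \<Rightarrow> 'b::real_normed_vector) \<Rightarrow> nat \<Rightarrow> bool" where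
  "higher_differentiable_on S f 0 \<longleftrightarrow> continuous_on S f"
| "higher_differentiable_on S f (Suc k) \<longleftrightarrow>
     (\<forall>x\<in>S. f differentiable (at x)) \<and>
     (\<forall>v. higher_differentiable_on S (\<lambda>x. frechet_derivative f (at x) v) k)"

definition smooth_on :: "'a::real_normed_vector set \<Rightarrow> ('a \<Rightarrow> 'b::real_normed_vector) \<Rightarrow> bool" where
  "smooth_on S f \<longleftrightarrow> (\<forall>k. higher_differentiable_on S f k)"

text \<open>A function on the jet space takes \<open>x\<close> and \<open>u\<close>, where \<open>u k\<close> is the coordinate of
  the \<open>k\<close>-th derivative \<open>y\<^sup>(\<^sup>k\<^sup>)\<close>. A function of order at most \<open>n\<close> depends on
  \<open>u 0, \<dots>, u n\<close> only. A vector field \<open>V = (\<xi>, \<eta>)\<close> stands for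
  \<open>\<xi>(x,y) \<partial>\<^sub>x + \<eta>(x,y) \<partial>\<^sub>y\<close>.\<close>

type_synonym jet_fun = "real \<Rightarrow> (nat \<Rightarrow> real) \<Rightarrow> real"
type_synonym vector_field = "real \<times> real \<Rightarrow> real \<times> real"

definition jet_partial_x :: "jet_fun \<Rightarrow> jet_fun" where
  "jet_partial_x F = (\<lambda>x u. deriv (\<lambda>t. F t u) x)"

definition jet_partial :: "nat \<Rightarrow> jet_fun \<Rightarrow> jet_fun" where
  "jet_partial k F = (\<lambda>x u. deriv (\<lambda>t. F x (u(k := t))) (u k))"

text \<open>The total derivative \<open>D\<^sub>x F\<close>, for \<open>F\<close> of order at most \<open>n\<close>.\<close>

definition total_deriv :: "nat \<Rightarrow> jet_fun \<Rightarrow> jet_fun" where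
  "total_deriv n F =
     (\<lambda>x u. jet_partial_x F x u + (\<Sum>k\<le>n. u (Suc k) * jet_partial k F x u))"

text \<open>The coefficients of the prolongation of \<open>V\<close>:
  \<open>\<eta>\<^sup>(\<^sup>0\<^sup>) = \<eta>\<close> and \<open>\<eta>\<^sup>(\<^sup>k\<^sup>+\<^sup>1\<^sup>) = D\<^sub>x \<eta>\<^sup>(\<^sup>k\<^sup>) - y\<^sup>(\<^sup>k\<^sup>+\<^sup>1\<^sup>) D\<^sub>x \<xi>\<close>.\<close>

primrec prolong_coeff :: "vector_field \<Rightarrow> nat \<Rightarrow> jet_fun" where
  "prolong_coeff V 0 = (\<lambda>x u. snd (V (x, u 0)))"
| "prolong_coeff V (Suc k) =
     (\<lambda>x u. total_deriv k (prolong_coeff V k) x u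
            - u (Suc k) * total_deriv 0 (\<lambda>x u. fst (V (x, u 0))) x u)"

text \<open>The \<open>n\<close>-th prolongation of \<open>V\<close>, applied to a function of order at most \<open>n\<close>.\<close>

definition prolong_apply :: "nat \<Rightarrow> vector_field \<Rightarrow> jet_fun \<Rightarrow> jet_fun" where
  "prolong_apply n V F =
     (\<lambda>x u. fst (V (x, u 0)) * jet_partial_x F x u
            + (\<Sum>k\<le>n. prolong_coeff V k x u * jet_partial k F x u))"

text \<open>The infinitesimal criterion of invariance of the \<open>n\<close>-th order equation
  \<open>\<Delta> = 0\<close>, with \<open>x\<close> in \<open>I\<close>.\<close>

definition infinitesimally_invariant ::
    "nat \<Rightarrow> real set \<Rightarrow> jet_fun \<Rightarrow> vector_field \<Rightarrow> bool" where
  "infinitesimally_invariant n I \<Delta> V \<longleftrightarrow>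
     (\<forall>x\<in>I. \<forall>u. \<Delta> x u = 0 \<longrightarrow> prolong_apply n V \<Delta> x u = 0)"

text \<open>Vector fields on \<open>I \<times> \<real>\<close> are represented by total functions vanishing outside
  \<open>I \<times> \<real>\<close>, so that distinct functions are distinct vector fields.\<close>

definition symmetry_algebra :: "nat \<Rightarrow> real set \<Rightarrow> jet_fun \<Rightarrow> vector_field set" where
  "symmetry_algebra n I \<Delta> =
     {V. smooth_on (I \<times> UNIV) V \<and> (\<forall>p. p \<notin> I \<times> UNIV \<longrightarrow> V p = 0)
         \<and> infinitesimally_invariant n I \<Delta> V}"

definition vf_scale :: "real \<Rightarrow> vector_field \<Rightarrow> vector_field" where
  "vf_scale r V = (\<lambda>p. r *\<^sub>R V p)"

interpretation vf: vector_space vf_scale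
  by unfold_locales (auto simp: vf_scale_def fun_eq_iff plus_fun_def algebra_simps)

text \<open>The equation \<open>y\<^sup>(\<^sup>n\<^sup>) + c\<^sub>n\<^sub>-\<^sub>1 y\<^sup>(\<^sup>n\<^sup>-\<^sup>1\<^sup>) + \<dots> + c\<^sub>0 y = 0\<close> as a function on the jet space.\<close>

definition linear_ode :: "nat \<Rightarrow> (nat \<Rightarrow> real \<Rightarrow> real) \<Rightarrow> jet_fun" where
  "linear_ode n c = (\<lambda>x u. u n + (\<Sum>j<n. c j x * u j))"

text \<open>Meaningful for \<open>n \<ge> 3\<close>, where \<open>n + 4\<close> is the largest possible dimension.\<close>

definition has_maximal_symmetry_algebra ::
    "nat \<Rightarrow> real set \<Rightarrow> (nat \<Rightarrow> real \<Rightarrow> real) \<Rightarrow> bool" where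
  "has_maximal_symmetry_algebra n I c \<longleftrightarrow>
     vf.dim (symmetry_algebra n I (linear_ode n c)) = n + 4"

end

theory Submission
  imports Defs
begin

text \<open>
  Every symmetry of a fifth-order linear equation has the form
  \<open>a(x) \<partial>\<^sub>x + (f(x) y + g(x)) \<partial>\<^sub>y\<close>: on the equation the invariance condition is affine in \<open>u\<^sub>4\<close>, and
  comparing coefficients in its slope gives first \<open>\<xi>\<^sub>y = 0\<close>, then \<open>\<eta>\<^sub>y\<^sub>y = 0\<close>
  (\<open>symmetry_is_affine\<close>). For such a field the condition says that \<open>g\<close> solves the equation and that
  five linear determining equations \<open>det4 = 0, \<dots>, det0 = 0\<close> hold for \<open>a\<close> and \<open>f\<close>, one for each of
  the coordinates \<open>u\<^sub>4, \<dots>, u\<^sub>0\<close> (\<open>symmetry_algebra_eq\<close>). The first two fix \<open>f'\<close> and \<open>a'''\<close> in terms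
  of \<open>a, a', a''\<close>. So at any point \<open>x\<close> the nine numbers \<open>a, a', a'', f, g, g', \<dots>, g\<^sup>(\<^sup>4\<^sup>)\<close> determine
  the symmetry, and the dimension is nine if and only if all nine can be prescribed
  (\<open>maximal_iff_data_surj\<close>).

  What remains are \<open>det2\<close>, \<open>det1\<close>, \<open>det0\<close>. The three displayed equations state that certain
  quantities \<open>w\<^sub>3, w\<^sub>4, w\<^sub>5\<close> vanish, namely the differences between \<open>c\<^sub>2, c\<^sub>1, c\<^sub>0\<close> and polynomials in
  the derivatives of \<open>c\<^sub>4\<close> and \<open>c\<^sub>3\<close>. They are the relative invariants of the equation, of weight 3, 4
  and 5: modulo \<open>det4\<close>, \<open>det3\<close> and their derivatives, \<open>det2\<close> equals \<open>a w\<^sub>3' + 3 a' w\<^sub>3\<close>; if \<open>w\<^sub>3\<close>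
  vanishes, \<open>det1\<close> equals \<open>a w\<^sub>4' + 4 a' w\<^sub>4\<close>; if \<open>w\<^sub>4\<close> vanishes too, \<open>det0\<close> equals
  \<open>a w\<^sub>5' + 5 a' w\<^sub>5\<close> (\<open>det2_eq\<close>, \<open>det1_eq\<close>, \<open>det0_eq\<close>). If all three vanish, the remaining
  determining equations are consequences of the first two, and the existence theorem for linear
  equations yields all initial values. Conversely, if the algebra is maximal, then at each point
  \<open>x\<close> there is a symmetry with \<open>a(x) = 0\<close> and \<open>a'(x) = 1\<close>, which forces \<open>w\<^sub>3(x) = 0\<close>, then
  \<open>w\<^sub>4(x) = 0\<close>, then \<open>w\<^sub>5(x) = 0\<close>.
\<close>

section \<open>Calculus of smooth functions\<close>

lemma higher_differentiable_on_SucD: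
  "higher_differentiable_on S f (Suc k) \<Longrightarrow> higher_differentiable_on S f k"
proof (induction k arbitrary: f)
  case 0
  then show ?case
    by (auto intro!: continuous_at_imp_continuous_on differentiable_imp_continuous_within)
next
  case (Suc k)
  then show ?case by (metis higher_differentiable_on.simps(2))
qed

lemma higher_differentiable_on_cong:
  assumes "open S" and "\<And>x. x \<in> S \<Longrightarrow> f x = g x" and "higher_differentiable_on S f k"
  shows "higher_differentiable_on S g k"
  using assms(2,3)
proof (induction k arbitrary: f g)
  case 0
  then show ?case by (metis continuous_on_cong higher_differentiable_on.simps(1))
next
  case (Suc k)
  have fd: "(f has_derivative frechet_derivative f (at x)) (at x)" if "x \<in> S" for x
    using Suc.prems(2) that frechet_derivative_works by auto
  have gd: "(g has_derivative frechet_derivative f (at x)) (at x)" if "x \<in> S" for x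
    using has_derivative_transform_within_open[OF fd[OF that] \<open>open S\<close> that] Suc.prems(1) by auto
  then have "frechet_derivative g (at x) = frechet_derivative f (at x)" if "x \<in> S" for x
    using that frechet_derivative_at by metis
  moreover have "g differentiable (at x)" if "x \<in> S" for x
    using gd[OF that] differentiable_def by blast
  ultimately show ?case
    using Suc.IH[of "\<lambda>x. frechet_derivative f (at x) _" "\<lambda>x. frechet_derivative g (at x) _"]
      Suc.prems(2) by auto
qed

text \<open>Membership at order \<open>k + 1\<close> only asks for some derivative, which need not be
  identified with \<^const>\<open>frechet_derivative\<close> off the open set.\<close>

lemma higher_differentiable_on_SucI:
  assumes "open S" and "\<And>x. x \<in> S \<Longrightarrow> (f has_derivative f' x) (at x)"
    and "\<And>v. higher_differentiable_on S (\<lambda>x. f' x v) k"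
  shows "higher_differentiable_on S f (Suc k)"
proof -
  have "frechet_derivative f (at x) = f' x" if "x \<in> S" for x
    using assms(2)[OF that] frechet_derivative_at by metis
  then have "higher_differentiable_on S (\<lambda>x. frechet_derivative f (at x) v) k" for v
    using higher_differentiable_on_cong[OF assms(1) _ assms(3)[of v]] by auto
  moreover have "f differentiable (at x)" if "x \<in> S" for x
    using assms(2)[OF that] unfolding differentiable_def by blast
  ultimately show ?thesis by auto
qed

lemma higher_differentiable_on_has_derivative:
  assumes "higher_differentiable_on S f (Suc k)" and "x \<in> S"
  shows "(f has_derivative frechet_derivative f (at x)) (at x)"
  using assms frechet_derivative_works by auto

lemma higher_differentiable_on_const: "higher_differentiable_on S (\<lambda>x. c) k"
  by (induction k arbitrary: c) auto

lemma higher_differentiable_on_add: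
  assumes "open S" and "higher_differentiable_on S f k" and "higher_differentiable_on S g k"
  shows "higher_differentiable_on S (\<lambda>x. f x + g x) k"
  using assms(2,3)
proof (induction k arbitrary: f g)
  case 0
  then show ?case by (auto intro: continuous_intros)
next
  case (Suc k)
  show ?case
  proof (rule higher_differentiable_on_SucI[OF \<open>open S\<close>])
    show "((\<lambda>x. f x + g x) has_derivative
        (\<lambda>v. frechet_derivative f (at x) v + frechet_derivative g (at x) v)) (at x)" if "x \<in> S" for x
      using Suc.prems that by (intro has_derivative_add higher_differentiable_on_has_derivative)
  qed (use Suc in auto)
qed

lemma higher_differentiable_on_mult:
  fixes f g :: "'a::real_normed_vector \<Rightarrow> real"
  assumes "open S" and "higher_differentiable_on S f k" and "higher_differentiable_on S g k"
  shows "higher_differentiable_on S (\<lambda>x. f x * g x) k"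
  using assms(2,3)
proof (induction k arbitrary: f g)
  case 0
  then show ?case by (auto intro: continuous_intros)
next
  case (Suc k)
  note low = Suc.prems[THEN higher_differentiable_on_SucD]
  show ?case
  proof (rule higher_differentiable_on_SucI[OF \<open>open S\<close>])
    show "((\<lambda>x. f x * g x) has_derivative
        (\<lambda>v. f x * frechet_derivative g (at x) v + frechet_derivative f (at x) v * g x)) (at x)"
      if "x \<in> S" for x
      using Suc.prems that by (intro has_derivative_mult higher_differentiable_on_has_derivative)
  qed (use Suc low in \<open>auto intro!: higher_differentiable_on_add[OF \<open>open S\<close>]\<close>)
qed

lemma higher_differentiable_on_bounded_linear:
  assumes "open S" and "bounded_linear L" and "higher_differentiable_on S f k"
  shows "higher_differentiable_on S (\<lambda>x. L (f x)) k"
  using assms(3)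
proof (induction k arbitrary: f)
  case 0
  then show ?case
    using bounded_linear.continuous_on[OF \<open>bounded_linear L\<close>] by simp
next
  case (Suc k)
  show ?case
  proof (rule higher_differentiable_on_SucI[OF \<open>open S\<close>])
    show "((\<lambda>x. L (f x)) has_derivative (\<lambda>v. L (frechet_derivative f (at x) v))) (at x)"
      if "x \<in> S" for x
      using Suc.prems that
      by (intro bounded_linear.has_derivative[OF \<open>bounded_linear L\<close>]
          higher_differentiable_on_has_derivative)
  qed (use Suc in auto)
qed

lemma higher_differentiable_on_Pair:
  assumes "open S" and "higher_differentiable_on S f k" and "higher_differentiable_on S g k"
  shows "higher_differentiable_on S (\<lambda>x. (f x, g x)) k"
  using assms(2,3)
proof (induction k arbitrary: f g)
  case 0
  then show ?case by (auto intro: continuous_intros)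
next
  case (Suc k)
  show ?case
  proof (rule higher_differentiable_on_SucI[OF \<open>open S\<close>])
    show "((\<lambda>x. (f x, g x)) has_derivative
        (\<lambda>v. (frechet_derivative f (at x) v, frechet_derivative g (at x) v))) (at x)" if "x \<in> S" for x
      using Suc.prems that by (intro has_derivative_Pair higher_differentiable_on_has_derivative)
  qed (use Suc in auto)
qed

text \<open>Inner maps with constant derivative suffice below: the projection of the plane to the
  \<open>x\<close>-axis and the inclusions of horizontal lines.\<close>

lemma higher_differentiable_on_compose_affine:
  assumes "open T" and h: "\<And>x. (h has_derivative L) (at x)" and hT: "\<And>x. x \<in> T \<Longrightarrow> h x \<in> S"
    and "higher_differentiable_on S f k"
  shows "higher_differentiable_on T (\<lambda>x. f (h x)) k"
  using assms(4)
proof (induction k arbitrary: f)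
  case 0
  have "continuous_on T h"
    by (intro continuous_at_imp_continuous_on ballI has_derivative_continuous[OF h])
  then show ?case
    using 0 hT by (auto intro: continuous_on_compose2)
next
  case (Suc k)
  show ?case
  proof (rule higher_differentiable_on_SucI[OF \<open>open T\<close>])
    show "((\<lambda>x. f (h x)) has_derivative (\<lambda>v. frechet_derivative f (at (h x)) (L v))) (at x)"
      if "x \<in> T" for x
      using has_derivative_compose[OF h higher_differentiable_on_has_derivative[OF Suc.prems hT[OF that]]] .
    show "higher_differentiable_on T (\<lambda>x. frechet_derivative f (at (h x)) (L v)) k" for v
      using Suc.IH[of "\<lambda>y. frechet_derivative f (at y) (L v)"] Suc.prems by auto
  qed
qed

lemma smooth_on_cong:
  "open S \<Longrightarrow> (\<And>x. x \<in> S \<Longrightarrow> f x = g x) \<Longrightarrow> smooth_on S f \<Longrightarrow> smooth_on S g"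
  by (auto simp: smooth_on_def intro: higher_differentiable_on_cong)

lemma smooth_on_const: "smooth_on S (\<lambda>x. c)"
  by (simp add: smooth_on_def higher_differentiable_on_const)

lemma smooth_on_ident:
  assumes "open S"
  shows "smooth_on S (\<lambda>x. x)"
  unfolding smooth_on_def
proof
  show "higher_differentiable_on S (\<lambda>x. x) k" for k
  proof (cases k)
    case (Suc m)
    show ?thesis
      unfolding Suc by (rule higher_differentiable_on_SucI[OF assms has_derivative_ident])
        (rule higher_differentiable_on_const)
  qed simp
qed

lemma smooth_on_add:
  "open S \<Longrightarrow> smooth_on S f \<Longrightarrow> smooth_on S g \<Longrightarrow> smooth_on S (\<lambda>x. f x + g x)"
  by (simp add: smooth_on_def higher_differentiable_on_add)

lemma smooth_on_mult:
  fixes f g :: "'a::real_normed_vector \<Rightarrow> real"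
  shows "open S \<Longrightarrow> smooth_on S f \<Longrightarrow> smooth_on S g \<Longrightarrow> smooth_on S (\<lambda>x. f x * g x)"
  by (simp add: smooth_on_def higher_differentiable_on_mult)

lemma smooth_on_bounded_linear:
  "open S \<Longrightarrow> bounded_linear L \<Longrightarrow> smooth_on S f \<Longrightarrow> smooth_on S (\<lambda>x. L (f x))"
  by (simp add: smooth_on_def higher_differentiable_on_bounded_linear)

lemma smooth_on_Pair:
  "open S \<Longrightarrow> smooth_on S f \<Longrightarrow> smooth_on S g \<Longrightarrow> smooth_on S (\<lambda>x. (f x, g x))"
  by (simp add: smooth_on_def higher_differentiable_on_Pair)

lemma smooth_on_compose_affine:
  assumes "open T" and "\<And>x. (h has_derivative L) (at x)" and "\<And>x. x \<in> T \<Longrightarrow> h x \<in> S"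
    and "smooth_on S f"
  shows "smooth_on T (\<lambda>x. f (h x))"
  using assms(4) unfolding smooth_on_def
  by (intro allI higher_differentiable_on_compose_affine[OF assms(1-3)]) auto

lemma smooth_on_has_derivative:
  "smooth_on S f \<Longrightarrow> x \<in> S \<Longrightarrow> (f has_derivative frechet_derivative f (at x)) (at x)"
  by (auto simp: smooth_on_def intro: higher_differentiable_on_has_derivative)

lemma smooth_on_frechet_derivative:
  "smooth_on S f \<Longrightarrow> smooth_on S (\<lambda>x. frechet_derivative f (at x) v)"
  unfolding smooth_on_def by (metis higher_differentiable_on.simps(2))

lemma smooth_on_imp_continuous_on: "smooth_on S f \<Longrightarrow> continuous_on S f"
  unfolding smooth_on_def by (metis higher_differentiable_on.simps(1))

lemma smooth_on_funpow_deriv: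
  fixes f :: "real \<Rightarrow> real"
  assumes "open I" and "smooth_on I f"
  shows "smooth_on I ((deriv ^^ k) f)"
proof (induction k)
  case 0
  then show ?case using assms by simp
next
  case (Suc k)
  let ?g = "(deriv ^^ k) f"
  have "frechet_derivative ?g (at x) 1 = deriv ?g x" if "x \<in> I" for x
  proof -
    let ?L = "frechet_derivative ?g (at x)"
    have d: "(?g has_derivative ?L) (at x)"
      using smooth_on_has_derivative[OF Suc that] .
    have "?L v = ?L 1 * v" for v
      using linear_scale[OF has_derivative_linear[OF d], of v 1] by (simp add: mult.commute)
    then have "?L = (*) (?L 1)" by (rule ext)
    with d have "(?g has_derivative (*) (?L 1)) (at x)" by simp
    then show ?thesis by (simp add: DERIV_imp_deriv has_field_derivative_def)
  qed
  then show ?case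
    using smooth_on_cong[OF assms(1) _ smooth_on_frechet_derivative[OF Suc, of 1]] by simp
qed

lemma smooth_on_has_real_derivative:
  fixes f :: "real \<Rightarrow> real"
  assumes "open I" and "smooth_on I f" and "x \<in> I"
  shows "((deriv ^^ k) f has_real_derivative (deriv ^^ Suc k) f x) (at x)"
proof -
  have "(deriv ^^ k) f differentiable (at x)"
    by (rule differentiableI[OF smooth_on_has_derivative[OF smooth_on_funpow_deriv[OF assms(1,2)] assms(3)]])
  then obtain d where d: "((deriv ^^ k) f has_real_derivative d) (at x)"
    unfolding real_differentiable_def by blast
  then show ?thesis
    using DERIV_imp_deriv[OF d] by simp
qed

lemma funpow_deriv_unique:
  fixes d :: "nat \<Rightarrow> real \<Rightarrow> real"
  assumes "open I" and "\<And>j x. j < k \<Longrightarrow> x \<in> I \<Longrightarrow> (d j has_real_derivative d (Suc j) x) (at x)"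
    and "x \<in> I"
  shows "(deriv ^^ k) (d 0) x = d k x"
  using assms(2,3)
proof (induction k arbitrary: x)
  case 0
  then show ?case by simp
next
  case (Suc k)
  have "deriv ((deriv ^^ k) (d 0)) x = deriv (d k) x"
  proof (rule deriv_cong_ev)
    show "\<forall>\<^sub>F t in nhds x. (deriv ^^ k) (d 0) t = d k t"
      using Suc assms(1) by (auto simp: eventually_nhds intro!: exI[of _ I])
  qed simp
  then show ?case
    using DERIV_imp_deriv[of "d k"] Suc.prems by auto
qed

section \<open>Linear systems of ordinary differential equations\<close>

lemma compact_interval_around:
  fixes I :: "real set"
  assumes "open I" and "is_interval I" and "x \<in> I" and "y \<in> I"
  obtains l r where "l < x" and "x < r" and "l < y" and "y < r" and "{l..r} \<subseteq> I"
proof -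
  obtain d e where d: "d > 0" "cball x d \<subseteq> I" and e: "e > 0" "cball y e \<subseteq> I"
    using assms by (meson open_contains_cball)
  define h where "h = min d e"
  have "h > 0" using d e by (simp add: h_def)
  have "x - h \<in> I" "x + h \<in> I"
    using \<open>h > 0\<close> by (auto simp: dist_real_def h_def intro!: subsetD[OF d(2)])
  moreover have "y - h \<in> I" "y + h \<in> I"
    using \<open>h > 0\<close> by (auto simp: dist_real_def h_def intro!: subsetD[OF e(2)])
  ultimately have "min x y - h \<in> I" "max x y + h \<in> I"
    by (simp_all add: min_def max_def)
  then have "{min x y - h..max x y + h} \<subseteq> I"
    using assms(2) unfolding is_interval_1 by (meson atLeastAtMost_iff subsetI)
  then show thesis
    using that[of "min x y - h" "max x y + h"] \<open>h > 0\<close> by (simp add: min_def max_def split: if_splits)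
qed

lemma bounded_matrix_on_compact:
  fixes A :: "nat \<Rightarrow> nat \<Rightarrow> real \<Rightarrow> real"
  assumes "compact J" and "\<And>i j. i < n \<Longrightarrow> j < n \<Longrightarrow> continuous_on J (A i j)"
  obtains K where "K \<ge> 0" and "\<And>i j x. i < n \<Longrightarrow> j < n \<Longrightarrow> x \<in> J \<Longrightarrow> \<bar>A i j x\<bar> \<le> K"
proof -
  have "\<exists>B\<ge>0. \<forall>x\<in>J. \<bar>A i j x\<bar> \<le> B" if "i < n" "j < n" for i j
  proof -
    have "bounded (A i j ` J)"
      using assms that by (intro compact_imp_bounded compact_continuous_image)
    then obtain B where "\<forall>x\<in>J. \<bar>A i j x\<bar> \<le> B"
      by (auto simp: bounded_iff)
    then show ?thesis by (intro exI[of _ "max B 0"]) force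
  qed
  then obtain B where B: "\<And>i j. i < n \<Longrightarrow> j < n \<Longrightarrow> B i j \<ge> 0 \<and> (\<forall>x\<in>J. \<bar>A i j x\<bar> \<le> B i j)"
    by metis
  show thesis
  proof (rule that)
    show "(\<Sum>i<n. \<Sum>j<n. B i j) \<ge> 0"
      using B by (intro sum_nonneg) auto
    fix i j x assume ij: "i < n" "j < n" and "x \<in> J"
    have "B i j \<le> (\<Sum>j<n. B i j)"
      using B ij by (intro member_le_sum) auto
    also have "\<dots> \<le> (\<Sum>i<n. \<Sum>j<n. B i j)"
      using B ij by (intro member_le_sum) (auto intro!: sum_nonneg)
    finally show "\<bar>A i j x\<bar> \<le> (\<Sum>i<n. \<Sum>j<n. B i j)"
      using B[OF ij] \<open>x \<in> J\<close> by force
  qed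
qed

definition solves_linear_system ::
    "real set \<Rightarrow> nat \<Rightarrow> (nat \<Rightarrow> nat \<Rightarrow> real \<Rightarrow> real) \<Rightarrow> (nat \<Rightarrow> real \<Rightarrow> real) \<Rightarrow> bool" where
  "solves_linear_system I n A u \<longleftrightarrow>
     (\<forall>i<n. \<forall>x\<in>I. (u i has_real_derivative (\<Sum>j<n. A i j x * u j x)) (at x))"

text \<open>The energy \<open>E = \<Sum>\<^sub>i u\<^sub>i\<^sup>2\<close> of a solution obeys \<open>\<bar>E'\<bar> \<le> C E\<close> on compact intervals, so
  \<open>E(x) e\<^sup>-\<^sup>C\<^sup>x\<close> decreases and \<open>E(x) e\<^sup>C\<^sup>x\<close> increases; a zero of \<open>E\<close> therefore spreads in both
  directions.\<close>

lemma linear_system_unique: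
  fixes I :: "real set"
  assumes "open I" and "is_interval I" and "x0 \<in> I"
    and cont: "\<And>i j. i < n \<Longrightarrow> j < n \<Longrightarrow> continuous_on I (A i j)"
    and sol: "solves_linear_system I n A u"
    and init: "\<And>i. i < n \<Longrightarrow> u i x0 = 0"
    and "x \<in> I" and "i < n"
  shows "u i x = 0"
proof -
  obtain l r where lr: "l < x0" "x0 < r" "l < x" "x < r" "{l..r} \<subseteq> I"
    using compact_interval_around[OF assms(1-3) \<open>x \<in> I\<close>] .
  obtain K where K: "K \<ge> 0" "\<And>i j t. i < n \<Longrightarrow> j < n \<Longrightarrow> t \<in> {l..r} \<Longrightarrow> \<bar>A i j t\<bar> \<le> K"
    using bounded_matrix_on_compact[of "{l..r}" n A] cont lr(5)
    by (metis compact_Icc continuous_on_subset)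
  define E where "E t = (\<Sum>i<n. (u i t)\<^sup>2)" for t
  define E' where "E' t = (\<Sum>i<n. 2 * u i t * (\<Sum>j<n. A i j t * u j t))" for t
  define C where "C = 2 * real n * K"
  have dE: "(E has_real_derivative E' t) (at t)" if "t \<in> {l..r}" for t
    unfolding E_def[abs_def] E'_def
    using sol lr(5) that
    by (auto simp: solves_linear_system_def intro!: derivative_eq_intros sum.cong)
  have bound: "\<bar>E' t\<bar> \<le> C * E t" if t: "t \<in> {l..r}" for t
  proof -
    have "\<bar>E' t\<bar> \<le> (\<Sum>i<n. \<Sum>j<n. \<bar>2 * u i t * (A i j t * u j t)\<bar>)"
      unfolding E'_def sum_distrib_left
      by (rule order_trans[OF sum_abs]) (intro sum_mono sum_abs)
    also have "\<dots> \<le> (\<Sum>i<n. \<Sum>j<n. K * ((u i t)\<^sup>2 + (u j t)\<^sup>2))"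
    proof (intro sum_mono)
      fix i j assume ij: "i \<in> {..<n}" "j \<in> {..<n}"
      have "2 * \<bar>u i t\<bar> * \<bar>u j t\<bar> \<le> (u i t)\<^sup>2 + (u j t)\<^sup>2"
        using sum_squares_bound[of "\<bar>u i t\<bar>" "\<bar>u j t\<bar>"] by simp
      then have "\<bar>A i j t\<bar> * (2 * \<bar>u i t\<bar> * \<bar>u j t\<bar>) \<le> K * ((u i t)\<^sup>2 + (u j t)\<^sup>2)"
        using K ij t by (intro mult_mono) auto
      then show "\<bar>2 * u i t * (A i j t * u j t)\<bar> \<le> K * ((u i t)\<^sup>2 + (u j t)\<^sup>2)"
        by (simp add: abs_mult mult_ac)
    qed
    also have "\<dots> = C * E t"
      by (simp add: C_def E_def sum.distrib sum_distrib_left algebra_simps)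
    finally show ?thesis .
  qed
  have "E x0 = 0" using init by (simp add: E_def)
  have "E x \<le> 0"
  proof (cases "x0 \<le> x")
    case True
    have "E x * exp (- C * x) \<le> E x0 * exp (- C * x0)"
    proof (rule DERIV_nonpos_imp_nonincreasing[OF True])
      fix t assume "x0 \<le> t" "t \<le> x"
      then have t: "t \<in> {l..r}" using lr by auto
      have "((\<lambda>t. E t * exp (- C * t)) has_real_derivative (E' t - C * E t) * exp (- C * t)) (at t)"
        by (rule derivative_eq_intros dE[OF t] refl | simp add: algebra_simps)+
      moreover have "(E' t - C * E t) * exp (- C * t) \<le> 0"
        using bound[OF t] by (intro mult_nonpos_nonneg) auto
      ultimately show "\<exists>y. ((\<lambda>t. E t * exp (- C * t)) has_real_derivative y) (at t) \<and> y \<le> 0"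
        by blast
    qed
    then show ?thesis by (simp add: \<open>E x0 = 0\<close> mult_le_0_iff)
  next
    case False
    then have "x \<le> x0" by simp
    have "E x * exp (C * x) \<le> E x0 * exp (C * x0)"
    proof (rule DERIV_nonneg_imp_nondecreasing[OF \<open>x \<le> x0\<close>])
      fix t assume "x \<le> t" "t \<le> x0"
      then have t: "t \<in> {l..r}" using lr by auto
      have "((\<lambda>t. E t * exp (C * t)) has_real_derivative (E' t + C * E t) * exp (C * t)) (at t)"
        by (rule derivative_eq_intros dE[OF t] refl | simp add: algebra_simps)+
      moreover have "(E' t + C * E t) * exp (C * t) \<ge> 0"
        using bound[OF t] by (intro mult_nonneg_nonneg) auto
      ultimately show "\<exists>y. ((\<lambda>t. E t * exp (C * t)) has_real_derivative y) (at t) \<and> y \<ge> 0"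
        by blast
    qed
    then show ?thesis by (simp add: \<open>E x0 = 0\<close> mult_le_0_iff)
  qed
  then have "E x = 0" by (simp add: E_def sum_nonneg antisym)
  then show ?thesis
    using \<open>i < n\<close> by (simp add: E_def sum_nonneg_eq_0_iff)
qed

lemma antiderivative_on_open_interval:
  fixes I :: "real set" and f :: "real \<Rightarrow> real"
  assumes "open I" and "is_interval I" and "x0 \<in> I" and "continuous_on I f"
  obtains F where "F x0 = c" and "\<And>x. x \<in> I \<Longrightarrow> (F has_real_derivative f x) (at x)"
proof -
  let ?F = "\<lambda>u. LBINT y=x0..u. f y"
  have "(?F has_real_derivative f x) (at x)" if x: "x \<in> I" for x
  proof -
    obtain l r where lr: "l < x0" "x0 < r" "l < x" "x < r" "{l..r} \<subseteq> I"
      using compact_interval_around[OF assms(1-3) x] .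
    have "(?F has_vector_derivative f x) (at x within {l..r})"
      using lr assms(4) by (intro interval_integral_FTC2) (auto intro: continuous_on_subset)
    moreover have "at x within {l..r} = at x"
      using lr by (intro at_within_interior) auto
    ultimately show ?thesis
      by (simp add: has_real_derivative_iff_has_vector_derivative)
  qed
  then show thesis
    by (intro that[of "\<lambda>u. ?F u + c"]) (auto intro!: derivative_eq_intros)
qed

lemma bound_from_derivative_bound_right:
  fixes F :: "real \<Rightarrow> real"
  assumes "\<And>t. t \<in> {x0..x} \<Longrightarrow> (F has_real_derivative F' t) (at t)"
    and "F x0 = 0" and "x0 \<le> x"
    and "\<And>t. t \<in> {x0..x} \<Longrightarrow> \<bar>F' t\<bar> \<le> M * (t - x0) ^ m"
  shows "\<bar>F x\<bar> \<le> M * (x - x0) ^ Suc m / real (Suc m)"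
proof -
  let ?G = "\<lambda>t. M * (t - x0) ^ Suc m / real (Suc m)"
  have dG: "(?G has_real_derivative M * (t - x0) ^ m) (at t)" for t
    by (rule derivative_eq_intros refl | simp)+
  have "?G x0 - F x0 \<le> ?G x - F x"
  proof (rule DERIV_nonneg_imp_nondecreasing[OF assms(3)])
    fix t assume "x0 \<le> t" "t \<le> x"
    then show "\<exists>y. ((\<lambda>t. ?G t - F t) has_real_derivative y) (at t) \<and> y \<ge> 0"
      using DERIV_diff[OF dG assms(1)[of t]] assms(4)[of t] by (force simp: abs_le_iff)
  qed
  moreover have "?G x0 + F x0 \<le> ?G x + F x"
  proof (rule DERIV_nonneg_imp_nondecreasing[OF assms(3)])
    fix t assume "x0 \<le> t" "t \<le> x"
    then show "\<exists>y. ((\<lambda>t. ?G t + F t) has_real_derivative y) (at t) \<and> y \<ge> 0"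
      using DERIV_add[OF dG assms(1)[of t]] assms(4)[of t] by (force simp: abs_le_iff)
  qed
  ultimately show ?thesis
    using assms(2) by (simp add: abs_le_iff)
qed

lemma bound_from_derivative_bound:
  fixes F :: "real \<Rightarrow> real"
  assumes "\<And>t. t \<in> {l..r} \<Longrightarrow> (F has_real_derivative F' t) (at t)"
    and "F x0 = 0" and "x0 \<in> {l..r}"
    and "\<And>t. t \<in> {l..r} \<Longrightarrow> \<bar>F' t\<bar> \<le> M * \<bar>t - x0\<bar> ^ m"
    and "x \<in> {l..r}"
  shows "\<bar>F x\<bar> \<le> M * \<bar>x - x0\<bar> ^ Suc m / real (Suc m)"
proof (cases "x0 \<le> x")
  case True
  have "\<bar>F x\<bar> \<le> M * (x - x0) ^ Suc m / real (Suc m)"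
  proof (rule bound_from_derivative_bound_right[where F = F and F' = F'])
    show "(F has_real_derivative F' t) (at t)" if "t \<in> {x0..x}" for t
      using that assms by auto
    show "\<bar>F' t\<bar> \<le> M * (t - x0) ^ m" if "t \<in> {x0..x}" for t
      using that assms(3,5) assms(4)[of t] by auto
  qed (use assms(2) True in auto)
  then show ?thesis using True by simp
next
  case False
  have "\<bar>F (- (- x))\<bar> \<le> M * (- x - - x0) ^ Suc m / real (Suc m)"
  proof (rule bound_from_derivative_bound_right[of "- x0" "- x" "\<lambda>t. F (- t)" "\<lambda>t. - F' (- t)"])
    fix t assume t: "t \<in> {- x0..- x}"
    then have t': "- t \<in> {l..r}" using assms by auto
    show "((\<lambda>t. F (- t)) has_real_derivative - F' (- t)) (at t)"
      using DERIV_mirror[of F "F' (- t)" "t"] assms(1)[OF t'] by simp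
    show "\<bar>- F' (- t)\<bar> \<le> M * (t - - x0) ^ m"
    proof -
      have "\<bar>- t - x0\<bar> = t - - x0" using t by auto
      with assms(4)[OF t'] show ?thesis by (simp only: abs_minus_cancel)
    qed
  qed (use assms(2) False in simp_all)
  moreover have "- x - - x0 = \<bar>x - x0\<bar>" using False by simp
  ultimately show ?thesis by (simp only: minus_minus)
qed

text \<open>Picard iteration written as a series: its terms \<open>v\<^sub>m\<close> satisfy \<open>v\<^sub>m\<^sub>+\<^sub>1' = A v\<^sub>m\<close> on the whole of
  \<open>I\<close>, and on compact subintervals \<open>\<bar>v\<^sub>m\<bar> \<le> B (L \<bar>x - x\<^sub>0\<bar>)\<^sup>m / m!\<close>. The sum is therefore
  defined on all of \<open>I\<close> at once, and no gluing of local solutions takes place.\<close>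

lemma linear_system_exists:
  fixes I :: "real set" and b :: "nat \<Rightarrow> real"
  assumes "open I" and "is_interval I" and "x0 \<in> I"
    and cont: "\<And>i j. i < n \<Longrightarrow> j < n \<Longrightarrow> continuous_on I (A i j)"
  obtains u where "solves_linear_system I n A u" and "\<And>i. i < n \<Longrightarrow> u i x0 = b i"
proof -
  define step where "step v i x = (\<Sum>j<n. A i j x * v j x)" for v :: "nat \<Rightarrow> real \<Rightarrow> real" and i x
  have next_ex: "\<exists>w. (\<forall>i<n. continuous_on I (w i)) \<and>
      (\<forall>i<n. w i x0 = 0 \<and> (\<forall>x\<in>I. (w i has_real_derivative step v i x) (at x)))"
    if v: "\<forall>i<n. continuous_on I (v i)" for v
  proof -
    have "\<exists>F. F x0 = 0 \<and> (\<forall>x\<in>I. (F has_real_derivative step v i x) (at x))" if "i < n" for i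
    proof -
      have "continuous_on I (step v i)"
        unfolding step_def using v cont that by (intro continuous_intros) auto
      then show ?thesis
        using antiderivative_on_open_interval[OF assms(1-3)] by metis
    qed
    then obtain w where w: "\<forall>i<n. w i x0 = 0 \<and> (\<forall>x\<in>I. (w i has_real_derivative step v i x) (at x))"
      by metis
    moreover have "continuous_on I (w i)" if "i < n" for i
      using w that by (auto intro!: continuous_at_imp_continuous_on DERIV_isCont)
    ultimately show ?thesis by blast
  qed
  have "\<exists>v. \<forall>m. ((\<forall>i<n. continuous_on I (v m i)) \<and> (m = 0 \<longrightarrow> v m = (\<lambda>i x. b i))) \<and>
      (\<forall>i<n. v (Suc m) i x0 = 0 \<and> (\<forall>x\<in>I. (v (Suc m) i has_real_derivative step (v m) i x) (at x)))"
  proof (rule dependent_nat_choice)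
    show "\<exists>v. (\<forall>i<n. continuous_on I (v i)) \<and> (0 = (0::nat) \<longrightarrow> v = (\<lambda>i x. b i))"
      by (intro exI[of _ "\<lambda>i x. b i"]) simp
    fix v and m :: nat
    assume "(\<forall>i<n. continuous_on I (v i)) \<and> (m = 0 \<longrightarrow> v = (\<lambda>i x. b i))"
    then have "\<forall>i<n. continuous_on I (v i)" by (rule conjunct1)
    from next_ex[OF this]
    show "\<exists>w. ((\<forall>i<n. continuous_on I (w i)) \<and> (Suc m = 0 \<longrightarrow> w = (\<lambda>i x. b i))) \<and>
        (\<forall>i<n. w i x0 = 0 \<and> (\<forall>x\<in>I. (w i has_real_derivative step v i x) (at x)))"
      by simp
  qed
  then obtain v where "\<forall>m. ((\<forall>i<n. continuous_on I (v m i)) \<and> (m = 0 \<longrightarrow> v m = (\<lambda>i x. b i))) \<and>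
      (\<forall>i<n. v (Suc m) i x0 = 0 \<and> (\<forall>x\<in>I. (v (Suc m) i has_real_derivative step (v m) i x) (at x)))"
    by (rule exE)
  note v = spec[OF this]
  have v0: "v 0 = (\<lambda>i x. b i)"
    using v[of 0] by simp
  have v_init: "v (Suc m) i x0 = 0" if "i < n" for m i
    using v[of m] that by simp
  have v_deriv: "(v (Suc m) i has_real_derivative step (v m) i x) (at x)" if "i < n" "x \<in> I" for m i x
    using v[of m] that by simp
  define u where "u i x = (\<Sum>m. v m i x)" for i x
  show thesis
  proof (rule that[of u])
    show "u i x0 = b i" if "i < n" for i
    proof -
      have "(\<lambda>m. v m i x0) = (\<lambda>m. if m = 0 then b i else 0)"
        using v0 v_init[OF that] by (auto simp: fun_eq_iff gr0_conv_Suc)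
      then show ?thesis
        using sums_unique[OF sums_single[of 0 "\<lambda>_. b i"]] by (simp add: u_def)
    qed
    have "(u i has_real_derivative (\<Sum>j<n. A i j x * u j x)) (at x)" if "i < n" and x: "x \<in> I" for i x
    proof -
      obtain l r where lr: "l < x0" "x0 < r" "l < x" "x < r" "{l..r} \<subseteq> I"
        using compact_interval_around[OF assms(1-3) x] .
      let ?J = "{l..r}"
      obtain K where K: "K \<ge> 0" "\<And>i j t. i < n \<Longrightarrow> j < n \<Longrightarrow> t \<in> ?J \<Longrightarrow> \<bar>A i j t\<bar> \<le> K"
        using bounded_matrix_on_compact[of ?J n A] cont lr(5)
        by (metis compact_Icc continuous_on_subset)
      define B where "B = (\<Sum>i<n. \<bar>b i\<bar>)"
      define L where "L = real n * K"
      have "L \<ge> 0" using K by (simp add: L_def)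
      have step_bound: "\<bar>step w i t\<bar> \<le> L * D"
        if "i < n" "t \<in> ?J" and w: "\<And>j. j < n \<Longrightarrow> \<bar>w j t\<bar> \<le> D" for w i t D
      proof -
        have "\<bar>step w i t\<bar> \<le> (\<Sum>j<n. \<bar>A i j t * w j t\<bar>)"
          unfolding step_def by (rule sum_abs)
        also have "\<dots> \<le> (\<Sum>j<n. K * D)"
          using K that by (intro sum_mono) (auto simp: abs_mult intro!: mult_mono)
        finally show ?thesis by (simp add: L_def)
      qed
      have v_bound: "\<bar>v m i t\<bar> \<le> B * (L * \<bar>t - x0\<bar>) ^ m / fact m" if "i < n" "t \<in> ?J" for m i t
        using that
      proof (induction m arbitrary: i t)
        case 0
        then show ?case
          by (simp add: v0 B_def member_le_sum[of i "{..<n}" "\<lambda>i. \<bar>b i\<bar>"])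
      next
        case (Suc m)
        have "\<bar>v (Suc m) i t\<bar> \<le> (B * L ^ Suc m / fact m) * \<bar>t - x0\<bar> ^ Suc m / real (Suc m)"
        proof (rule bound_from_derivative_bound[where l = l and r = r])
          show "\<bar>step (v m) i s\<bar> \<le> (B * L ^ Suc m / fact m) * \<bar>s - x0\<bar> ^ m" if "s \<in> ?J" for s
          proof -
            have "\<bar>step (v m) i s\<bar> \<le> L * (B * (L * \<bar>s - x0\<bar>) ^ m / fact m)"
              by (rule step_bound[OF Suc.prems(1) that]) (rule Suc.IH[OF _ that])
            then show ?thesis by (simp add: power_mult_distrib mult_ac)
          qed
        qed (use Suc.prems lr v_init v_deriv in auto)
        then show ?case
          by (simp add: power_mult_distrib field_simps)
      qed
      define R where "R = r - l"
      have v_unif: "\<bar>v m i t\<bar> \<le> B * (L * R) ^ m / fact m" if "i < n" "t \<in> ?J" for m i t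
      proof -
        have "\<bar>t - x0\<bar> \<le> R" using that lr by (auto simp: R_def)
        then have "B * (L * \<bar>t - x0\<bar>) ^ m / fact m \<le> B * (L * R) ^ m / fact m"
          using \<open>L \<ge> 0\<close>
          by (intro divide_right_mono mult_left_mono power_mono) (auto simp: B_def sum_nonneg)
        then show ?thesis using v_bound[OF that, of m] by linarith
      qed
      have summ: "summable (\<lambda>m. B * (L * R) ^ m / fact m)"
        using summable_mult[OF summable_exp[of "L * R"], of B] by (simp add: field_simps)
      have v_summable: "summable (\<lambda>m. v m j t)" if "j < n" "t \<in> ?J" for j t
      proof (rule summable_comparison_test'[OF summ])
        show "norm (v m j t) \<le> B * (L * R) ^ m / fact m" for m
          using v_unif[OF that] by simp
      qed
      define v' where "v' m t = (case m of 0 \<Rightarrow> 0 | Suc m \<Rightarrow> step (v m) i t)" for m t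
      have "((\<lambda>x. \<Sum>m. v m i x) has_real_derivative (\<Sum>m. v' m x)) (at x)"
      proof (rule has_field_derivative_series'(2)[where S = ?J and ?x0.0 = x0])
        show "(v m i has_real_derivative v' m t) (at t within ?J)" if "t \<in> ?J" for m t
        proof (cases m)
          case 0
          then show ?thesis by (simp add: v0 v'_def)
        next
          case (Suc m')
          have "t \<in> I" using that lr(5) by blast
          from has_field_derivative_at_within[OF v_deriv[OF \<open>i < n\<close> this]]
          show ?thesis by (simp add: Suc v'_def)
        qed
        have "uniform_limit ?J (\<lambda>k t. \<Sum>m<k. v' m t) (\<lambda>t. \<Sum>m. v' m t) sequentially"
        proof (rule Weierstrass_m_test)
          show "norm (v' m t) \<le> (case m of 0 \<Rightarrow> 0 | Suc m \<Rightarrow> L * (B * (L * R) ^ m / fact m))"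
            if "t \<in> ?J" for m t
          proof (cases m)
            case 0
            then show ?thesis by (simp add: v'_def)
          next
            case (Suc m')
            have "\<bar>step (v m') i t\<bar> \<le> L * (B * (L * R) ^ m' / fact m')"
              by (rule step_bound[OF \<open>i < n\<close> that]) (rule v_unif[OF _ that])
            then show ?thesis by (simp add: Suc v'_def)
          qed
          show "summable (\<lambda>m. case m of 0 \<Rightarrow> 0 | Suc m \<Rightarrow> L * (B * (L * R) ^ m / fact m))"
            using summable_mult[OF summ, of L] by (subst summable_Suc_iff[symmetric]) simp
        qed
        then show "uniformly_convergent_on ?J (\<lambda>k t. \<Sum>m<k. v' m t)"
          by (auto simp: uniformly_convergent_on_def)
        show "summable (\<lambda>m. v m i x0)"
          using lr by (intro v_summable \<open>i < n\<close>) simp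
        show "x \<in> interior ?J" "x0 \<in> ?J" "convex ?J" using lr by simp_all
      qed
      moreover have "(\<Sum>m. v' m x) = (\<Sum>j<n. A i j x * u j x)"
      proof -
        have x: "x \<in> ?J" using lr by auto
        have s: "(\<lambda>m. step (v m) i x) sums (\<Sum>j<n. A i j x * u j x)"
          unfolding step_def u_def
          by (intro sums_sum sums_mult summable_sums v_summable[OF _ x]) auto
        have "(\<lambda>m. v' m x) sums ((\<Sum>j<n. A i j x * u j x) + v' 0 x)"
          by (rule sums_Suc) (use s in \<open>simp add: v'_def\<close>)
        then show ?thesis by (simp add: v'_def sums_iff)
      qed
      ultimately show ?thesis by (simp add: u_def[abs_def])
    qed
    then show "solves_linear_system I n A u"
      by (simp add: solves_linear_system_def)
  qed
qed

lemma linear_system_smooth: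
  assumes "open I" and A: "\<And>i j. i < n \<Longrightarrow> j < n \<Longrightarrow> smooth_on I (A i j)"
    and sol: "solves_linear_system I n A u" and "i < n"
  shows "smooth_on I (u i)"
proof -
  have "higher_differentiable_on I (u i) k" if "i < n" for k i
    using that
  proof (induction k arbitrary: i)
    case 0
    then show ?case
      using sol by (auto simp: solves_linear_system_def
          intro!: continuous_at_imp_continuous_on DERIV_isCont)
  next
    case (Suc k)
    have sums: "higher_differentiable_on I (\<lambda>x. \<Sum>j<m. A i j x * u j x) k" if "m \<le> n" for m
      using that
    proof (induction m)
      case 0
      then show ?case by (simp add: higher_differentiable_on_const)
    next
      case (Suc m)
      then show ?case
        using A[OF \<open>i < n\<close>, of m] \<open>\<And>i. i < n \<Longrightarrow> higher_differentiable_on I (u i) k\<close>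
        by (auto simp: smooth_on_def
            intro!: higher_differentiable_on_add higher_differentiable_on_mult \<open>open I\<close>)
    qed
    show ?case
    proof (rule higher_differentiable_on_SucI[OF \<open>open I\<close>])
      show "(u i has_derivative (*) (\<Sum>j<n. A i j x * u j x)) (at x)" if "x \<in> I" for x
        using sol Suc.prems that by (auto simp: solves_linear_system_def has_field_derivative_def)
      show "higher_differentiable_on I (\<lambda>x. (\<Sum>j<n. A i j x * u j x) * v) k" for v
        by (intro higher_differentiable_on_mult \<open>open I\<close> higher_differentiable_on_const sums) simp
    qed
  qed
  then show ?thesis using \<open>i < n\<close> by (simp add: smooth_on_def)
qed

text \<open>The companion system of \<open>y\<^sup>(\<^sup>n\<^sup>) = \<Sum>\<^sub>j\<^sub><\<^sub>n a\<^sub>j y\<^sup>(\<^sup>j\<^sup>)\<close>.\<close>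

definition companion :: "nat \<Rightarrow> (nat \<Rightarrow> real \<Rightarrow> real) \<Rightarrow> nat \<Rightarrow> nat \<Rightarrow> real \<Rightarrow> real" where
  "companion n a i j x = (if Suc i = n then a j x else if j = Suc i then 1 else 0)"

lemma smooth_on_companion:
  assumes "\<And>j. j < n \<Longrightarrow> smooth_on I (a j)" and "j < n"
  shows "smooth_on I (companion n a i j)"
  using assms unfolding companion_def[abs_def]
  by (cases "Suc i = n"; cases "j = Suc i") (simp_all add: smooth_on_const)

lemma companion_sum:
  assumes "i < n"
  shows "(\<Sum>j<n. companion n a i j x * u j) = (if Suc i = n then \<Sum>j<n. a j x * u j else u (Suc i))"
proof (cases "Suc i = n")
  case False
  with assms have "Suc i < n" by simp
  with False show ?thesis by (simp add: companion_def if_distrib[of "\<lambda>z. z * _"] cong: if_cong)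
qed (simp add: companion_def)

lemma linear_ode_solution_unique:
  fixes y :: "real \<Rightarrow> real"
  assumes I: "open I" "is_interval I" "x0 \<in> I" and a: "\<And>j. j < n \<Longrightarrow> smooth_on I (a j)"
    and y: "smooth_on I y"
    and ode: "\<And>x. x \<in> I \<Longrightarrow> (deriv ^^ n) y x = (\<Sum>j<n. a j x * (deriv ^^ j) y x)"
    and init: "\<And>j. j < n \<Longrightarrow> (deriv ^^ j) y x0 = 0"
    and "x \<in> I" and "n > 0"
  shows "y x = 0"
proof -
  have "solves_linear_system I n (companion n a) (\<lambda>j. (deriv ^^ j) y)"
    unfolding solves_linear_system_def
  proof (intro allI impI ballI)
    fix i x assume "i < n" "x \<in> I"
    then show "((deriv ^^ i) y has_real_derivative
        (\<Sum>j<n. companion n a i j x * (deriv ^^ j) y x)) (at x)"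
      using smooth_on_has_real_derivative[OF I(1) y, of x i] ode[of x] by (auto simp: companion_sum)
  qed
  from linear_system_unique[OF I _ this init \<open>x \<in> I\<close> \<open>n > 0\<close>]
  show ?thesis
    using smooth_on_imp_continuous_on[OF smooth_on_companion] a by simp
qed

lemma linear_ode_solution_exists:
  fixes b :: "nat \<Rightarrow> real"
  assumes I: "open I" "is_interval I" "x0 \<in> I" and a: "\<And>j. j < n \<Longrightarrow> smooth_on I (a j)"
    and "n > 0"
  obtains y where "smooth_on I y"
    and "\<And>x. x \<in> I \<Longrightarrow> (deriv ^^ n) y x = (\<Sum>j<n. a j x * (deriv ^^ j) y x)"
    and "\<And>j. j < n \<Longrightarrow> (deriv ^^ j) y x0 = b j"
proof -
  have sm: "smooth_on I (companion n a i j)" if "i < n" "j < n" for i j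
    using smooth_on_companion a that by blast
  obtain u where u: "solves_linear_system I n (companion n a) u" "\<And>i. i < n \<Longrightarrow> u i x0 = b i"
  proof (rule linear_system_exists[OF I, where n = n and A = "companion n a" and b = b])
    show "continuous_on I (companion n a i j)" if "i < n" "j < n" for i j
      by (rule smooth_on_imp_continuous_on[OF sm[OF that]])
  qed blast
  define d where "d i x = (if i < n then u i x else \<Sum>j<n. a j x * u j x)" for i x
  have d_u: "d i = u i" if "i < n" for i using that by (simp add: d_def fun_eq_iff)
  have "(d j has_real_derivative d (Suc j) x) (at x)" if "j < n" "x \<in> I" for j x
  proof -
    have "(u j has_real_derivative (\<Sum>i<n. companion n a j i x * u i x)) (at x)"
      using u(1) that by (simp add: solves_linear_system_def)
    moreover have "(\<Sum>i<n. companion n a j i x * u i x) = d (Suc j) x"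
      using that by (auto simp: companion_sum d_def)
    ultimately show ?thesis using d_u[OF that(1)] by simp
  qed
  then have jets: "(deriv ^^ k) (d 0) x = d k x" if "k \<le> n" "x \<in> I" for k x
    using funpow_deriv_unique[OF I(1), of k d x] that by simp
  show thesis
  proof (rule that[of "d 0"])
    show "smooth_on I (d 0)"
      using linear_system_smooth[OF I(1) sm u(1) \<open>n > 0\<close>] d_u[OF \<open>n > 0\<close>] by simp
    show "(deriv ^^ n) (d 0) x = (\<Sum>j<n. a j x * (deriv ^^ j) (d 0) x)" if "x \<in> I" for x
      using jets that by (simp add: d_def[of n])  (simp add: d_u)
    show "(deriv ^^ j) (d 0) x0 = b j" if "j < n" for j
      using jets[of j x0] that I(3) u(2) d_u by simp
  qed
qed

section \<open>Total derivatives and the prolongation formula\<close>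

text \<open>A pointwise derivative predicate for jet functions, so that total derivatives can be computed
  by introduction rules in the style of \<open>derivative_eq_intros\<close>.\<close>

definition has_total_deriv :: "nat \<Rightarrow> jet_fun \<Rightarrow> real \<Rightarrow> real \<Rightarrow> (nat \<Rightarrow> real) \<Rightarrow> bool" where
  "has_total_deriv n F d x u \<longleftrightarrow>
     (\<exists>a b. ((\<lambda>t. F t u) has_real_derivative a) (at x) \<and>
       (\<forall>k\<le>n. ((\<lambda>t. F x (u(k := t))) has_real_derivative b k) (at (u k))) \<and>
       d = a + (\<Sum>k\<le>n. u (Suc k) * b k))"

lemma has_total_derivI:
  assumes "((\<lambda>t. F t u) has_real_derivative a) (at x)"
    and "\<And>k. k \<le> n \<Longrightarrow> ((\<lambda>t. F x (u(k := t))) has_real_derivative b k) (at (u k))"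
    and "d = a + (\<Sum>k\<le>n. u (Suc k) * b k)"
  shows "has_total_deriv n F d x u"
  using assms unfolding has_total_deriv_def by blast

lemma has_total_derivE:
  assumes "has_total_deriv n F d x u"
  obtains a b where "((\<lambda>t. F t u) has_real_derivative a) (at x)"
    and "\<And>k. k \<le> n \<Longrightarrow> ((\<lambda>t. F x (u(k := t))) has_real_derivative b k) (at (u k))"
    and "d = a + (\<Sum>k\<le>n. u (Suc k) * b k)"
  using assms unfolding has_total_deriv_def by blast

lemma total_deriv_eq:
  assumes "has_total_deriv n F d x u"
  shows "total_deriv n F x u = d"
  using assms
  by (elim has_total_derivE)
    (auto simp: total_deriv_def jet_partial_x_def jet_partial_def DERIV_imp_deriv intro!: sum.cong)

lemma has_total_deriv_cong:
  assumes "open I" and "x \<in> I" and "\<And>t v. t \<in> I \<Longrightarrow> F t v = G t v"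
    and "has_total_deriv n F d x u"
  shows "has_total_deriv n G d x u"
  using assms(4)
proof (elim has_total_derivE, intro has_total_derivI)
  fix a assume "((\<lambda>t. F t u) has_real_derivative a) (at x)"
  from has_field_derivative_transform_within_open[OF this assms(1,2)] assms(3)
  show "((\<lambda>t. G t u) has_real_derivative a) (at x)" by simp
next
  fix b k assume "k \<le> n"
    and "\<And>k. k \<le> n \<Longrightarrow> ((\<lambda>t. F x (u(k := t))) has_real_derivative b k) (at (u k))"
  then show "((\<lambda>t. G x (u(k := t))) has_real_derivative b k) (at (u k))"
    using assms(2,3) by simp
qed

lemma has_total_deriv_add:
  assumes "has_total_deriv n F d x u" and "has_total_deriv n G e x u"
  shows "has_total_deriv n (\<lambda>x u. F x u + G x u) (d + e) x u"
  using assms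
proof (elim has_total_derivE)
  fix a b a' b'
  assume F: "((\<lambda>t. F t u) has_real_derivative a) (at x)"
      "\<And>k. k \<le> n \<Longrightarrow> ((\<lambda>t. F x (u(k := t))) has_real_derivative b k) (at (u k))"
      "d = a + (\<Sum>k\<le>n. u (Suc k) * b k)"
    and G: "((\<lambda>t. G t u) has_real_derivative a') (at x)"
      "\<And>k. k \<le> n \<Longrightarrow> ((\<lambda>t. G x (u(k := t))) has_real_derivative b' k) (at (u k))"
      "e = a' + (\<Sum>k\<le>n. u (Suc k) * b' k)"
  show ?thesis
    by (rule has_total_derivI[OF DERIV_add[OF F(1) G(1)] DERIV_add[OF F(2) G(2)]])
      (simp_all add: F(3) G(3) algebra_simps sum.distrib)
qed

lemma has_total_deriv_mult:
  assumes "has_total_deriv n F d x u" and "has_total_deriv n G e x u"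
  shows "has_total_deriv n (\<lambda>x u. F x u * G x u) (d * G x u + e * F x u) x u"
  using assms
proof (elim has_total_derivE)
  fix a b a' b'
  assume F: "((\<lambda>t. F t u) has_real_derivative a) (at x)"
      "\<And>k. k \<le> n \<Longrightarrow> ((\<lambda>t. F x (u(k := t))) has_real_derivative b k) (at (u k))"
      "d = a + (\<Sum>k\<le>n. u (Suc k) * b k)"
    and G: "((\<lambda>t. G t u) has_real_derivative a') (at x)"
      "\<And>k. k \<le> n \<Longrightarrow> ((\<lambda>t. G x (u(k := t))) has_real_derivative b' k) (at (u k))"
      "e = a' + (\<Sum>k\<le>n. u (Suc k) * b' k)"
  show ?thesis
    by (rule has_total_derivI[OF DERIV_mult[OF F(1) G(1)] DERIV_mult[OF F(2) G(2)]])
      (simp_all add: F(3) G(3) algebra_simps sum.distrib sum_distrib_left)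
qed

lemma has_total_deriv_base:
  assumes "((\<lambda>t. \<phi> (t, u 0)) has_real_derivative a) (at x)"
    and "((\<lambda>t. \<phi> (x, t)) has_real_derivative b) (at (u 0))"
  shows "has_total_deriv n (\<lambda>x u. \<phi> (x, u 0)) (a + u 1 * b) x u"
proof (rule has_total_derivI)
  show "((\<lambda>t. \<phi> (t, u 0)) has_real_derivative a) (at x)" by fact
  show "((\<lambda>t. \<phi> (x, (u(k := t)) 0)) has_real_derivative (if k = 0 then b else 0)) (at (u k))" for k
    using assms(2) by simp
  show "a + u 1 * b = a + (\<Sum>k\<le>n. u (Suc k) * (if k = 0 then b else 0))"
    by (simp add: if_distrib[of "\<lambda>z. _ * z"] cong: if_cong)
qed

lemma has_total_deriv_coordinate:
  assumes "m \<le> n"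
  shows "has_total_deriv n (\<lambda>x u. u m) (u (Suc m)) x u"
proof (rule has_total_derivI)
  show "((\<lambda>t. u m) has_real_derivative 0) (at x)" by simp
  show "((\<lambda>t. (u(k := t)) m) has_real_derivative (if k = m then 1 else 0)) (at (u k))" for k
    by simp
  show "u (Suc m) = 0 + (\<Sum>k\<le>n. u (Suc k) * (if k = m then 1 else 0))"
    using assms by (simp add: if_distrib[of "\<lambda>z. _ * z"] cong: if_cong)
qed

lemma has_total_deriv_fun_of_x:
  assumes "(h has_real_derivative a) (at x)"
  shows "has_total_deriv n (\<lambda>x u. h x) a x u"
  using has_total_deriv_base[of "\<lambda>p. h (fst p)" u a x 0] assms by simp

lemma has_total_deriv_cmult:
  assumes "has_total_deriv n F d x u"
  shows "has_total_deriv n (\<lambda>x u. c * F x u) (c * d) x u"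
  using has_total_deriv_mult[OF has_total_deriv_fun_of_x[of "\<lambda>_. c" 0] assms] by (simp add: mult.commute)

lemma has_total_deriv_diff:
  assumes "has_total_deriv n F d x u" and "has_total_deriv n G e x u"
  shows "has_total_deriv n (\<lambda>x u. F x u - G x u) (d - e) x u"
  using has_total_deriv_add[OF assms(1) has_total_deriv_cmult[OF assms(2), of "- 1"]] by simp

lemma has_total_deriv_sum:
  fixes N :: nat
  assumes "\<And>i. i < N \<Longrightarrow> has_total_deriv n (F i) (d i) x u"
  shows "has_total_deriv n (\<lambda>x u. \<Sum>i<N. F i x u) (\<Sum>i<N. d i) x u"
  using assms
proof (induction N)
  case 0
  then show ?case using has_total_deriv_fun_of_x[of "\<lambda>_. 0" 0] by simp
next
  case (Suc N)
  then show ?case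
    using has_total_deriv_add[of n "\<lambda>x u. \<Sum>i<N. F i x u" _ x u "F N"] by simp
qed

text \<open>\<open>F\<close> is the sequence of iterated total derivatives of the function \<open>\<phi>\<close> on the plane, over \<open>I\<close>;
  the clause for all \<open>m \<ge> k\<close> expresses that \<open>F k\<close> has order at most \<open>k\<close>.\<close>

definition total_deriv_tower :: "real set \<Rightarrow> (real \<times> real \<Rightarrow> real) \<Rightarrow> (nat \<Rightarrow> jet_fun) \<Rightarrow> bool" where
  "total_deriv_tower I \<phi> F \<longleftrightarrow>
     (\<forall>x\<in>I. \<forall>u. F 0 x u = \<phi> (x, u 0)) \<and>
     (\<forall>k m u. \<forall>x\<in>I. k \<le> m \<longrightarrow> has_total_deriv m (F k) (F (Suc k) x u) x u)"

text \<open>This is the classical formula \<open>\<eta>\<^sup>(\<^sup>k\<^sup>) = D\<^sup>k(\<eta> - y' \<xi>) + \<xi> y\<^sup>(\<^sup>k\<^sup>+\<^sup>1\<^sup>)\<close>, with the powers of \<open>D\<close>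
  expanded by the Leibniz rule.\<close>

lemma prolong_coeff_eq:
  assumes "open I" and H: "total_deriv_tower I (\<lambda>p. snd (V p)) H"
    and X: "total_deriv_tower I (\<lambda>p. fst (V p)) X"
    and "x \<in> I"
  shows "prolong_coeff V k x u =
    H k x u - (\<Sum>j<k. real (k choose j) * (u (Suc j) * X (k - j) x u))"
  using assms(4)
proof (induction k arbitrary: x u)
  case 0
  then show ?case using H by (simp add: total_deriv_tower_def)
next
  case (Suc k)
  let ?P = "\<lambda>k x u. H k x u - (\<Sum>j<k. real (k choose j) * (u (Suc j) * X (k - j) x u))"
  let ?d = "H (Suc k) x u - (\<Sum>j<k. real (k choose j) *
    (u (Suc (Suc j)) * X (k - j) x u + X (Suc (k - j)) x u * u (Suc j)))"
  have "has_total_deriv k (?P k) ?d x u"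
    using H X Suc.prems
    by (intro has_total_deriv_diff has_total_deriv_sum has_total_deriv_cmult has_total_deriv_mult
        has_total_deriv_coordinate) (auto simp: total_deriv_tower_def)
  then have "has_total_deriv k (prolong_coeff V k) ?d x u"
    by (rule has_total_deriv_cong[OF \<open>open I\<close> Suc.prems, rotated]) (simp add: Suc.IH)
  moreover have "has_total_deriv 0 (\<lambda>x u. fst (V (x, u 0))) (X 1 x u) x u"
  proof (rule has_total_deriv_cong[OF \<open>open I\<close> Suc.prems])
    show "X 0 t v = fst (V (t, v 0))" if "t \<in> I" for t v
      using X that by (simp add: total_deriv_tower_def)
    show "has_total_deriv 0 (X 0) (X 1 x u) x u"
      using X Suc.prems by (simp add: total_deriv_tower_def)
  qed
  ultimately have "prolong_coeff V (Suc k) x u = ?d - u (Suc k) * X 1 x u"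
    by (simp add: total_deriv_eq)
  also have "\<dots> = ?P (Suc k) x u"
  proof -
    let ?t = "\<lambda>j. u (Suc j) * X (Suc k - j) x u"
    have "(\<Sum>j<Suc k. real (Suc k choose j) * ?t j)
        = ?t 0 + (\<Sum>j<k. real (Suc k choose Suc j) * ?t (Suc j))"
      by (subst sum.lessThan_Suc_shift) simp
    also have "\<dots> = ?t 0 + (\<Sum>j<k. real (k choose j) * ?t (Suc j))
        + (\<Sum>j<k. real (k choose Suc j) * ?t (Suc j))"
      by (simp add: sum.distrib algebra_simps)
    also have "\<dots> = (\<Sum>j<k. real (k choose j) * ?t (Suc j)) + (\<Sum>j<Suc k. real (k choose j) * ?t j)"
      by (subst sum.lessThan_Suc_shift[of _ k]) simp
    also have "\<dots> = (\<Sum>j<k. real (k choose j) *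
        (u (Suc (Suc j)) * X (k - j) x u + X (Suc (k - j)) x u * u (Suc j))) + u (Suc k) * X 1 x u"
      by (simp add: sum.distrib[symmetric] algebra_simps Suc_diff_le cong: sum.cong_simp)
    finally show ?thesis by simp
  qed
  finally show ?case .
qed

section \<open>Leading terms of iterated total derivatives\<close>

definition pdx :: "(real \<times> real \<Rightarrow> real) \<Rightarrow> real \<times> real \<Rightarrow> real" where
  "pdx \<phi> p = frechet_derivative \<phi> (at p) (1, 0)"

definition pdy :: "(real \<times> real \<Rightarrow> real) \<Rightarrow> real \<times> real \<Rightarrow> real" where
  "pdy \<phi> p = frechet_derivative \<phi> (at p) (0, 1)"

lemma smooth_on_pdx: "smooth_on S \<phi> \<Longrightarrow> smooth_on S (pdx \<phi>)"
  and smooth_on_pdy: "smooth_on S \<phi> \<Longrightarrow> smooth_on S (pdy \<phi>)"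
  unfolding pdx_def[abs_def] pdy_def[abs_def] by (rule smooth_on_frechet_derivative, assumption)+

lemma pdx_works:
  assumes "smooth_on S \<phi>" and "(x, y) \<in> S"
  shows "((\<lambda>t. \<phi> (t, y)) has_real_derivative pdx \<phi> (x, y)) (at x)"
proof -
  let ?L = "frechet_derivative \<phi> (at (x, y))"
  have d: "(\<phi> has_derivative ?L) (at (x, y))"
    using smooth_on_has_derivative[OF assms] .
  have "((\<lambda>t. (t, y)) has_derivative (\<lambda>h. (h, 0))) (at x)"
    by (intro derivative_eq_intros | simp)+
  from has_derivative_compose[OF this d]
  have c: "((\<lambda>t. \<phi> (t, y)) has_derivative (\<lambda>h. ?L (h, 0))) (at x)" .
  have "?L (h, 0) = ?L (1, 0) * h" for h
    using linear_scale[OF has_derivative_linear[OF d], of h "(1, 0)"] by (simp add: mult.commute)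
  then have "(\<lambda>h. ?L (h, 0)) = (*) (?L (1, 0))" by (rule ext)
  with c show ?thesis by (simp add: has_field_derivative_def pdx_def)
qed

lemma pdy_works:
  assumes "smooth_on S \<phi>" and "(x, y) \<in> S"
  shows "((\<lambda>t. \<phi> (x, t)) has_real_derivative pdy \<phi> (x, y)) (at y)"
proof -
  let ?L = "frechet_derivative \<phi> (at (x, y))"
  have d: "(\<phi> has_derivative ?L) (at (x, y))"
    using smooth_on_has_derivative[OF assms] .
  have "((\<lambda>t. (x, t)) has_derivative (\<lambda>h. (0, h))) (at y)"
    by (intro derivative_eq_intros | simp)+
  from has_derivative_compose[OF this d]
  have c: "((\<lambda>t. \<phi> (x, t)) has_derivative (\<lambda>h. ?L (0, h))) (at y)" .
  have "?L (0, h) = ?L (0, 1) * h" for h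
    using linear_scale[OF has_derivative_linear[OF d], of h "(0, 1)"] by (simp add: mult.commute)
  then have "(\<lambda>h. ?L (0, h)) = (*) (?L (0, 1))" by (rule ext)
  with c show ?thesis by (simp add: has_field_derivative_def pdy_def)
qed

lemma has_total_deriv_smooth:
  assumes "smooth_on (I \<times> UNIV) \<phi>" and "x \<in> I"
  shows "has_total_deriv n (\<lambda>x u. \<phi> (x, u 0)) (pdx \<phi> (x, u 0) + u 1 * pdy \<phi> (x, u 0)) x u"
  using assms by (intro has_total_deriv_base pdx_works pdy_works) auto

text \<open>A class for the remainder terms of lower order: polynomials in \<open>u\<^sub>1, \<dots>, u\<^sub>m\<close> whose coefficients
  are smooth functions of \<open>(x, u\<^sub>0)\<close>. A total derivative raises \<open>m\<close> by one, and coordinates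
  beyond \<open>u\<^sub>m\<close> do not enter.\<close>

inductive jet_poly :: "real set \<Rightarrow> nat \<Rightarrow> jet_fun \<Rightarrow> bool" for I :: "real set" and m :: nat where
  base: "smooth_on (I \<times> UNIV) \<phi> \<Longrightarrow> jet_poly I m (\<lambda>x u. \<phi> (x, u 0))"
| coordinate: "j \<le> m \<Longrightarrow> jet_poly I m (\<lambda>x u. u j)"
| add: "jet_poly I m F \<Longrightarrow> jet_poly I m G \<Longrightarrow> jet_poly I m (\<lambda>x u. F x u + G x u)"
| mult: "jet_poly I m F \<Longrightarrow> jet_poly I m G \<Longrightarrow> jet_poly I m (\<lambda>x u. F x u * G x u)"

lemma jet_poly_mono: "jet_poly I m F \<Longrightarrow> m \<le> n \<Longrightarrow> jet_poly I n F"
  by (induction rule: jet_poly.induct) (auto intro: jet_poly.intros)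

lemma jet_poly_const: "jet_poly I m (\<lambda>x u. c)"
  using jet_poly.base[OF smooth_on_const] .

lemma jet_poly_local:
  "jet_poly I m F \<Longrightarrow> (\<And>j. j \<le> m \<Longrightarrow> u j = v j) \<Longrightarrow> F x u = F x v"
  by (induction rule: jet_poly.induct) auto

lemma jet_poly_total_deriv:
  assumes "jet_poly I m F"
  shows "\<exists>G. jet_poly I (Suc m) G \<and> (\<forall>x\<in>I. \<forall>n\<ge>m. \<forall>u. has_total_deriv n F (G x u) x u)"
  using assms
proof (induction rule: jet_poly.induct)
  case (base \<phi>)
  show ?case
    using base by (intro exI[of _ "\<lambda>x u. pdx \<phi> (x, u 0) + u 1 * pdy \<phi> (x, u 0)"])
      (auto intro!: jet_poly.intros smooth_on_pdx smooth_on_pdy has_total_deriv_smooth[of I, simplified])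
next
  case (coordinate j)
  then show ?case
    by (intro exI[of _ "\<lambda>x u. u (Suc j)"]) (auto intro!: jet_poly.intros has_total_deriv_coordinate)
next
  case (add F G)
  then obtain F' G' where "jet_poly I (Suc m) F'" "jet_poly I (Suc m) G'"
    "\<forall>x\<in>I. \<forall>n\<ge>m. \<forall>u. has_total_deriv n F (F' x u) x u"
    "\<forall>x\<in>I. \<forall>n\<ge>m. \<forall>u. has_total_deriv n G (G' x u) x u" by blast
  then show ?case
    by (intro exI[of _ "\<lambda>x u. F' x u + G' x u"]) (auto intro!: jet_poly.add has_total_deriv_add)
next
  case (mult F G)
  then obtain F' G' where "jet_poly I (Suc m) F'" "jet_poly I (Suc m) G'"
    "\<forall>x\<in>I. \<forall>n\<ge>m. \<forall>u. has_total_deriv n F (F' x u) x u"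
    "\<forall>x\<in>I. \<forall>n\<ge>m. \<forall>u. has_total_deriv n G (G' x u) x u" by blast
  moreover have "jet_poly I (Suc m) F" "jet_poly I (Suc m) G"
    using mult.hyps jet_poly_mono by auto
  ultimately show ?case
    by (intro exI[of _ "\<lambda>x u. F' x u * G x u + G' x u * F x u"])
      (auto intro!: jet_poly.add jet_poly.mult has_total_deriv_mult)
qed

lemma total_deriv_tower_exists:
  assumes "smooth_on (I \<times> UNIV) \<phi>"
  obtains F where "total_deriv_tower I \<phi> F" and "\<And>k. jet_poly I k (F k)"
proof -
  have "\<exists>F. \<forall>k. (jet_poly I k (F k) \<and> (k = 0 \<longrightarrow> F k = (\<lambda>x u. \<phi> (x, u 0)))) \<and>
      (\<forall>x\<in>I. \<forall>n\<ge>k. \<forall>u. has_total_deriv n (F k) (F (Suc k) x u) x u)"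
  proof (rule dependent_nat_choice)
    show "\<exists>F. jet_poly I 0 F \<and> (0 = (0::nat) \<longrightarrow> F = (\<lambda>x u. \<phi> (x, u 0)))"
      using jet_poly.base[OF assms] by blast
    fix F :: jet_fun and k
    assume "jet_poly I k F \<and> (k = 0 \<longrightarrow> F = (\<lambda>x u. \<phi> (x, u 0)))"
    then show "\<exists>G. (jet_poly I (Suc k) G \<and> (Suc k = 0 \<longrightarrow> G = (\<lambda>x u. \<phi> (x, u 0)))) \<and>
        (\<forall>x\<in>I. \<forall>n\<ge>k. \<forall>u. has_total_deriv n F (G x u) x u)"
      using jet_poly_total_deriv[of I k F] by simp
  qed
  then obtain F where "\<forall>k. (jet_poly I k (F k) \<and> (k = 0 \<longrightarrow> F k = (\<lambda>x u. \<phi> (x, u 0)))) \<and>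
      (\<forall>x\<in>I. \<forall>n\<ge>k. \<forall>u. has_total_deriv n (F k) (F (Suc k) x u) x u)"
    by (rule exE)
  note F = spec[OF this]
  show thesis
  proof (rule that[of F])
    show "total_deriv_tower I \<phi> F"
      using F[of 0] F unfolding total_deriv_tower_def by simp
    show "jet_poly I k (F k)" for k using F[of k] by simp
  qed
qed

lemma total_deriv_tower_Suc:
  assumes "open I" and "total_deriv_tower I \<phi> F" and "x \<in> I"
    and "\<And>t v. t \<in> I \<Longrightarrow> F k t v = G t v" and "has_total_deriv k G d x u"
  shows "F (Suc k) x u = d"
proof -
  have "has_total_deriv k (F k) (F (Suc k) x u) x u"
    using assms(2,3) by (simp add: total_deriv_tower_def)
  moreover have "has_total_deriv k (F k) d x u"
    by (rule has_total_deriv_cong[OF assms(1,3) _ assms(5)]) (simp add: assms(4))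
  ultimately show ?thesis using total_deriv_eq by metis
qed

lemma total_deriv_tower_1:
  assumes "open I" and \<phi>: "smooth_on (I \<times> UNIV) \<phi>" and F: "total_deriv_tower I \<phi> F" and "x \<in> I"
  shows "F 1 x u = pdx \<phi> (x, u 0) + u 1 * pdy \<phi> (x, u 0)"
  unfolding One_nat_def
  by (rule total_deriv_tower_Suc[OF \<open>open I\<close> F \<open>x \<in> I\<close> _ has_total_deriv_smooth[OF \<phi> \<open>x \<in> I\<close>, unfolded One_nat_def]])
    (use F in \<open>simp add: total_deriv_tower_def\<close>)

lemma total_deriv_tower_2:
  assumes "open I" and \<phi>: "smooth_on (I \<times> UNIV) \<phi>" and F: "total_deriv_tower I \<phi> F" and "x \<in> I"
  shows "F 2 x u = pdx (pdx \<phi>) (x, u 0) + u 1 * (pdy (pdx \<phi>) (x, u 0) + pdx (pdy \<phi>) (x, u 0))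
    + u 1 * u 1 * pdy (pdy \<phi>) (x, u 0) + u 2 * pdy \<phi> (x, u 0)"
proof -
  have "F (Suc 1) x u = (pdx (pdx \<phi>) (x, u 0) + u 1 * pdy (pdx \<phi>) (x, u 0)) +
      (u (Suc 1) * pdy \<phi> (x, u 0) + (pdx (pdy \<phi>) (x, u 0) + u 1 * pdy (pdy \<phi>) (x, u 0)) * u 1)"
    by (rule total_deriv_tower_Suc[OF \<open>open I\<close> F \<open>x \<in> I\<close> total_deriv_tower_1[OF \<open>open I\<close> \<phi> F]])
      (intro has_total_deriv_add has_total_deriv_mult has_total_deriv_coordinate
        has_total_deriv_smooth[of I] smooth_on_pdx smooth_on_pdy \<phi> \<open>x \<in> I\<close> | simp)+
  then show ?thesis by (simp add: numeral_2_eq_2 algebra_simps)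
qed

text \<open>The two highest jet coordinates enter \<open>D\<^sup>k \<phi>\<close> linearly for \<open>k \<ge> 3\<close>. The coefficient of
  \<open>u\<^sub>k\<^sub>-\<^sub>1\<close> is split into a function of \<open>(x, u\<^sub>0)\<close> and \<open>k \<phi>\<^sub>y\<^sub>y u\<^sub>1\<close>, because later arguments
  compare coefficients of powers of \<open>u\<^sub>1\<close>.\<close>

lemma total_deriv_tower_leading:
  assumes "open I" and \<phi>: "smooth_on (I \<times> UNIV) \<phi>" and F: "total_deriv_tower I \<phi> F"
  shows "\<exists>\<beta> R. smooth_on (I \<times> UNIV) \<beta> \<and> jet_poly I (Suc m) R \<and>
    (\<forall>x\<in>I. \<forall>u. F (m + 3) x u = pdy \<phi> (x, u 0) * u (m + 3)
      + (\<beta> (x, u 0) + real (m + 3) * (u 1 * pdy (pdy \<phi>) (x, u 0))) * u (m + 2) + R x u)"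
proof (induction m)
  case 0
  let ?A = "pdx (pdx \<phi>)" and ?B = "\<lambda>p. pdy (pdx \<phi>) p + pdx (pdy \<phi>) p" and ?C = "pdy (pdy \<phi>)"
  note sm = smooth_on_pdx smooth_on_pdy \<phi>
  have S: "open (I \<times> (UNIV :: real set))" using \<open>open I\<close> by (simp add: open_Times)
  have B: "smooth_on (I \<times> UNIV) ?B" by (intro smooth_on_add S sm)
  let ?R = "\<lambda>x u. (pdx ?A (x, u 0) + u 1 * pdy ?A (x, u 0)) + u 1 * (pdx ?B (x, u 0) + u 1 * pdy ?B (x, u 0))
      + u 1 * u 1 * (pdx ?C (x, u 0) + u 1 * pdy ?C (x, u 0))"
  have "F (Suc 2) x u = pdy \<phi> (x, u 0) * u 3
      + ((?B (x, u 0) + pdx (pdy \<phi>) (x, u 0)) + 3 * (u 1 * ?C (x, u 0))) * u 2 + ?R x u"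
    if "x \<in> I" for x u
  proof -
    have "F (Suc 2) x u = (pdx ?A (x, u 0) + u 1 * pdy ?A (x, u 0)) +
        (u (Suc 1) * ?B (x, u 0) + (pdx ?B (x, u 0) + u 1 * pdy ?B (x, u 0)) * u 1) +
        ((u (Suc 1) * u 1 + u (Suc 1) * u 1) * ?C (x, u 0)
          + (pdx ?C (x, u 0) + u 1 * pdy ?C (x, u 0)) * (u 1 * u 1)) +
        (u (Suc 2) * pdy \<phi> (x, u 0) + (pdx (pdy \<phi>) (x, u 0) + u 1 * ?C (x, u 0)) * u 2)"
      by (rule total_deriv_tower_Suc[OF \<open>open I\<close> F that total_deriv_tower_2[OF \<open>open I\<close> \<phi> F]])
        (intro has_total_deriv_add has_total_deriv_mult has_total_deriv_coordinate
          has_total_deriv_smooth[of I] B sm that | simp)+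
    moreover have "Suc 1 = 2" "Suc 2 = 3" by simp_all
    ultimately show ?thesis by (simp only:) (simp add: algebra_simps)
  qed
  moreover have "jet_poly I (Suc 0) ?R"
    by (intro jet_poly.intros(3,4) jet_poly.base jet_poly.coordinate sm B) simp_all
  moreover have "smooth_on (I \<times> UNIV) (\<lambda>p. ?B p + pdx (pdy \<phi>) p)"
    by (intro smooth_on_add S sm)
  ultimately show ?case
    by (intro exI[of _ "\<lambda>p. ?B p + pdx (pdy \<phi>) p"] exI[of _ ?R]) (simp add: numeral_3_eq_3 numeral_2_eq_2)
next
  case (Suc m)
  then obtain \<beta> R where \<beta>: "smooth_on (I \<times> UNIV) \<beta>" and R: "jet_poly I (Suc m) R"
    and Fm: "\<And>x u. x \<in> I \<Longrightarrow> F (m + 3) x u = pdy \<phi> (x, u 0) * u (m + 3)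
      + (\<beta> (x, u 0) + real (m + 3) * (u 1 * pdy (pdy \<phi>) (x, u 0))) * u (m + 2) + R x u"
    by blast
  obtain R' where R': "jet_poly I (Suc (Suc m)) R'"
    "\<And>x n u. x \<in> I \<Longrightarrow> Suc m \<le> n \<Longrightarrow> has_total_deriv n R (R' x u) x u"
    using jet_poly_total_deriv[OF R] by blast
  note sm = smooth_on_pdx smooth_on_pdy \<phi> \<beta>
  let ?C = "pdy (pdy \<phi>)"
  let ?D\<beta> = "\<lambda>x u. (pdx \<beta> (x, u 0) + u 1 * pdy \<beta> (x, u 0)) + real (m + 3) * (u (Suc 1) * ?C (x, u 0)
          + (pdx ?C (x, u 0) + u 1 * pdy ?C (x, u 0)) * u 1)"
  let ?R = "\<lambda>x u. ?D\<beta> x u * u (m + 2) + R' x u"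
  have S: "open (I \<times> (UNIV :: real set))" using \<open>open I\<close> by (simp add: open_Times)
  have "F (Suc (m + 3)) x u = pdy \<phi> (x, u 0) * u (Suc (m + 3))
      + ((\<beta> (x, u 0) + pdx (pdy \<phi>) (x, u 0)) + real (Suc (m + 3)) * (u 1 * ?C (x, u 0))) * u (m + 3) + ?R x u"
    if "x \<in> I" for x u
  proof -
    have "F (Suc (m + 3)) x u =
        ((pdx (pdy \<phi>) (x, u 0) + u 1 * ?C (x, u 0)) * u (m + 3) + u (Suc (m + 3)) * pdy \<phi> (x, u 0)) +
        (?D\<beta> x u * u (m + 2) + u (Suc (m + 2)) * (\<beta> (x, u 0) + real (m + 3) * (u 1 * ?C (x, u 0)))) + R' x u"
      by (rule total_deriv_tower_Suc[OF \<open>open I\<close> F that Fm])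
        (intro has_total_deriv_add has_total_deriv_mult has_total_deriv_coordinate has_total_deriv_cmult
          has_total_deriv_smooth[of I] R'(2) sm that | simp)+
    moreover have "Suc (m + 2) = m + 3" by simp
    ultimately show ?thesis by (simp only: of_nat_Suc) (simp add: algebra_simps)
  qed
  moreover have "jet_poly I (Suc (Suc m)) ?R"
    by (intro jet_poly.intros(3,4) jet_poly.base jet_poly.coordinate jet_poly_const sm R') simp_all
  moreover have "smooth_on (I \<times> UNIV) (\<lambda>p. \<beta> p + pdx (pdy \<phi>) p)"
    by (intro smooth_on_add S sm)
  moreover have "Suc m + 3 = Suc (m + 3)" "Suc m + 2 = m + 3" by simp_all
  ultimately show ?case
    by (intro exI[of _ "\<lambda>p. \<beta> p + pdx (pdy \<phi>) p"] exI[of _ ?R]) (simp only:, blast)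
qed

section \<open>Symmetries of the equation are affine in the dependent variable\<close>

lemma prolong_apply_linear_ode:
  assumes "x \<in> I" and c: "\<And>j. j < n \<Longrightarrow> (c j has_real_derivative c' j) (at x)"
  shows "prolong_apply n V (linear_ode n c) x u =
    fst (V (x, u 0)) * (\<Sum>j<n. c' j * u j) + prolong_coeff V n x u
      + (\<Sum>j<n. c j x * prolong_coeff V j x u)"
proof -
  have dx: "jet_partial_x (linear_ode n c) x u = (\<Sum>j<n. c' j * u j)"
    unfolding jet_partial_x_def linear_ode_def
    by (rule DERIV_imp_deriv) (use c in \<open>auto intro!: derivative_eq_intros sum.cong\<close>)
  have "jet_partial k (linear_ode n c) x u = (if k = n then 1 else c k x)" if "k \<le> n" for k
    unfolding jet_partial_def linear_ode_def
  proof (rule DERIV_imp_deriv)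
    have "((\<lambda>t. (u(k := t)) j) has_real_derivative (if j = k then 1 else 0)) (at (u k))" for j
      by simp
    then have "((\<lambda>t. (u(k := t)) n + (\<Sum>j<n. c j x * (u(k := t)) j)) has_real_derivative
        (if n = k then 1 else 0) + (\<Sum>j<n. c j x * (if j = k then 1 else 0))) (at (u k))"
      by (intro DERIV_add DERIV_sum DERIV_cmult)
    moreover have "(if n = k then 1 else 0) + (\<Sum>j<n. c j x * (if j = k then 1 else 0)) =
        (if k = n then 1 else c k x)"
      using that by (simp add: if_distrib[of "\<lambda>z. _ * z"] cong: if_cong)
    ultimately show "((\<lambda>t. (u(k := t)) n + (\<Sum>j<n. c j x * (u(k := t)) j)) has_real_derivative
        (if k = n then 1 else c k x)) (at (u k))" by (simp only:)
  qed
  then have "(\<Sum>k\<le>n. prolong_coeff V k x u * jet_partial k (linear_ode n c) x u)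
      = (\<Sum>k\<le>n. prolong_coeff V k x u * (if k = n then 1 else c k x))"
    by (intro sum.cong) simp_all
  also have "\<dots> = prolong_coeff V n x u + (\<Sum>j<n. c j x * prolong_coeff V j x u)"
    by (simp add: lessThan_Suc_atMost[symmetric] mult.commute)
  finally show ?thesis by (simp add: prolong_apply_def dx)
qed

definition on_equation :: "(nat \<Rightarrow> real \<Rightarrow> real) \<Rightarrow> real \<Rightarrow> (nat \<Rightarrow> real) \<Rightarrow> bool" where
  "on_equation c x u \<longleftrightarrow> u 5 = - (c 0 x * u 0 + c 1 x * u 1 + c 2 x * u 2 + c 3 x * u 3 + c 4 x * u 4)"

lemma lessThan_numeral_sums:
  fixes f :: "nat \<Rightarrow> real"
  shows "(\<Sum>j<1. f j) = f 0" "(\<Sum>j<2. f j) = f 0 + f 1" "(\<Sum>j<3. f j) = f 0 + f 1 + f 2"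
    "(\<Sum>j<4. f j) = f 0 + f 1 + f 2 + f 3" "(\<Sum>j<5. f j) = f 0 + f 1 + f 2 + f 3 + f 4"
  by (simp_all add: eval_nat_numeral)

lemma infinitesimally_invariant_5_iff:
  assumes c: "\<forall>j<5. \<forall>x\<in>I. (c j has_real_derivative c' j x) (at x)"
    and "open I" and H: "total_deriv_tower I (\<lambda>p. snd (V p)) H"
    and X: "total_deriv_tower I (\<lambda>p. fst (V p)) X"
  shows "infinitesimally_invariant 5 I (linear_ode 5 c) V \<longleftrightarrow>
    (\<forall>x\<in>I. \<forall>u. on_equation c x u \<longrightarrow>
      X 0 x u * (c' 0 x * u 0 + c' 1 x * u 1 + c' 2 x * u 2 + c' 3 x * u 3 + c' 4 x * u 4)
      + (H 5 x u - (u 1 * X 5 x u + 5 * u 2 * X 4 x u + 10 * u 3 * X 3 x u + 10 * u 4 * X 2 x u + 5 * u 5 * X 1 x u))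
      + c 4 x * (H 4 x u - (u 1 * X 4 x u + 4 * u 2 * X 3 x u + 6 * u 3 * X 2 x u + 4 * u 4 * X 1 x u))
      + c 3 x * (H 3 x u - (u 1 * X 3 x u + 3 * u 2 * X 2 x u + 3 * u 3 * X 1 x u))
      + c 2 x * (H 2 x u - (u 1 * X 2 x u + 2 * u 2 * X 1 x u))
      + c 1 x * (H 1 x u - u 1 * X 1 x u)
      + c 0 x * H 0 x u = 0)"
  (is "_ \<longleftrightarrow> (\<forall>x\<in>I. \<forall>u. _ \<longrightarrow> ?C x u = 0)")
proof -
  have eqn: "linear_ode 5 c x u = 0 \<longleftrightarrow> on_equation c x u" for x u
    by (auto simp: linear_ode_def on_equation_def lessThan_numeral_sums)
  have crit: "prolong_apply 5 V (linear_ode 5 c) x u = ?C x u" if "x \<in> I" for x u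
  proof -
    have P: "prolong_coeff V k x u =
        H k x u - (\<Sum>j<k. real (k choose j) * (u (Suc j) * X (k - j) x u))" for k
      using prolong_coeff_eq[OF \<open>open I\<close> H X that] .
    have "fst (V (x, u 0)) = X 0 x u"
      using X that by (simp add: total_deriv_tower_def)
    then have "prolong_apply 5 V (linear_ode 5 c) x u = X 0 x u * (\<Sum>j<5. c' j x * u j)
        + prolong_coeff V 5 x u + (\<Sum>j<5. c j x * prolong_coeff V j x u)"
      using prolong_apply_linear_ode[OF that, of 5 c "\<lambda>j. c' j x" V u] c that by simp
    also have "\<dots> = ?C x u"
    proof -
      have "(5::nat) choose 2 = 10" "(5::nat) choose 3 = 10" "(5::nat) choose 4 = 5"
        "(4::nat) choose 2 = 6" "(4::nat) choose 3 = 4" "(3::nat) choose 2 = 3"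
        by (simp_all add: eval_nat_numeral)
      then show ?thesis
        unfolding lessThan_numeral_sums P by (simp add: numeral_2_eq_2[symmetric] lessThan_numeral_sums algebra_simps)
    qed
    finally show ?thesis .
  qed
  show ?thesis
    unfolding infinitesimally_invariant_def
    by (intro ball_cong refl) (simp only: eqn crit)
qed


text \<open>On the equation the invariance condition is affine in \<open>u\<^sub>4\<close>. Its slope is a polynomial in
  \<open>u\<^sub>1, u\<^sub>2\<close> (at \<open>u\<^sub>3 = 0\<close>) in which \<open>u\<^sub>2\<close> has the coefficient \<open>-15 \<xi>\<^sub>y\<close>.\<close>

lemma symmetry_fst_pdy_zero:
  assumes c: "\<forall>j<5. \<forall>x\<in>I. (c j has_real_derivative c' j x) (at x)"
    and "open I" and V: "smooth_on (I \<times> UNIV) V"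
    and inv: "infinitesimally_invariant 5 I (linear_ode 5 c) V" and x: "x \<in> I"
  shows "pdy (\<lambda>p. fst (V p)) (x, y) = 0"
proof -
  let ?\<xi> = "\<lambda>p. fst (V p)" and ?\<eta> = "\<lambda>p. snd (V p)"
  have S: "open (I \<times> (UNIV :: real set))" using \<open>open I\<close> by (simp add: open_Times)
  have \<xi>: "smooth_on (I \<times> UNIV) ?\<xi>" and \<eta>: "smooth_on (I \<times> UNIV) ?\<eta>"
    using smooth_on_bounded_linear[OF S bounded_linear_fst V]
      smooth_on_bounded_linear[OF S bounded_linear_snd V] by auto
  obtain H where H: "total_deriv_tower I ?\<eta> H" and HP: "\<And>k. jet_poly I k (H k)"
    using total_deriv_tower_exists[OF \<eta>] by blast
  obtain X where X: "total_deriv_tower I ?\<xi> X" and XP: "\<And>k. jet_poly I k (X k)"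
    using total_deriv_tower_exists[OF \<xi>] by blast
  obtain b5 R5 where H5: "jet_poly I 3 R5" "\<And>u. H 5 x u = pdy ?\<eta> (x, u 0) * u 5
      + (b5 (x, u 0) + 5 * (u 1 * pdy (pdy ?\<eta>) (x, u 0))) * u 4 + R5 x u"
    using total_deriv_tower_leading[OF \<open>open I\<close> \<eta> H, of 2] x by auto
  obtain b4 R4 where H4: "jet_poly I (Suc 1) R4" "\<And>u. H 4 x u = pdy ?\<eta> (x, u 0) * u 4
      + (b4 (x, u 0) + 4 * (u 1 * pdy (pdy ?\<eta>) (x, u 0))) * u 3 + R4 x u"
    using total_deriv_tower_leading[OF \<open>open I\<close> \<eta> H, of 1] x by (auto simp: eval_nat_numeral)
  obtain d5 Q5 where X5: "jet_poly I 3 Q5" "\<And>u. X 5 x u = pdy ?\<xi> (x, u 0) * u 5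
      + (d5 (x, u 0) + 5 * (u 1 * pdy (pdy ?\<xi>) (x, u 0))) * u 4 + Q5 x u"
    using total_deriv_tower_leading[OF \<open>open I\<close> \<xi> X, of 2] x by auto
  obtain d4 Q4 where X4: "jet_poly I (Suc 1) Q4" "\<And>u. X 4 x u = pdy ?\<xi> (x, u 0) * u 4
      + (d4 (x, u 0) + 4 * (u 1 * pdy (pdy ?\<xi>) (x, u 0))) * u 3 + Q4 x u"
    using total_deriv_tower_leading[OF \<open>open I\<close> \<xi> X, of 1] x by (auto simp: eval_nat_numeral)
  define w where "w s t r = - (c 0 x * y + c 1 x * s + c 2 x * t + c 4 x * r)" for s t r
  define u where "u s t r = (\<lambda>_ :: nat. 0)(0 := y, 1 := s, 2 := t, 4 := r, 5 := w s t r)" for s t r :: real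
  have u: "u s t r 0 = y" "u s t r 1 = s" "u s t r 2 = t" "u s t r 3 = 0" "u s t r 4 = r"
    "u s t r 5 = w s t r" for s t r by (simp_all add: u_def)
  have loc: "F x (u s t r) = F x (u s t 0)" if "jet_poly I k F" "k \<le> 3" for F k s t r
    by (rule jet_poly_local[OF that(1)]) (use that(2) in \<open>simp add: u_def\<close>)
  have zero: "X 0 x v * (c' 0 x * v 0 + c' 1 x * v 1 + c' 2 x * v 2 + c' 3 x * v 3 + c' 4 x * v 4)
      + (H 5 x v - (v 1 * X 5 x v + 5 * v 2 * X 4 x v + 10 * v 3 * X 3 x v + 10 * v 4 * X 2 x v + 5 * v 5 * X 1 x v))
      + c 4 x * (H 4 x v - (v 1 * X 4 x v + 4 * v 2 * X 3 x v + 6 * v 3 * X 2 x v + 4 * v 4 * X 1 x v))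
      + c 3 x * (H 3 x v - (v 1 * X 3 x v + 3 * v 2 * X 2 x v + 3 * v 3 * X 1 x v))
      + c 2 x * (H 2 x v - (v 1 * X 2 x v + 2 * v 2 * X 1 x v))
      + c 1 x * (H 1 x v - v 1 * X 1 x v)
      + c 0 x * H 0 x v = 0" if "v 5 = - (c 0 x * v 0 + c 1 x * v 1 + c 2 x * v 2 + c 3 x * v 3 + c 4 x * v 4)" for v
    using inv[unfolded infinitesimally_invariant_5_iff[OF c \<open>open I\<close> H X]] x that
    unfolding on_equation_def by blast
  define \<xi>y where "\<xi>y = pdy ?\<xi> (x, y)"
  (* The difference of the invariance conditions at r = 1 and r = 0. Functions of order at most 3
     take the same value at both jets, and u 5 changes by - c 4 x. *)
  have slope: "X 0 x (u s t 0) * c' 4 x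
      + (- pdy ?\<eta> (x, y) * c 4 x + b5 (x, y) + 5 * (s * pdy (pdy ?\<eta>) (x, y))
        - s * (- \<xi>y * c 4 x + d5 (x, y) + 5 * (s * pdy (pdy ?\<xi>) (x, y))) - 5 * t * \<xi>y
        - 10 * X 2 x (u s t 0) + 5 * c 4 x * X 1 x (u s t 0))
      + c 4 x * (pdy ?\<eta> (x, y) - s * \<xi>y - 4 * X 1 x (u s t 0)) = 0" for s t
  proof -
    have e: "u s t r 5 = - (c 0 x * u s t r 0 + c 1 x * u s t r 1 + c 2 x * u s t r 2
        + c 3 x * u s t r 3 + c 4 x * u s t r 4)" for r
      unfolding u w_def by simp
    note red = loc[OF H5(1), of s t 1] loc[OF H4(1), of s t 1] loc[OF X5(1), of s t 1] loc[OF X4(1), of s t 1]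
      loc[OF HP[of 0], of s t 1] loc[OF HP[of 1], of s t 1] loc[OF HP[of 2], of s t 1] loc[OF HP[of 3], of s t 1]
      loc[OF XP[of 0], of s t 1] loc[OF XP[of 1], of s t 1] loc[OF XP[of 2], of s t 1] loc[OF XP[of 3], of s t 1]
    have w1: "w s t 1 = w s t 0 - c 4 x" by (simp add: w_def)
    note z1 = zero[OF e[of 1], unfolded H5(2) H4(2) X5(2) X4(2) u, folded \<xi>y_def]
    note z0 = zero[OF e[of 0], unfolded H5(2) H4(2) X5(2) X4(2) u, folded \<xi>y_def]
    show ?thesis using z1 z0 red w1 by (simp add: algebra_simps)
  qed
  have X0: "X 0 x (u s t 0) = ?\<xi> (x, y)" for s t
    using X x u by (simp add: total_deriv_tower_def)
  note X1 = total_deriv_tower_1[OF \<open>open I\<close> \<xi> X x, of "u _ _ _", unfolded u]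
  note X2 = total_deriv_tower_2[OF \<open>open I\<close> \<xi> X x, of "u _ _ _", unfolded u]
  have "\<xi>y = 0"
    using slope[of 0 1] slope[of 0 0] unfolding X0 X1 X2 \<xi>y_def[symmetric] by (simp add: algebra_simps)
  then show ?thesis by (simp add: \<xi>y_def)
qed

lemma fun_of_x_total_deriv_tower:
  assumes "open I" and "smooth_on I a" and "\<And>x y. x \<in> I \<Longrightarrow> \<phi> (x, y) = a x"
  shows "total_deriv_tower I \<phi> (\<lambda>k x u. (deriv ^^ k) a x)"
  using assms smooth_on_has_real_derivative[OF assms(1,2)]
  by (auto simp: total_deriv_tower_def intro!: has_total_deriv_fun_of_x simp del: funpow.simps)

text \<open>With \<open>\<xi>\<close> a function of \<open>x\<close> alone, the slope in \<open>u\<^sub>4\<close> depends on \<open>u\<^sub>1\<close> through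
  \<open>5 \<eta>\<^sub>y\<^sub>y u\<^sub>1\<close> only.\<close>

lemma symmetry_snd_pdy_pdy_zero:
  assumes c: "\<forall>j<5. \<forall>x\<in>I. (c j has_real_derivative c' j x) (at x)"
    and "open I" and V: "smooth_on (I \<times> UNIV) V"
    and inv: "infinitesimally_invariant 5 I (linear_ode 5 c) V" and x: "x \<in> I"
    and a: "smooth_on I a" "\<And>x y. x \<in> I \<Longrightarrow> fst (V (x, y)) = a x"
  shows "pdy (pdy (\<lambda>p. snd (V p))) (x, y) = 0"
proof -
  let ?\<eta> = "\<lambda>p. snd (V p)" and ?X = "\<lambda>k x (u :: nat \<Rightarrow> real). (deriv ^^ k) a x"
  have S: "open (I \<times> (UNIV :: real set))" using \<open>open I\<close> by (simp add: open_Times)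
  have \<eta>: "smooth_on (I \<times> UNIV) ?\<eta>"
    using smooth_on_bounded_linear[OF S bounded_linear_snd V] .
  obtain H where H: "total_deriv_tower I ?\<eta> H" and HP: "\<And>k. jet_poly I k (H k)"
    using total_deriv_tower_exists[OF \<eta>] by blast
  have X: "total_deriv_tower I (\<lambda>p. fst (V p)) ?X"
    using fun_of_x_total_deriv_tower[OF \<open>open I\<close> a(1)] a(2) by simp
  obtain b5 R5 where H5: "jet_poly I 3 R5" "\<And>u. H 5 x u = pdy ?\<eta> (x, u 0) * u 5
      + (b5 (x, u 0) + 5 * (u 1 * pdy (pdy ?\<eta>) (x, u 0))) * u 4 + R5 x u"
    using total_deriv_tower_leading[OF \<open>open I\<close> \<eta> H, of 2] x by auto
  obtain b4 R4 where H4: "jet_poly I (Suc 1) R4" "\<And>u. H 4 x u = pdy ?\<eta> (x, u 0) * u 4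
      + (b4 (x, u 0) + 4 * (u 1 * pdy (pdy ?\<eta>) (x, u 0))) * u 3 + R4 x u"
    using total_deriv_tower_leading[OF \<open>open I\<close> \<eta> H, of 1] x by (auto simp: eval_nat_numeral)
  define w where "w s r = - (c 0 x * y + c 1 x * s + c 4 x * r)" for s r
  define u where "u s r = (\<lambda>_ :: nat. 0)(0 := y, 1 := s, 4 := r, 5 := w s r)" for s r :: real
  have u: "u s r 0 = y" "u s r 1 = s" "u s r 2 = 0" "u s r 3 = 0" "u s r 4 = r"
    "u s r 5 = w s r" for s r by (simp_all add: u_def)
  have loc: "F x (u s r) = F x (u s 0)" if "jet_poly I k F" "k \<le> 3" for F k s r
    by (rule jet_poly_local[OF that(1)]) (use that(2) in \<open>simp add: u_def\<close>)
  have zero: "?X 0 x v * (c' 0 x * v 0 + c' 1 x * v 1 + c' 2 x * v 2 + c' 3 x * v 3 + c' 4 x * v 4)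
      + (H 5 x v - (v 1 * ?X 5 x v + 5 * v 2 * ?X 4 x v + 10 * v 3 * ?X 3 x v + 10 * v 4 * ?X 2 x v + 5 * v 5 * ?X 1 x v))
      + c 4 x * (H 4 x v - (v 1 * ?X 4 x v + 4 * v 2 * ?X 3 x v + 6 * v 3 * ?X 2 x v + 4 * v 4 * ?X 1 x v))
      + c 3 x * (H 3 x v - (v 1 * ?X 3 x v + 3 * v 2 * ?X 2 x v + 3 * v 3 * ?X 1 x v))
      + c 2 x * (H 2 x v - (v 1 * ?X 2 x v + 2 * v 2 * ?X 1 x v))
      + c 1 x * (H 1 x v - v 1 * ?X 1 x v)
      + c 0 x * H 0 x v = 0" if "v 5 = - (c 0 x * v 0 + c 1 x * v 1 + c 2 x * v 2 + c 3 x * v 3 + c 4 x * v 4)" for v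
    using inv[unfolded infinitesimally_invariant_5_iff[OF c \<open>open I\<close> H X]] x that
    unfolding on_equation_def by blast
  define A where "A k = (deriv ^^ k) a x" for k
  (* Again the difference of the conditions at r = 1 and r = 0. *)
  have slope: "A 0 * c' 4 x + b5 (x, y) + 5 * (s * pdy (pdy ?\<eta>) (x, y)) - 10 * A 2 + c 4 x * A 1 = 0" for s
  proof -
    have e: "u s r 5 = - (c 0 x * u s r 0 + c 1 x * u s r 1 + c 2 x * u s r 2
        + c 3 x * u s r 3 + c 4 x * u s r 4)" for r
      unfolding u w_def by simp
    note red = loc[OF H5(1), of s 1] loc[OF H4(1), of s 1]
      loc[OF HP[of 0], of s 1] loc[OF HP[of 1], of s 1] loc[OF HP[of 2], of s 1] loc[OF HP[of 3], of s 1]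
    have w1: "w s 1 = w s 0 - c 4 x" by (simp add: w_def)
    note z1 = zero[OF e[of 1], unfolded H5(2) H4(2) u, folded A_def]
    note z0 = zero[OF e[of 0], unfolded H5(2) H4(2) u, folded A_def]
    show ?thesis using z1 z0 red w1 by (simp add: algebra_simps)
  qed
  show ?thesis using slope[of 1] slope[of 0] by simp
qed

definition affine_vf :: "real set \<Rightarrow> (real \<Rightarrow> real) \<Rightarrow> (real \<Rightarrow> real) \<Rightarrow> (real \<Rightarrow> real) \<Rightarrow> vector_field" where
  "affine_vf I a f g = (\<lambda>(x, y). if x \<in> I then (a x, f x * y + g x) else 0)"

lemma smooth_on_affine_vf:
  assumes "open I" and "smooth_on I a" and "smooth_on I f" and "smooth_on I g"
  shows "smooth_on (I \<times> UNIV) (affine_vf I a f g)"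
proof -
  have S: "open (I \<times> (UNIV :: real set))" using \<open>open I\<close> by (simp add: open_Times)
  have fst_smooth: "smooth_on (I \<times> UNIV) (\<lambda>p :: real \<times> real. h (fst p))"
    if "smooth_on I h" for h :: "real \<Rightarrow> real"
    by (rule smooth_on_compose_affine[OF S has_derivative_fst[OF has_derivative_ident] _ that]) auto
  have snd_smooth: "smooth_on (I \<times> UNIV) (\<lambda>p :: real \<times> real. snd p)"
    by (rule smooth_on_bounded_linear[OF S bounded_linear_snd smooth_on_ident[OF S]])
  show ?thesis
    by (rule smooth_on_cong[OF S, of "\<lambda>p. (a (fst p), f (fst p) * snd p + g (fst p))"])
      (auto simp: affine_vf_def intro!: smooth_on_Pair smooth_on_add smooth_on_mult S snd_smooth fst_smooth assms)
qed

lemma smooth_on_slice: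
  fixes \<phi> :: "real \<times> real \<Rightarrow> real"
  assumes "open I" and "smooth_on (I \<times> UNIV) \<phi>"
  shows "smooth_on I (\<lambda>x. \<phi> (x, y))"
proof (rule smooth_on_compose_affine[OF \<open>open I\<close> _ _ assms(2)])
  show "((\<lambda>x. (x, y)) has_derivative (\<lambda>h. (h, 0))) (at x)" for x
    by (intro derivative_eq_intros | simp)+
qed auto

lemma symmetry_is_affine:
  assumes c: "\<forall>j<5. \<forall>x\<in>I. (c j has_real_derivative c' j x) (at x)"
    and "open I" and V: "V \<in> symmetry_algebra 5 I (linear_ode 5 c)"
  obtains a f g where "smooth_on I a" and "smooth_on I f" and "smooth_on I g" and "V = affine_vf I a f g"
proof -
  let ?\<xi> = "\<lambda>p. fst (V p)" and ?\<eta> = "\<lambda>p. snd (V p)"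
  have sV: "smooth_on (I \<times> UNIV) V" and out: "\<And>p. p \<notin> I \<times> UNIV \<Longrightarrow> V p = 0"
    and inv: "infinitesimally_invariant 5 I (linear_ode 5 c) V"
    using V by (auto simp: symmetry_algebra_def)
  have S: "open (I \<times> (UNIV :: real set))" using \<open>open I\<close> by (simp add: open_Times)
  have \<xi>: "smooth_on (I \<times> UNIV) ?\<xi>" and \<eta>: "smooth_on (I \<times> UNIV) ?\<eta>"
    using smooth_on_bounded_linear[OF S bounded_linear_fst sV]
      smooth_on_bounded_linear[OF S bounded_linear_snd sV] by auto
  define a where "a x = ?\<xi> (x, 0)" for x
  define g where "g x = ?\<eta> (x, 0)" for x
  define f where "f x = pdy ?\<eta> (x, 0)" for x
  have a: "smooth_on I a"
    unfolding a_def[abs_def] using smooth_on_slice[OF \<open>open I\<close> \<xi>] .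
  have \<xi>a: "?\<xi> (x, y) = a x" if "x \<in> I" for x y
  proof -
    have "((\<lambda>t. ?\<xi> (x, t)) has_real_derivative 0) (at t)" for t
      using pdy_works[OF \<xi>, of x t] symmetry_fst_pdy_zero[OF c \<open>open I\<close> sV inv that] that by simp
    then show ?thesis using DERIV_isconst_all[of "\<lambda>t. ?\<xi> (x, t)" y 0] by (simp add: a_def)
  qed
  have \<eta>fg: "?\<eta> (x, y) = f x * y + g x" if "x \<in> I" for x y
  proof -
    have "((\<lambda>t. pdy ?\<eta> (x, t)) has_real_derivative 0) (at t)" for t
      using pdy_works[OF smooth_on_pdy[OF \<eta>], of x t]
        symmetry_snd_pdy_pdy_zero[OF c \<open>open I\<close> sV inv that a \<xi>a] that by simp
    then have "pdy ?\<eta> (x, t) = f x" for t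
      using DERIV_isconst_all[of "\<lambda>t. pdy ?\<eta> (x, t)" t 0] by (simp add: f_def)
    then have "((\<lambda>t. ?\<eta> (x, t)) has_real_derivative f x) (at t)" for t
      using pdy_works[OF \<eta>, of x t] that by simp
    then have "((\<lambda>t. ?\<eta> (x, t) - f x * t) has_real_derivative 0) (at t)" for t
      by (auto intro!: derivative_eq_intros)
    then show ?thesis
      using DERIV_isconst_all[of "\<lambda>t. ?\<eta> (x, t) - f x * t" y 0] by (simp add: g_def)
  qed
  have "V = affine_vf I a f g"
  proof (rule ext)
    fix p :: "real \<times> real"
    obtain x y where p: "p = (x, y)" by (cases p)
    show "V p = affine_vf I a f g p"
    proof (cases "x \<in> I")
      case True
      then show ?thesis
        using \<xi>a[of x y] \<eta>fg[of x y] by (simp add: p affine_vf_def prod_eq_iff)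
    next
      case False
      then show ?thesis using out[of p] by (simp add: p affine_vf_def)
    qed
  qed
  moreover have "smooth_on I f" "smooth_on I g"
    unfolding f_def[abs_def] g_def[abs_def]
    using smooth_on_slice[OF \<open>open I\<close> smooth_on_pdy[OF \<eta>]] smooth_on_slice[OF \<open>open I\<close> \<eta>] by auto
  ultimately show thesis using that a by blast
qed

section \<open>The determining equations and the relative invariants\<close>

definition is_jet :: "real set \<Rightarrow> (nat \<Rightarrow> real \<Rightarrow> real) \<Rightarrow> bool" where
  "is_jet I s \<longleftrightarrow> (\<forall>k. \<forall>x\<in>I. (s k has_real_derivative s (Suc k) x) (at x))"

lemma vanishing_derivative:
  fixes F :: "real \<Rightarrow> real"
  assumes "open I" and "x \<in> I" and "\<And>t. t \<in> I \<Longrightarrow> F t = 0" and "(F has_real_derivative d) (at x)"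
  shows "d = 0"
proof -
  have "((\<lambda>t. 0) has_real_derivative d) (at x)"
    using has_field_derivative_transform_within_open[OF assms(4,1,2)] assms(3) by simp
  then show ?thesis using DERIV_unique[OF _ DERIV_const] by blast
qed

lemma clear_denominator: "(d :: real) = c - w / n \<Longrightarrow> n \<noteq> 0 \<Longrightarrow> n * d = n * c - w"
  by (simp add: field_simps)

lemma mult_divide_eqI: "(w :: real) = v \<Longrightarrow> n \<noteq> 0 \<Longrightarrow> n * (w / n) = v"
  by simp

text \<open>\<open>det j\<close> below is the coefficient of \<open>u\<^sub>j\<close> in the invariance condition for the vector field
  \<open>a \<partial>\<^sub>x + (f y + g) \<partial>\<^sub>y\<close>. The arguments are jets: \<open>a k\<close>, \<open>f k\<close> and \<open>C j k\<close> are the \<open>k\<close>-th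
  derivatives of \<open>a\<close>, \<open>f\<close> and \<open>c\<^sub>j\<close>.\<close>

definition det4 :: "(nat \<Rightarrow> nat \<Rightarrow> real \<Rightarrow> real) \<Rightarrow> (nat \<Rightarrow> real \<Rightarrow> real) \<Rightarrow> (nat \<Rightarrow> real \<Rightarrow> real) \<Rightarrow> real \<Rightarrow> real" where
  "det4 C a f x = - 10 * a 2 x + 5 * f 1 x + a 0 x * C 4 1 x + a 1 x * C 4 0 x"

definition det3 :: "(nat \<Rightarrow> nat \<Rightarrow> real \<Rightarrow> real) \<Rightarrow> (nat \<Rightarrow> real \<Rightarrow> real) \<Rightarrow> (nat \<Rightarrow> real \<Rightarrow> real) \<Rightarrow> real \<Rightarrow> real" where
  "det3 C a f x = - 10 * a 3 x + 10 * f 2 x + a 0 x * C 3 1 x + 2 * a 1 x * C 3 0 x - 6 * a 2 x * C 4 0 x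
      + 4 * f 1 x * C 4 0 x"

definition det2 :: "(nat \<Rightarrow> nat \<Rightarrow> real \<Rightarrow> real) \<Rightarrow> (nat \<Rightarrow> real \<Rightarrow> real) \<Rightarrow> (nat \<Rightarrow> real \<Rightarrow> real) \<Rightarrow> real \<Rightarrow> real" where
  "det2 C a f x = - 5 * a 4 x + 10 * f 3 x + a 0 x * C 2 1 x + 3 * a 1 x * C 2 0 x - 3 * a 2 x * C 3 0 x
      - 4 * a 3 x * C 4 0 x + 3 * f 1 x * C 3 0 x + 6 * f 2 x * C 4 0 x"

definition det1 :: "(nat \<Rightarrow> nat \<Rightarrow> real \<Rightarrow> real) \<Rightarrow> (nat \<Rightarrow> real \<Rightarrow> real) \<Rightarrow> (nat \<Rightarrow> real \<Rightarrow> real) \<Rightarrow> real \<Rightarrow> real" where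
  "det1 C a f x = - a 5 x + 5 * f 4 x + a 0 x * C 1 1 x + 4 * a 1 x * C 1 0 x - a 2 x * C 2 0 x
      - a 3 x * C 3 0 x - a 4 x * C 4 0 x + 2 * f 1 x * C 2 0 x + 3 * f 2 x * C 3 0 x
      + 4 * f 3 x * C 4 0 x"

definition det0 :: "(nat \<Rightarrow> nat \<Rightarrow> real \<Rightarrow> real) \<Rightarrow> (nat \<Rightarrow> real \<Rightarrow> real) \<Rightarrow> (nat \<Rightarrow> real \<Rightarrow> real) \<Rightarrow> real \<Rightarrow> real" where
  "det0 C a f x = f 5 x + a 0 x * C 0 1 x + 5 * a 1 x * C 0 0 x + f 1 x * C 1 0 x + f 2 x * C 2 0 x
      + f 3 x * C 3 0 x + f 4 x * C 4 0 x"

text \<open>The values of \<open>c\<^sub>2\<close>, \<open>c\<^sub>1\<close>, \<open>c\<^sub>0\<close> at which the relative invariants of weight 3, 4 and 5 vanish.\<close>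

definition forced_c2 :: "(nat \<Rightarrow> nat \<Rightarrow> real \<Rightarrow> real) \<Rightarrow> real \<Rightarrow> real" where
  "forced_c2 C x = (30 * C 3 0 x * C 4 0 x - 8 * C 4 0 x ^ 3 + 75 * C 3 1 x
      - 60 * C 4 0 x * C 4 1 x - 50 * C 4 2 x) / 50"

definition forced_c1 :: "(nat \<Rightarrow> nat \<Rightarrow> real \<Rightarrow> real) \<Rightarrow> real \<Rightarrow> real" where
  "forced_c1 C x = (200 * C 3 0 x ^ 2 - 18 * C 4 0 x ^ 4 + 750 * C 4 0 x * C 3 1 x
      - 580 * C 4 0 x ^ 2 * C 4 1 x - 850 * (C 4 1 x) ^ 2
      - 10 * C 3 0 x * (C 4 0 x ^ 2 + 5 * C 4 1 x)
      + 1125 * C 3 2 x - 1400 * C 4 0 x * C 4 2 x - 1000 * C 4 3 x) / 1250"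

definition forced_c0 :: "(nat \<Rightarrow> nat \<Rightarrow> real \<Rightarrow> real) \<Rightarrow> real \<Rightarrow> real" where
  "forced_c0 C x = (200 * C 3 0 x ^ 2 * C 4 0 x + 14 * C 4 0 x ^ 5 - 25 * C 4 0 x ^ 2 * C 3 1 x
      + 40 * C 4 0 x ^ 3 * C 4 1 x - 125 * C 3 1 x * C 4 1 x
      - 750 * C 4 0 x * (C 4 1 x) ^ 2 + 1125 * C 4 0 x * C 3 2 x
      - 850 * C 4 0 x ^ 2 * C 4 2 x - 2750 * C 4 1 x * C 4 2 x
      + 1250 * C 3 3 x - 2000 * C 4 0 x * C 4 3 x - 1250 * C 4 4 x
      - 10 * C 3 0 x * (11 * C 4 0 x ^ 3 - 100 * C 3 1 x
          + 85 * C 4 0 x * C 4 1 x + 75 * C 4 2 x)) / 6250"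

lemma forced_c2_scaled: "50 * forced_c2 C x =
    - 50 * C 4 2 x + 75 * C 3 1 x - 60 * C 4 0 x * C 4 1 x + 30 * C 4 0 x * C 3 0 x
      - 8 * C 4 0 x ^ 3"
  unfolding forced_c2_def by (rule mult_divide_eqI, algebra, simp)

lemma forced_c2_deriv:
  assumes "\<And>j. is_jet I (C j)" and "x \<in> I"
  shows "(forced_c2 C has_real_derivative
    (- 50 * C 4 3 x + 75 * C 3 2 x - 60 * C 4 0 x * C 4 2 x + 30 * C 4 0 x * C 3 1 x
      - 60 * C 4 1 x ^ 2 + 30 * C 4 1 x * C 3 0 x - 24 * C 4 0 x ^ 2 * C 4 1 x) / 50) (at x)"
proof -
  have d: "(C j k has_real_derivative C j (Suc k) x) (at x)" for j k
    using assms by (simp add: is_jet_def)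
  show ?thesis
    unfolding forced_c2_def[abs_def]
    by (rule derivative_eq_intros d refl | simp)+ (simp add: field_simps eval_nat_numeral)
qed

lemma forced_c1_scaled: "1250 * forced_c1 C x =
    - 1000 * C 4 3 x + 1125 * C 3 2 x - 1400 * C 4 0 x * C 4 2 x + 750 * C 4 0 x * C 3 1 x
      - 850 * C 4 1 x ^ 2 - 50 * C 4 1 x * C 3 0 x + 200 * C 3 0 x ^ 2
      - 580 * C 4 0 x ^ 2 * C 4 1 x - 10 * C 4 0 x ^ 2 * C 3 0 x - 18 * C 4 0 x ^ 4"
  unfolding forced_c1_def by (rule mult_divide_eqI, algebra, simp)

lemma forced_c1_deriv:
  assumes "\<And>j. is_jet I (C j)" and "x \<in> I"
  shows "(forced_c1 C has_real_derivative
    (- 1000 * C 4 4 x + 1125 * C 3 3 x - 1400 * C 4 0 x * C 4 3 x + 750 * C 4 0 x * C 3 2 x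
      - 3100 * C 4 1 x * C 4 2 x + 700 * C 4 1 x * C 3 1 x - 50 * C 4 2 x * C 3 0 x
      + 400 * C 3 0 x * C 3 1 x - 580 * C 4 0 x ^ 2 * C 4 2 x - 10 * C 4 0 x ^ 2 * C 3 1 x
      - 1160 * C 4 0 x * C 4 1 x ^ 2 - 20 * C 4 0 x * C 4 1 x * C 3 0 x
      - 72 * C 4 0 x ^ 3 * C 4 1 x) / 1250) (at x)"
proof -
  have d: "(C j k has_real_derivative C j (Suc k) x) (at x)" for j k
    using assms by (simp add: is_jet_def)
  show ?thesis
    unfolding forced_c1_def[abs_def]
    by (rule derivative_eq_intros d refl | simp)+ (simp add: field_simps eval_nat_numeral)
qed

lemma forced_c0_scaled: "6250 * forced_c0 C x =
    - 1250 * C 4 4 x + 1250 * C 3 3 x - 2000 * C 4 0 x * C 4 3 x + 1125 * C 4 0 x * C 3 2 x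
      - 2750 * C 4 1 x * C 4 2 x - 125 * C 4 1 x * C 3 1 x - 750 * C 4 2 x * C 3 0 x
      + 1000 * C 3 0 x * C 3 1 x - 850 * C 4 0 x ^ 2 * C 4 2 x - 25 * C 4 0 x ^ 2 * C 3 1 x
      - 750 * C 4 0 x * C 4 1 x ^ 2 - 850 * C 4 0 x * C 4 1 x * C 3 0 x
      + 200 * C 4 0 x * C 3 0 x ^ 2 + 40 * C 4 0 x ^ 3 * C 4 1 x - 110 * C 4 0 x ^ 3 * C 3 0 x
      + 14 * C 4 0 x ^ 5"
  unfolding forced_c0_def by (rule mult_divide_eqI, algebra, simp)

lemma forced_c0_deriv:
  assumes "\<And>j. is_jet I (C j)" and "x \<in> I"
  shows "(forced_c0 C has_real_derivative
    (- 1250 * C 4 5 x + 1250 * C 3 4 x - 2000 * C 4 0 x * C 4 4 x + 1125 * C 4 0 x * C 3 3 x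
      - 4750 * C 4 1 x * C 4 3 x + 1000 * C 4 1 x * C 3 2 x - 2750 * C 4 2 x ^ 2
      - 875 * C 4 2 x * C 3 1 x - 750 * C 4 3 x * C 3 0 x + 1000 * C 3 0 x * C 3 2 x
      + 1000 * C 3 1 x ^ 2 - 850 * C 4 0 x ^ 2 * C 4 3 x - 25 * C 4 0 x ^ 2 * C 3 2 x
      - 3200 * C 4 0 x * C 4 1 x * C 4 2 x - 900 * C 4 0 x * C 4 1 x * C 3 1 x
      - 850 * C 4 0 x * C 4 2 x * C 3 0 x + 400 * C 4 0 x * C 3 0 x * C 3 1 x
      - 750 * C 4 1 x ^ 3 - 850 * C 4 1 x ^ 2 * C 3 0 x + 200 * C 4 1 x * C 3 0 x ^ 2
      + 40 * C 4 0 x ^ 3 * C 4 2 x - 110 * C 4 0 x ^ 3 * C 3 1 x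
      + 120 * C 4 0 x ^ 2 * C 4 1 x ^ 2 - 330 * C 4 0 x ^ 2 * C 4 1 x * C 3 0 x
      + 70 * C 4 0 x ^ 4 * C 4 1 x) / 6250) (at x)"
proof -
  have d: "(C j k has_real_derivative C j (Suc k) x) (at x)" for j k
    using assms by (simp add: is_jet_def)
  show ?thesis
    unfolding forced_c0_def[abs_def]
    by (rule derivative_eq_intros d refl | simp)+ (simp add: field_simps eval_nat_numeral)
qed

text \<open>These consequences reduce all derivatives of \<open>a\<close> of order at least 3 and all derivatives of \<open>f\<close>
  to \<open>a, a', a''\<close>.\<close>

lemma det4_det3_prolonged:
  assumes "open I" and "\<And>j. is_jet I (C j)" and "is_jet I a" and "is_jet I f"
    and "\<forall>x\<in>I. det4 C a f x = 0" and "\<forall>x\<in>I. det3 C a f x = 0" and "x \<in> I"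
  shows "- 10 * a 2 x + 5 * f 1 x + a 0 x * C 4 1 x + a 1 x * C 4 0 x = 0"
    and "- 10 * a 3 x + 5 * f 2 x + a 0 x * C 4 2 x + 2 * a 1 x * C 4 1 x + a 2 x * C 4 0 x = 0"
    and "- 10 * a 4 x + 5 * f 3 x + a 0 x * C 4 3 x + 3 * a 1 x * C 4 2 x + 3 * a 2 x * C 4 1 x
      + a 3 x * C 4 0 x = 0"
    and "- 10 * a 5 x + 5 * f 4 x + a 0 x * C 4 4 x + 4 * a 1 x * C 4 3 x + 6 * a 2 x * C 4 2 x
      + 4 * a 3 x * C 4 1 x + a 4 x * C 4 0 x = 0"
    and "- 10 * a 6 x + 5 * f 5 x + a 0 x * C 4 5 x + 5 * a 1 x * C 4 4 x + 10 * a 2 x * C 4 3 x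
      + 10 * a 3 x * C 4 2 x + 5 * a 4 x * C 4 1 x + a 5 x * C 4 0 x = 0"
    and "- 10 * a 3 x + 10 * f 2 x + a 0 x * C 3 1 x + 2 * a 1 x * C 3 0 x - 6 * a 2 x * C 4 0 x
      + 4 * f 1 x * C 4 0 x = 0"
    and "- 10 * a 4 x + 10 * f 3 x + a 0 x * C 3 2 x + 3 * a 1 x * C 3 1 x - 6 * a 2 x * C 4 1 x
      + 2 * a 2 x * C 3 0 x - 6 * a 3 x * C 4 0 x + 4 * f 1 x * C 4 1 x + 4 * f 2 x * C 4 0 x = 0"
    and "- 10 * a 5 x + 10 * f 4 x + a 0 x * C 3 3 x + 4 * a 1 x * C 3 2 x - 6 * a 2 x * C 4 2 x
      + 5 * a 2 x * C 3 1 x - 12 * a 3 x * C 4 1 x + 2 * a 3 x * C 3 0 x - 6 * a 4 x * C 4 0 x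
      + 4 * f 1 x * C 4 2 x + 8 * f 2 x * C 4 1 x + 4 * f 3 x * C 4 0 x = 0"
    and "- 10 * a 6 x + 10 * f 5 x + a 0 x * C 3 4 x + 5 * a 1 x * C 3 3 x - 6 * a 2 x * C 4 3 x
      + 9 * a 2 x * C 3 2 x - 18 * a 3 x * C 4 2 x + 7 * a 3 x * C 3 1 x
      - 18 * a 4 x * C 4 1 x + 2 * a 4 x * C 3 0 x - 6 * a 5 x * C 4 0 x + 4 * f 1 x * C 4 3 x
      + 12 * f 2 x * C 4 2 x + 12 * f 3 x * C 4 1 x + 4 * f 4 x * C 4 0 x = 0"
proof -
  have dC: "(C j k has_real_derivative C j (Suc k) x) (at x)" if "x \<in> I" for j k x
    using assms(2) that by (simp add: is_jet_def)
  have da: "(a k has_real_derivative a (Suc k) x) (at x)" if "x \<in> I" for k x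
    using assms(3) that by (simp add: is_jet_def)
  have df: "(f k has_real_derivative f (Suc k) x) (at x)" if "x \<in> I" for k x
    using assms(4) that by (simp add: is_jet_def)

  have e40: "- 10 * a 2 x + 5 * f 1 x + a 0 x * C 4 1 x + a 1 x * C 4 0 x = 0" if "x \<in> I" for x
    using assms(5) that by (simp add: det4_def)
  have e41: "- 10 * a 3 x + 5 * f 2 x + a 0 x * C 4 2 x + 2 * a 1 x * C 4 1 x + a 2 x * C 4 0 x = 0" if "x \<in> I" for x
    by (rule vanishing_derivative[OF \<open>open I\<close> that e40])
      (assumption | rule derivative_eq_intros dC da df that refl | simp add: algebra_simps eval_nat_numeral)+
  have e42: "- 10 * a 4 x + 5 * f 3 x + a 0 x * C 4 3 x + 3 * a 1 x * C 4 2 x + 3 * a 2 x * C 4 1 x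
      + a 3 x * C 4 0 x = 0" if "x \<in> I" for x
    by (rule vanishing_derivative[OF \<open>open I\<close> that e41])
      (assumption | rule derivative_eq_intros dC da df that refl | simp add: algebra_simps eval_nat_numeral)+
  have e43: "- 10 * a 5 x + 5 * f 4 x + a 0 x * C 4 4 x + 4 * a 1 x * C 4 3 x + 6 * a 2 x * C 4 2 x
      + 4 * a 3 x * C 4 1 x + a 4 x * C 4 0 x = 0" if "x \<in> I" for x
    by (rule vanishing_derivative[OF \<open>open I\<close> that e42])
      (assumption | rule derivative_eq_intros dC da df that refl | simp add: algebra_simps eval_nat_numeral)+
  have e44: "- 10 * a 6 x + 5 * f 5 x + a 0 x * C 4 5 x + 5 * a 1 x * C 4 4 x + 10 * a 2 x * C 4 3 x
      + 10 * a 3 x * C 4 2 x + 5 * a 4 x * C 4 1 x + a 5 x * C 4 0 x = 0" if "x \<in> I" for x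
    by (rule vanishing_derivative[OF \<open>open I\<close> that e43])
      (assumption | rule derivative_eq_intros dC da df that refl | simp add: algebra_simps eval_nat_numeral)+
  have e30: "- 10 * a 3 x + 10 * f 2 x + a 0 x * C 3 1 x + 2 * a 1 x * C 3 0 x - 6 * a 2 x * C 4 0 x
      + 4 * f 1 x * C 4 0 x = 0" if "x \<in> I" for x
    using assms(6) that by (simp add: det3_def)
  have e31: "- 10 * a 4 x + 10 * f 3 x + a 0 x * C 3 2 x + 3 * a 1 x * C 3 1 x - 6 * a 2 x * C 4 1 x
      + 2 * a 2 x * C 3 0 x - 6 * a 3 x * C 4 0 x + 4 * f 1 x * C 4 1 x + 4 * f 2 x * C 4 0 x = 0" if "x \<in> I" for x
    by (rule vanishing_derivative[OF \<open>open I\<close> that e30])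
      (assumption | rule derivative_eq_intros dC da df that refl | simp add: algebra_simps eval_nat_numeral)+
  have e32: "- 10 * a 5 x + 10 * f 4 x + a 0 x * C 3 3 x + 4 * a 1 x * C 3 2 x - 6 * a 2 x * C 4 2 x
      + 5 * a 2 x * C 3 1 x - 12 * a 3 x * C 4 1 x + 2 * a 3 x * C 3 0 x - 6 * a 4 x * C 4 0 x
      + 4 * f 1 x * C 4 2 x + 8 * f 2 x * C 4 1 x + 4 * f 3 x * C 4 0 x = 0" if "x \<in> I" for x
    by (rule vanishing_derivative[OF \<open>open I\<close> that e31])
      (assumption | rule derivative_eq_intros dC da df that refl | simp add: algebra_simps eval_nat_numeral)+
  have e33: "- 10 * a 6 x + 10 * f 5 x + a 0 x * C 3 4 x + 5 * a 1 x * C 3 3 x - 6 * a 2 x * C 4 3 x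
      + 9 * a 2 x * C 3 2 x - 18 * a 3 x * C 4 2 x + 7 * a 3 x * C 3 1 x
      - 18 * a 4 x * C 4 1 x + 2 * a 4 x * C 3 0 x - 6 * a 5 x * C 4 0 x + 4 * f 1 x * C 4 3 x
      + 12 * f 2 x * C 4 2 x + 12 * f 3 x * C 4 1 x + 4 * f 4 x * C 4 0 x = 0" if "x \<in> I" for x
    by (rule vanishing_derivative[OF \<open>open I\<close> that e32])
      (assumption | rule derivative_eq_intros dC da df that refl | simp add: algebra_simps eval_nat_numeral)+
  show "- 10 * a 2 x + 5 * f 1 x + a 0 x * C 4 1 x + a 1 x * C 4 0 x = 0"
    by (rule e40[OF \<open>x \<in> I\<close>])
  show "- 10 * a 3 x + 5 * f 2 x + a 0 x * C 4 2 x + 2 * a 1 x * C 4 1 x + a 2 x * C 4 0 x = 0"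
    by (rule e41[OF \<open>x \<in> I\<close>])
  show "- 10 * a 4 x + 5 * f 3 x + a 0 x * C 4 3 x + 3 * a 1 x * C 4 2 x + 3 * a 2 x * C 4 1 x
      + a 3 x * C 4 0 x = 0"
    by (rule e42[OF \<open>x \<in> I\<close>])
  show "- 10 * a 5 x + 5 * f 4 x + a 0 x * C 4 4 x + 4 * a 1 x * C 4 3 x + 6 * a 2 x * C 4 2 x
      + 4 * a 3 x * C 4 1 x + a 4 x * C 4 0 x = 0"
    by (rule e43[OF \<open>x \<in> I\<close>])
  show "- 10 * a 6 x + 5 * f 5 x + a 0 x * C 4 5 x + 5 * a 1 x * C 4 4 x + 10 * a 2 x * C 4 3 x
      + 10 * a 3 x * C 4 2 x + 5 * a 4 x * C 4 1 x + a 5 x * C 4 0 x = 0"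
    by (rule e44[OF \<open>x \<in> I\<close>])
  show "- 10 * a 3 x + 10 * f 2 x + a 0 x * C 3 1 x + 2 * a 1 x * C 3 0 x - 6 * a 2 x * C 4 0 x
      + 4 * f 1 x * C 4 0 x = 0"
    by (rule e30[OF \<open>x \<in> I\<close>])
  show "- 10 * a 4 x + 10 * f 3 x + a 0 x * C 3 2 x + 3 * a 1 x * C 3 1 x - 6 * a 2 x * C 4 1 x
      + 2 * a 2 x * C 3 0 x - 6 * a 3 x * C 4 0 x + 4 * f 1 x * C 4 1 x + 4 * f 2 x * C 4 0 x = 0"
    by (rule e31[OF \<open>x \<in> I\<close>])
  show "- 10 * a 5 x + 10 * f 4 x + a 0 x * C 3 3 x + 4 * a 1 x * C 3 2 x - 6 * a 2 x * C 4 2 x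
      + 5 * a 2 x * C 3 1 x - 12 * a 3 x * C 4 1 x + 2 * a 3 x * C 3 0 x - 6 * a 4 x * C 4 0 x
      + 4 * f 1 x * C 4 2 x + 8 * f 2 x * C 4 1 x + 4 * f 3 x * C 4 0 x = 0"
    by (rule e32[OF \<open>x \<in> I\<close>])
  show "- 10 * a 6 x + 10 * f 5 x + a 0 x * C 3 4 x + 5 * a 1 x * C 3 3 x - 6 * a 2 x * C 4 3 x
      + 9 * a 2 x * C 3 2 x - 18 * a 3 x * C 4 2 x + 7 * a 3 x * C 3 1 x
      - 18 * a 4 x * C 4 1 x + 2 * a 4 x * C 3 0 x - 6 * a 5 x * C 4 0 x + 4 * f 1 x * C 4 3 x
      + 12 * f 2 x * C 4 2 x + 12 * f 3 x * C 4 1 x + 4 * f 4 x * C 4 0 x = 0"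
    by (rule e33[OF \<open>x \<in> I\<close>])
qed

text \<open>Replacing the highest derivatives of \<open>f\<close> and \<open>a\<close> in \<open>det2\<close> one after the other by means of the
  prolonged equations produces the cofactors in the following identity, and likewise for \<open>det1\<close>
  and \<open>det0\<close>; a constant factor clears all denominators.\<close>

lemma det2_eq:
  assumes "open I" and "\<And>j. is_jet I (C j)" and "is_jet I a" and "is_jet I f"
    and "\<forall>x\<in>I. det4 C a f x = 0" and "\<forall>x\<in>I. det3 C a f x = 0" and "x \<in> I"
    and d: "((\<lambda>x. C 2 0 x - forced_c2 C x) has_real_derivative d) (at x)"
  shows "det2 C a f x = a 0 x * d + 3 * a 1 x * (C 2 0 x - forced_c2 C x)"
proof -
  let ?W = "- 50 * C 4 2 x + 75 * C 3 1 x - 60 * C 4 0 x * C 4 1 x + 30 * C 4 0 x * C 3 0 x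
      - 8 * C 4 0 x ^ 3"
  let ?W' = "- 50 * C 4 3 x + 75 * C 3 2 x - 60 * C 4 0 x * C 4 2 x + 30 * C 4 0 x * C 3 1 x
      - 60 * C 4 1 x ^ 2 + 30 * C 4 1 x * C 3 0 x - 24 * C 4 0 x ^ 2 * C 4 1 x"
  have "(C 2 0 has_real_derivative C 2 1 x) (at x)"
    using assms(2)[of 2] \<open>x \<in> I\<close> by (simp add: is_jet_def)
  from DERIV_diff[OF this forced_c2_deriv[of I C x, OF assms(2) \<open>x \<in> I\<close>]]
  have "d = C 2 1 x - ?W' / 50"
    by (rule DERIV_unique[OF d])
  then have d_eq: "50 * d = 50 * C 2 1 x - ?W'"
    by (rule clear_denominator) simp
  note W_eq = forced_c2_scaled[of C x]
  have "50 * det2 C a f x - a 0 x * (50 * C 2 1 x - ?W') - 3 * a 1 x * (50 * C 2 0 x - ?W) =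
        (- 50) *
          (- 10 * a 4 x + 5 * f 3 x + a 0 x * C 4 3 x + 3 * a 1 x * C 4 2 x + 3 * a 2 x * C 4 1 x
          + a 3 x * C 4 0 x)
        + (- 60 * C 4 0 x) *
          (- 10 * a 3 x + 5 * f 2 x + a 0 x * C 4 2 x + 2 * a 1 x * C 4 1 x + a 2 x * C 4 0 x)
        + (- 60 * C 4 1 x + 30 * C 3 0 x - 24 * C 4 0 x ^ 2) *
          (- 10 * a 2 x + 5 * f 1 x + a 0 x * C 4 1 x + a 1 x * C 4 0 x)
        + 75 *
          (- 10 * a 4 x + 10 * f 3 x + a 0 x * C 3 2 x + 3 * a 1 x * C 3 1 x - 6 * a 2 x * C 4 1 x
          + 2 * a 2 x * C 3 0 x - 6 * a 3 x * C 4 0 x + 4 * f 1 x * C 4 1 x + 4 * f 2 x * C 4 0 x)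
        + (30 * C 4 0 x) *
          (- 10 * a 3 x + 10 * f 2 x + a 0 x * C 3 1 x + 2 * a 1 x * C 3 0 x - 6 * a 2 x * C 4 0 x
          + 4 * f 1 x * C 4 0 x)"
    unfolding det2_def by algebra
  also have "\<dots> = 0"
    unfolding det4_det3_prolonged[of I C a f x, OF assms(1-7)] by simp
  finally show ?thesis
    unfolding d_eq[symmetric] W_eq[symmetric] by (simp add: algebra_simps)
qed

lemma det1_eq:
  assumes "open I" and "\<And>j. is_jet I (C j)" and "is_jet I a" and "is_jet I f"
    and "\<forall>x\<in>I. det4 C a f x = 0" and "\<forall>x\<in>I. det3 C a f x = 0" and "x \<in> I"
    and d: "((\<lambda>x. C 1 0 x - forced_c1 C x) has_real_derivative d) (at x)"
    and c2: "C 2 0 x = forced_c2 C x"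
  shows "det1 C a f x = a 0 x * d + 4 * a 1 x * (C 1 0 x - forced_c1 C x)"
proof -
  let ?W = "- 1000 * C 4 3 x + 1125 * C 3 2 x - 1400 * C 4 0 x * C 4 2 x + 750 * C 4 0 x * C 3 1 x
      - 850 * C 4 1 x ^ 2 - 50 * C 4 1 x * C 3 0 x + 200 * C 3 0 x ^ 2
      - 580 * C 4 0 x ^ 2 * C 4 1 x - 10 * C 4 0 x ^ 2 * C 3 0 x - 18 * C 4 0 x ^ 4"
  let ?W' = "- 1000 * C 4 4 x + 1125 * C 3 3 x - 1400 * C 4 0 x * C 4 3 x + 750 * C 4 0 x * C 3 2 x
      - 3100 * C 4 1 x * C 4 2 x + 700 * C 4 1 x * C 3 1 x - 50 * C 4 2 x * C 3 0 x
      + 400 * C 3 0 x * C 3 1 x - 580 * C 4 0 x ^ 2 * C 4 2 x - 10 * C 4 0 x ^ 2 * C 3 1 x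
      - 1160 * C 4 0 x * C 4 1 x ^ 2 - 20 * C 4 0 x * C 4 1 x * C 3 0 x
      - 72 * C 4 0 x ^ 3 * C 4 1 x"
  have "(C 1 0 has_real_derivative C 1 1 x) (at x)"
    using assms(2)[of 1] \<open>x \<in> I\<close> by (simp add: is_jet_def)
  from DERIV_diff[OF this forced_c1_deriv[of I C x, OF assms(2) \<open>x \<in> I\<close>]]
  have "d = C 1 1 x - ?W' / 1250"
    by (rule DERIV_unique[OF d])
  then have d_eq: "1250 * d = 1250 * C 1 1 x - ?W'"
    by (rule clear_denominator) simp
  note W_eq = forced_c1_scaled[of C x]
  have z2: "50 * C 2 0 x - (- 50 * C 4 2 x + 75 * C 3 1 x - 60 * C 4 0 x * C 4 1 x + 30 * C 4 0 x * C 3 0 x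
      - 8 * C 4 0 x ^ 3) = 0"
    unfolding c2 forced_c2_scaled by simp
  have "1250 * det1 C a f x - a 0 x * (1250 * C 1 1 x - ?W') - 4 * a 1 x * (1250 * C 1 0 x - ?W) =
        (- 1000) *
          (- 10 * a 5 x + 5 * f 4 x + a 0 x * C 4 4 x + 4 * a 1 x * C 4 3 x + 6 * a 2 x * C 4 2 x
          + 4 * a 3 x * C 4 1 x + a 4 x * C 4 0 x)
        + (- 1400 * C 4 0 x) *
          (- 10 * a 4 x + 5 * f 3 x + a 0 x * C 4 3 x + 3 * a 1 x * C 4 2 x + 3 * a 2 x * C 4 1 x
          + a 3 x * C 4 0 x)
        + (- 1700 * C 4 1 x - 50 * C 3 0 x - 580 * C 4 0 x ^ 2) *
          (- 10 * a 3 x + 5 * f 2 x + a 0 x * C 4 2 x + 2 * a 1 x * C 4 1 x + a 2 x * C 4 0 x)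
        + (- 1400 * C 4 2 x + 750 * C 3 1 x - 1160 * C 4 0 x * C 4 1 x - 20 * C 4 0 x * C 3 0 x
          - 72 * C 4 0 x ^ 3) *
          (- 10 * a 2 x + 5 * f 1 x + a 0 x * C 4 1 x + a 1 x * C 4 0 x)
        + (1125) *
          (- 10 * a 5 x + 10 * f 4 x + a 0 x * C 3 3 x + 4 * a 1 x * C 3 2 x - 6 * a 2 x * C 4 2 x
          + 5 * a 2 x * C 3 1 x - 12 * a 3 x * C 4 1 x + 2 * a 3 x * C 3 0 x - 6 * a 4 x * C 4 0 x
          + 4 * f 1 x * C 4 2 x + 8 * f 2 x * C 4 1 x + 4 * f 3 x * C 4 0 x)
        + (750 * C 4 0 x) *
          (- 10 * a 4 x + 10 * f 3 x + a 0 x * C 3 2 x + 3 * a 1 x * C 3 1 x - 6 * a 2 x * C 4 1 x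
          + 2 * a 2 x * C 3 0 x - 6 * a 3 x * C 4 0 x + 4 * f 1 x * C 4 1 x + 4 * f 2 x * C 4 0 x)
        + (- 50 * C 4 1 x + 400 * C 3 0 x - 10 * C 4 0 x ^ 2) *
          (- 10 * a 3 x + 10 * f 2 x + a 0 x * C 3 1 x + 2 * a 1 x * C 3 0 x - 6 * a 2 x * C 4 0 x
          + 4 * f 1 x * C 4 0 x)
        + (25 * (2 * f 1 x - a 2 x)) *
          (50 * C 2 0 x - (- 50 * C 4 2 x + 75 * C 3 1 x - 60 * C 4 0 x * C 4 1 x
          + 30 * C 4 0 x * C 3 0 x       - 8 * C 4 0 x ^ 3))"
    unfolding det1_def by algebra
  also have "\<dots> = 0"
    unfolding det4_det3_prolonged[of I C a f x, OF assms(1-7)] z2 by simp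
  finally show ?thesis
    unfolding d_eq[symmetric] W_eq[symmetric] by (simp add: algebra_simps)
qed

lemma det0_eq:
  assumes "open I" and "\<And>j. is_jet I (C j)" and "is_jet I a" and "is_jet I f"
    and "\<forall>x\<in>I. det4 C a f x = 0" and "\<forall>x\<in>I. det3 C a f x = 0" and "x \<in> I"
    and d: "((\<lambda>x. C 0 0 x - forced_c0 C x) has_real_derivative d) (at x)"
    and c2: "C 2 0 x = forced_c2 C x" and c1: "C 1 0 x = forced_c1 C x"
  shows "det0 C a f x = a 0 x * d + 5 * a 1 x * (C 0 0 x - forced_c0 C x)"
proof -
  let ?W = "- 1250 * C 4 4 x + 1250 * C 3 3 x - 2000 * C 4 0 x * C 4 3 x + 1125 * C 4 0 x * C 3 2 x
      - 2750 * C 4 1 x * C 4 2 x - 125 * C 4 1 x * C 3 1 x - 750 * C 4 2 x * C 3 0 x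
      + 1000 * C 3 0 x * C 3 1 x - 850 * C 4 0 x ^ 2 * C 4 2 x - 25 * C 4 0 x ^ 2 * C 3 1 x
      - 750 * C 4 0 x * C 4 1 x ^ 2 - 850 * C 4 0 x * C 4 1 x * C 3 0 x
      + 200 * C 4 0 x * C 3 0 x ^ 2 + 40 * C 4 0 x ^ 3 * C 4 1 x - 110 * C 4 0 x ^ 3 * C 3 0 x
      + 14 * C 4 0 x ^ 5"
  let ?W' = "- 1250 * C 4 5 x + 1250 * C 3 4 x - 2000 * C 4 0 x * C 4 4 x + 1125 * C 4 0 x * C 3 3 x
      - 4750 * C 4 1 x * C 4 3 x + 1000 * C 4 1 x * C 3 2 x - 2750 * C 4 2 x ^ 2
      - 875 * C 4 2 x * C 3 1 x - 750 * C 4 3 x * C 3 0 x + 1000 * C 3 0 x * C 3 2 x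
      + 1000 * C 3 1 x ^ 2 - 850 * C 4 0 x ^ 2 * C 4 3 x - 25 * C 4 0 x ^ 2 * C 3 2 x
      - 3200 * C 4 0 x * C 4 1 x * C 4 2 x - 900 * C 4 0 x * C 4 1 x * C 3 1 x
      - 850 * C 4 0 x * C 4 2 x * C 3 0 x + 400 * C 4 0 x * C 3 0 x * C 3 1 x
      - 750 * C 4 1 x ^ 3 - 850 * C 4 1 x ^ 2 * C 3 0 x + 200 * C 4 1 x * C 3 0 x ^ 2
      + 40 * C 4 0 x ^ 3 * C 4 2 x - 110 * C 4 0 x ^ 3 * C 3 1 x
      + 120 * C 4 0 x ^ 2 * C 4 1 x ^ 2 - 330 * C 4 0 x ^ 2 * C 4 1 x * C 3 0 x
      + 70 * C 4 0 x ^ 4 * C 4 1 x"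
  have "(C 0 0 has_real_derivative C 0 1 x) (at x)"
    using assms(2)[of 0] \<open>x \<in> I\<close> by (simp add: is_jet_def)
  from DERIV_diff[OF this forced_c0_deriv[of I C x, OF assms(2) \<open>x \<in> I\<close>]]
  have "d = C 0 1 x - ?W' / 6250"
    by (rule DERIV_unique[OF d])
  then have d_eq: "6250 * d = 6250 * C 0 1 x - ?W'"
    by (rule clear_denominator) simp
  note W_eq = forced_c0_scaled[of C x]
  have z2: "50 * C 2 0 x - (- 50 * C 4 2 x + 75 * C 3 1 x - 60 * C 4 0 x * C 4 1 x + 30 * C 4 0 x * C 3 0 x
      - 8 * C 4 0 x ^ 3) = 0"
    unfolding c2 forced_c2_scaled by simp
  have z1: "1250 * C 1 0 x - (- 1000 * C 4 3 x + 1125 * C 3 2 x - 1400 * C 4 0 x * C 4 2 x + 750 * C 4 0 x * C 3 1 x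
          - 850 * C 4 1 x ^ 2 - 50 * C 4 1 x * C 3 0 x + 200 * C 3 0 x ^ 2
          - 580 * C 4 0 x ^ 2 * C 4 1 x - 10 * C 4 0 x ^ 2 * C 3 0 x - 18 * C 4 0 x ^ 4) = 0"
    unfolding c1 forced_c1_scaled by simp
  have "6250 * det0 C a f x - a 0 x * (6250 * C 0 1 x - ?W') - 5 * a 1 x * (6250 * C 0 0 x - ?W) =
        (- 1250) *
          (- 10 * a 6 x + 5 * f 5 x + a 0 x * C 4 5 x + 5 * a 1 x * C 4 4 x + 10 * a 2 x * C 4 3 x
          + 10 * a 3 x * C 4 2 x + 5 * a 4 x * C 4 1 x + a 5 x * C 4 0 x)
        + (- 2000 * C 4 0 x) *
          (- 10 * a 5 x + 5 * f 4 x + a 0 x * C 4 4 x + 4 * a 1 x * C 4 3 x + 6 * a 2 x * C 4 2 x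
          + 4 * a 3 x * C 4 1 x + a 4 x * C 4 0 x)
        + (- 2750 * C 4 1 x - 750 * C 3 0 x - 850 * C 4 0 x ^ 2) *
          (- 10 * a 4 x + 5 * f 3 x + a 0 x * C 4 3 x + 3 * a 1 x * C 4 2 x + 3 * a 2 x * C 4 1 x
          + a 3 x * C 4 0 x)
        + (- 2750 * C 4 2 x - 125 * C 3 1 x - 1500 * C 4 0 x * C 4 1 x - 850 * C 4 0 x * C 3 0 x
          + 40 * C 4 0 x ^ 3) *
          (- 10 * a 3 x + 5 * f 2 x + a 0 x * C 4 2 x + 2 * a 1 x * C 4 1 x + a 2 x * C 4 0 x)
        + (- 2000 * C 4 3 x + 1125 * C 3 2 x - 1700 * C 4 0 x * C 4 2 x - 50 * C 4 0 x * C 3 1 x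
          - 750 * C 4 1 x ^ 2 - 850 * C 4 1 x * C 3 0 x + 200 * C 3 0 x ^ 2
          + 120 * C 4 0 x ^ 2 * C 4 1 x - 330 * C 4 0 x ^ 2 * C 3 0 x + 70 * C 4 0 x ^ 4) *
          (- 10 * a 2 x + 5 * f 1 x + a 0 x * C 4 1 x + a 1 x * C 4 0 x)
        + (1250) *
          (- 10 * a 6 x + 10 * f 5 x + a 0 x * C 3 4 x + 5 * a 1 x * C 3 3 x - 6 * a 2 x * C 4 3 x
          + 9 * a 2 x * C 3 2 x - 18 * a 3 x * C 4 2 x + 7 * a 3 x * C 3 1 x
          - 18 * a 4 x * C 4 1 x + 2 * a 4 x * C 3 0 x - 6 * a 5 x * C 4 0 x + 4 * f 1 x * C 4 3 x
          + 12 * f 2 x * C 4 2 x + 12 * f 3 x * C 4 1 x + 4 * f 4 x * C 4 0 x)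
        + (1125 * C 4 0 x) *
          (- 10 * a 5 x + 10 * f 4 x + a 0 x * C 3 3 x + 4 * a 1 x * C 3 2 x - 6 * a 2 x * C 4 2 x
          + 5 * a 2 x * C 3 1 x - 12 * a 3 x * C 4 1 x + 2 * a 3 x * C 3 0 x - 6 * a 4 x * C 4 0 x
          + 4 * f 1 x * C 4 2 x + 8 * f 2 x * C 4 1 x + 4 * f 3 x * C 4 0 x)
        + (- 125 * C 4 1 x + 1000 * C 3 0 x - 25 * C 4 0 x ^ 2) *
          (- 10 * a 4 x + 10 * f 3 x + a 0 x * C 3 2 x + 3 * a 1 x * C 3 1 x - 6 * a 2 x * C 4 1 x
          + 2 * a 2 x * C 3 0 x - 6 * a 3 x * C 4 0 x + 4 * f 1 x * C 4 1 x + 4 * f 2 x * C 4 0 x)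
        + (- 750 * C 4 2 x + 1000 * C 3 1 x - 850 * C 4 0 x * C 4 1 x + 400 * C 4 0 x * C 3 0 x
          - 110 * C 4 0 x ^ 3) *
          (- 10 * a 3 x + 10 * f 2 x + a 0 x * C 3 1 x + 2 * a 1 x * C 3 0 x - 6 * a 2 x * C 4 0 x
          + 4 * f 1 x * C 4 0 x)
        + (125 * f 2 x) *
          (50 * C 2 0 x - (- 50 * C 4 2 x + 75 * C 3 1 x - 60 * C 4 0 x * C 4 1 x
          + 30 * C 4 0 x * C 3 0 x       - 8 * C 4 0 x ^ 3))
        + (5 * f 1 x) *
          (1250 * C 1 0 x - (- 1000 * C 4 3 x + 1125 * C 3 2 x - 1400 * C 4 0 x * C 4 2 x
          + 750 * C 4 0 x * C 3 1 x           - 850 * C 4 1 x ^ 2 - 50 * C 4 1 x * C 3 0 x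
          + 200 * C 3 0 x ^ 2           - 580 * C 4 0 x ^ 2 * C 4 1 x - 10 * C 4 0 x ^ 2 * C 3 0 x
          - 18 * C 4 0 x ^ 4))"
    unfolding det0_def by algebra
  also have "\<dots> = 0"
    unfolding det4_det3_prolonged[of I C a f x, OF assms(1-7)] z2 z1 by simp
  finally show ?thesis
    unfolding d_eq[symmetric] W_eq[symmetric] by (simp add: algebra_simps)
qed

definition jet :: "(real \<Rightarrow> real) \<Rightarrow> nat \<Rightarrow> real \<Rightarrow> real" where
  "jet h k = (deriv ^^ k) h"

lemma jet_0 [simp]: "jet h 0 = h"
  by (simp add: jet_def)

lemma is_jet_jet: "open I \<Longrightarrow> smooth_on I h \<Longrightarrow> is_jet I (jet h)"
  unfolding is_jet_def jet_def using smooth_on_has_real_derivative by blast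

lemma jet_unique:
  assumes "open I" and "is_jet I s" and "\<And>t. t \<in> I \<Longrightarrow> h t = s 0 t" and "x \<in> I"
  shows "jet h k x = s k x"
proof -
  have "(deriv ^^ k) h x = s k x"
    using \<open>x \<in> I\<close>
  proof (induction k arbitrary: x)
    case 0
    then show ?case using assms(3) by simp
  next
    case (Suc k)
    have "(s k has_real_derivative s (Suc k) x) (at x)"
      using assms(2) Suc.prems by (simp add: is_jet_def)
    from has_field_derivative_transform_within_open[OF this \<open>open I\<close> Suc.prems, of "(deriv ^^ k) h"]
    show ?case using Suc.IH by (simp add: DERIV_imp_deriv)
  qed
  then show ?thesis by (simp add: jet_def)
qed

lemma is_jet_add:
  "is_jet I s \<Longrightarrow> is_jet I t \<Longrightarrow> is_jet I (\<lambda>k x. s k x + t k x)"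
  unfolding is_jet_def by (auto intro: DERIV_add)

lemma is_jet_scale: "is_jet I s \<Longrightarrow> is_jet I (\<lambda>k x. r * s k x)"
  unfolding is_jet_def by (auto intro: DERIV_cmult)

lemma jet_add:
  assumes "open I" and "smooth_on I h" and "smooth_on I h'" and "x \<in> I"
  shows "jet (\<lambda>x. h x + h' x) k x = jet h k x + jet h' k x"
  using jet_unique[OF \<open>open I\<close> is_jet_add[OF is_jet_jet is_jet_jet], of h h'] assms by simp

lemma jet_scale:
  assumes "open I" and "smooth_on I h" and "x \<in> I"
  shows "jet (\<lambda>x. r * h x) k x = r * jet h k x"
  using jet_unique[OF \<open>open I\<close> is_jet_scale[OF is_jet_jet], of h] assms by simp

section \<open>The symmetry algebra in terms of the determining equations\<close>

lemma affine_total_deriv_tower: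
  assumes "open I" and "is_jet I f" and "is_jet I g"
    and \<phi>: "\<And>x y. x \<in> I \<Longrightarrow> \<phi> (x, y) = f 0 x * y + g 0 x"
  shows "total_deriv_tower I \<phi> (\<lambda>k x u. (\<Sum>j<Suc k. real (k choose j) * (f (k - j) x * u j)) + g k x)"
  unfolding total_deriv_tower_def
proof (intro conjI ballI allI impI)
  fix x u assume "x \<in> I"
  then show "(\<Sum>j<Suc 0. real (0 choose j) * (f (0 - j) x * u j)) + g 0 x = \<phi> (x, u 0)"
    by (simp add: \<phi>)
next
  fix k m :: nat and x and u :: "nat \<Rightarrow> real" assume "x \<in> I" "k \<le> m"
  let ?H = "\<lambda>k x (u :: nat \<Rightarrow> real). (\<Sum>j<Suc k. real (k choose j) * (f (k - j) x * u j)) + g k x"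
  let ?d = "(\<Sum>j<Suc k. real (k choose j) * (f (Suc (k - j)) x * u j + u (Suc j) * f (k - j) x)) + g (Suc k) x"
  have "has_total_deriv m (?H k) ?d x u"
    using assms(2,3) \<open>x \<in> I\<close> \<open>k \<le> m\<close>
    by (intro has_total_deriv_add has_total_deriv_sum has_total_deriv_cmult has_total_deriv_mult
        has_total_deriv_coordinate has_total_deriv_fun_of_x) (auto simp: is_jet_def)
  moreover have "?d = ?H (Suc k) x u"
  proof -
    let ?t = "\<lambda>j. f (Suc k - j) x * u j"
    have "(\<Sum>j<Suc (Suc k). real (Suc k choose j) * ?t j)
        = ?t 0 + (\<Sum>j<Suc k. real (Suc k choose Suc j) * ?t (Suc j))"
      by (subst sum.lessThan_Suc_shift) simp
    also have "\<dots> = (\<Sum>j<Suc k. real (k choose j) * ?t (Suc j))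
        + (?t 0 + (\<Sum>j<Suc k. real (k choose Suc j) * ?t (Suc j)))"
      by (simp add: sum.distrib algebra_simps del: sum.lessThan_Suc)
    also have "?t 0 + (\<Sum>j<Suc k. real (k choose Suc j) * ?t (Suc j)) = (\<Sum>j<Suc k. real (k choose j) * ?t j)"
      by (subst sum.lessThan_Suc_shift[of _ k]) simp
    also have "(\<Sum>j<Suc k. real (k choose j) * ?t j) = (\<Sum>j<Suc k. real (k choose j) * (f (Suc (k - j)) x * u j))"
      by (intro sum.cong) (auto simp: Suc_diff_le)
    finally show ?thesis
      by (simp add: sum.distrib algebra_simps del: sum.lessThan_Suc)
  qed
  ultimately show "has_total_deriv m (?H k) (?H (Suc k) x u) x u" by (simp only:)
qed

definition affine_symmetry ::
    "real set \<Rightarrow> (nat \<Rightarrow> real \<Rightarrow> real) \<Rightarrow> (real \<Rightarrow> real) \<Rightarrow> (real \<Rightarrow> real) \<Rightarrow> (real \<Rightarrow> real) \<Rightarrow> bool" where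
  "affine_symmetry I c a f g \<longleftrightarrow> smooth_on I a \<and> smooth_on I f \<and> smooth_on I g \<and>
     (\<forall>x\<in>I. det4 (\<lambda>j. jet (c j)) (jet a) (jet f) x = 0 \<and>
            det3 (\<lambda>j. jet (c j)) (jet a) (jet f) x = 0 \<and>
            det2 (\<lambda>j. jet (c j)) (jet a) (jet f) x = 0 \<and>
            det1 (\<lambda>j. jet (c j)) (jet a) (jet f) x = 0 \<and>
            det0 (\<lambda>j. jet (c j)) (jet a) (jet f) x = 0 \<and>
            linear_ode 5 c x (\<lambda>k. jet g k x) = 0)"

lemma affine_vf_invariant_iff:
  assumes "open I" and c: "\<And>j. j < 5 \<Longrightarrow> smooth_on I (c j)"
    and "smooth_on I a" and "smooth_on I f" and "smooth_on I g"
  shows "infinitesimally_invariant 5 I (linear_ode 5 c) (affine_vf I a f g) \<longleftrightarrow> affine_symmetry I c a f g"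
proof -
  let ?V = "affine_vf I a f g"
  let ?C = "\<lambda>j. jet (c j)" and ?A = "jet a" and ?F = "jet f" and ?G = "jet g"
  let ?H = "\<lambda>k x (u :: nat \<Rightarrow> real). (\<Sum>j<Suc k. real (k choose j) * (?F (k - j) x * u j)) + ?G k x"
  let ?X = "\<lambda>k x (u :: nat \<Rightarrow> real). ?A k x"
  have jets: "is_jet I ?A" "is_jet I ?F" "is_jet I ?G"
    using is_jet_jet assms by auto
  have H: "total_deriv_tower I (\<lambda>p. snd (?V p)) ?H"
    using affine_total_deriv_tower[OF \<open>open I\<close> jets(2,3)] by (simp add: affine_vf_def)
  have X: "total_deriv_tower I (\<lambda>p. fst (?V p)) ?X"
    using fun_of_x_total_deriv_tower[OF \<open>open I\<close> \<open>smooth_on I a\<close>] by (simp add: affine_vf_def jet_def)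
  have c': "\<forall>j<5. \<forall>x\<in>I. (c j has_real_derivative ?C j 1 x) (at x)"
    using is_jet_jet[OF \<open>open I\<close> c] unfolding is_jet_def by (metis One_nat_def jet_0)
  let ?L = "\<lambda>x. linear_ode 5 c x (\<lambda>k. ?G k x)"
  have point: "(\<forall>u. on_equation c x u \<longrightarrow>
      ?X 0 x u * (?C 0 1 x * u 0 + ?C 1 1 x * u 1 + ?C 2 1 x * u 2 + ?C 3 1 x * u 3 + ?C 4 1 x * u 4)
      + (?H 5 x u - (u 1 * ?X 5 x u + 5 * u 2 * ?X 4 x u + 10 * u 3 * ?X 3 x u + 10 * u 4 * ?X 2 x u + 5 * u 5 * ?X 1 x u))
      + c 4 x * (?H 4 x u - (u 1 * ?X 4 x u + 4 * u 2 * ?X 3 x u + 6 * u 3 * ?X 2 x u + 4 * u 4 * ?X 1 x u))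
      + c 3 x * (?H 3 x u - (u 1 * ?X 3 x u + 3 * u 2 * ?X 2 x u + 3 * u 3 * ?X 1 x u))
      + c 2 x * (?H 2 x u - (u 1 * ?X 2 x u + 2 * u 2 * ?X 1 x u))
      + c 1 x * (?H 1 x u - u 1 * ?X 1 x u)
      + c 0 x * ?H 0 x u = 0) \<longleftrightarrow>
    det4 ?C ?A ?F x = 0 \<and> det3 ?C ?A ?F x = 0 \<and> det2 ?C ?A ?F x = 0 \<and> det1 ?C ?A ?F x = 0 \<and>
    det0 ?C ?A ?F x = 0 \<and> ?L x = 0" (is "(\<forall>u. _ \<longrightarrow> ?E u = 0) \<longleftrightarrow> ?R") for x
  proof -
    let ?D = "\<lambda>u. det4 ?C ?A ?F x * u 4 + det3 ?C ?A ?F x * u 3 + det2 ?C ?A ?F x * u 2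
      + det1 ?C ?A ?F x * u 1 + det0 ?C ?A ?F x * u 0 + ?L x"
    have h0: "?H 0 x u = f x * u 0 + g x" for u by simp
    have h1: "?H 1 x u = ?F 1 x * u 0 + f x * u 1 + ?G 1 x" for u by simp
    have h2: "?H 2 x u = ?F 2 x * u 0 + 2 * ?F 1 x * u 1 + f x * u 2 + ?G 2 x" for u
      by (simp add: eval_nat_numeral)
    have h3: "?H 3 x u = ?F 3 x * u 0 + 3 * ?F 2 x * u 1 + 3 * ?F 1 x * u 2 + f x * u 3 + ?G 3 x" for u
      by (simp add: eval_nat_numeral)
    have h4: "?H 4 x u = ?F 4 x * u 0 + 4 * ?F 3 x * u 1 + 6 * ?F 2 x * u 2 + 4 * ?F 1 x * u 3 + f x * u 4 + ?G 4 x" for u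
      by (simp add: eval_nat_numeral)
    have h5: "?H 5 x u = ?F 5 x * u 0 + 5 * ?F 4 x * u 1 + 10 * ?F 3 x * u 2 + 10 * ?F 2 x * u 3 + 5 * ?F 1 x * u 4
        + f x * u 5 + ?G 5 x" for u
      by (simp add: eval_nat_numeral)
    have E: "?E u = ?D u" if "on_equation c x u" for u
      unfolding h0 h1 h2 h3 h4 h5
      unfolding that[unfolded on_equation_def] det4_def det3_def det2_def det1_def det0_def
        linear_ode_def lessThan_numeral_sums jet_0
      by algebra
    show ?thesis
    proof
      assume all: "\<forall>u. on_equation c x u \<longrightarrow> ?E u = 0"
      have D0: "?D u = 0" if "on_equation c x u" for u
        using all[rule_format, OF that] unfolding E[OF that] .
      have L0: "?L x = 0"
        using D0[of "\<lambda>_. 0"] by (simp add: on_equation_def)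
      define e where "e k = (\<lambda>_ :: nat. 0 :: real)(k := 1, 5 := - c k x)" for k :: nat
      have "on_equation c x (e k)" if "k < 5" for k
        using that by (auto simp: on_equation_def e_def less_Suc_eq eval_nat_numeral)
      then have "?D (e k) = 0" if "k < 5" for k using D0 that by blast
      from this[of 4] this[of 3] this[of 2] this[of 1] this[of 0] L0
      show ?R by (simp add: e_def)
    next
      assume ?R
      then show "\<forall>u. on_equation c x u \<longrightarrow> ?E u = 0" using E by simp
    qed
  qed
  show ?thesis
    unfolding infinitesimally_invariant_5_iff[OF c' \<open>open I\<close> H X] affine_symmetry_def
    using assms(3-5) by (simp only: point simp_thms)
qed

lemma symmetry_algebra_eq:
  assumes "open I" and c: "\<And>j. j < 5 \<Longrightarrow> smooth_on I (c j)"
  shows "symmetry_algebra 5 I (linear_ode 5 c) = {affine_vf I a f g | a f g. affine_symmetry I c a f g}"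
proof (intro set_eqI iffI)
  fix V assume V: "V \<in> symmetry_algebra 5 I (linear_ode 5 c)"
  have c': "\<forall>j<5. \<forall>x\<in>I. (c j has_real_derivative jet (c j) 1 x) (at x)"
    using is_jet_jet[OF \<open>open I\<close> c] unfolding is_jet_def by (metis One_nat_def jet_0)
  obtain a f g where *: "smooth_on I a" "smooth_on I f" "smooth_on I g" "V = affine_vf I a f g"
    using symmetry_is_affine[OF c' \<open>open I\<close> V] .
  then have "affine_symmetry I c a f g"
    using V affine_vf_invariant_iff[OF \<open>open I\<close> c *(1-3)] by (simp add: symmetry_algebra_def)
  then show "V \<in> {affine_vf I a f g | a f g. affine_symmetry I c a f g}"
    using *(4) by blast
next
  fix V assume "V \<in> {affine_vf I a f g | a f g. affine_symmetry I c a f g}"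
  then obtain a f g where *: "V = affine_vf I a f g" "affine_symmetry I c a f g" by blast
  then have sm: "smooth_on I a" "smooth_on I f" "smooth_on I g"
    by (simp_all add: affine_symmetry_def)
  have "infinitesimally_invariant 5 I (linear_ode 5 c) V"
    using affine_vf_invariant_iff[OF \<open>open I\<close> c sm] * by simp
  moreover have "V p = 0" if "p \<notin> I \<times> UNIV" for p
    using that by (cases p) (auto simp: * affine_vf_def)
  ultimately show "V \<in> symmetry_algebra 5 I (linear_ode 5 c)"
    using smooth_on_affine_vf[OF \<open>open I\<close> sm] * by (simp add: symmetry_algebra_def)
qed

section \<open>Dimension of the symmetry algebra\<close>

text \<open>A linear map defined only on a subspace is extended from a basis to the whole space, so that
  the dimension theory of everywhere defined linear maps applies.\<close>

lemma dim_eq_DIM_iff: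
  fixes \<Phi> :: "vector_field \<Rightarrow> 'b::euclidean_space"
  assumes S: "vf.subspace S"
    and add: "\<And>V W. V \<in> S \<Longrightarrow> W \<in> S \<Longrightarrow> \<Phi> (V + W) = \<Phi> V + \<Phi> W"
    and scale: "\<And>r V. V \<in> S \<Longrightarrow> \<Phi> (vf_scale r V) = r *\<^sub>R \<Phi> V"
    and inj: "\<And>V. V \<in> S \<Longrightarrow> \<Phi> V = 0 \<Longrightarrow> V = 0"
  shows "vf.dim S = DIM('b) \<longleftrightarrow> \<Phi> ` S = UNIV"
proof -
  interpret vr: vector_space_pair vf_scale "scaleR :: real \<Rightarrow> 'b \<Rightarrow> 'b"
    by unfold_locales
  obtain B where B: "B \<subseteq> S" "vf.independent B" "S \<subseteq> vf.span B" "card B = vf.dim S"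
    using vf.basis_exists by blast
  have span_B: "vf.span B = S"
    using B S by (intro antisym vf.span_minimal)
  define \<Psi> where "\<Psi> = vr.construct B \<Phi>"
  have lin: "Vector_Spaces.linear vf_scale scaleR \<Psi>"
    unfolding \<Psi>_def by (rule vr.linear_construct[OF B(2)])
  interpret \<Psi>: Vector_Spaces.linear vf_scale "scaleR :: real \<Rightarrow> 'b \<Rightarrow> 'b" \<Psi>
    by (rule lin)
  have "vf.subspace {V \<in> S. \<Psi> V = \<Phi> V}"
  proof (rule vf.subspaceI)
    have "0 \<in> S" using S by (rule vf.subspace_0)
    moreover have "\<Phi> 0 = 0" using add[OF \<open>0 \<in> S\<close> \<open>0 \<in> S\<close>] by simp
    ultimately show "0 \<in> {V \<in> S. \<Psi> V = \<Phi> V}" by (simp add: \<Psi>.zero)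
  qed (use S add scale in \<open>auto simp: \<Psi>.add \<Psi>.scale vf.subspace_add vf.subspace_scale\<close>)
  moreover have "B \<subseteq> {V \<in> S. \<Psi> V = \<Phi> V}"
    using B(1) vr.construct_basis[OF B(2), of _ \<Phi>] by (auto simp: \<Psi>_def)
  ultimately have "S \<subseteq> {V \<in> S. \<Psi> V = \<Phi> V}"
    using vf.span_minimal[of B] span_B by blast
  then have \<Psi>_\<Phi>: "\<Psi> V = \<Phi> V" if "V \<in> S" for V using that by blast
  have inj_on: "inj_on \<Psi> S"
  proof (rule inj_onI)
    fix V W assume VW: "V \<in> S" "W \<in> S" "\<Psi> V = \<Psi> W"
    have "V - W \<in> S" using vf.subspace_diff[OF S VW(1,2)] .
    moreover have "\<Phi> (V - W) = 0"
      using \<Psi>_\<Phi>[OF \<open>V - W \<in> S\<close>] VW(3) by (simp add: \<Psi>.diff)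
    ultimately show "V = W" using inj by fastforce
  qed
  have indep: "independent (\<Psi> ` B)"
    using vr.linear_independent_injective_image[OF lin B(2)] inj_on
    unfolding span_B dependent_raw_def .
  have card: "card (\<Psi> ` B) = vf.dim S"
    using card_image[OF inj_on_subset[OF inj_on B(1)]] B(4) by simp
  have "span (\<Psi> ` B) = \<Psi> ` S"
    using vr.linear_span_image[OF lin, of B] unfolding span_B span_raw_def .
  also have "\<Psi> ` S = \<Phi> ` S" using \<Psi>_\<Phi> by (intro image_cong) auto
  finally have span: "span (\<Psi> ` B) = \<Phi> ` S" .
  show ?thesis
  proof
    assume "vf.dim S = DIM('b)"
    then have "UNIV \<subseteq> span (\<Psi> ` B)"
      using card_ge_dim_independent[OF _ indep, of UNIV] card by simp
    then show "\<Phi> ` S = UNIV" using span by auto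
  next
    assume "\<Phi> ` S = UNIV"
    then have "card (\<Psi> ` B) = dim (UNIV :: 'b set)"
      using basis_card_eq_dim[of "\<Psi> ` B" UNIV] span indep by auto
    then show "vf.dim S = DIM('b)" using card by simp
  qed
qed

text \<open>Nine initial values at a point determine a symmetry, because the determining equations
  contain an equation of third order for \<open>a\<close> and one of first order for \<open>f\<close>, and \<open>g\<close> solves the
  given equation.\<close>

type_synonym nine_reals =
  "(real \<times> real \<times> real) \<times> real \<times> (real \<times> real \<times> real \<times> real \<times> real)"

definition initial_values :: "real \<Rightarrow> (real \<Rightarrow> real) \<Rightarrow> (real \<Rightarrow> real) \<Rightarrow> (real \<Rightarrow> real) \<Rightarrow> nine_reals" where
  "initial_values x a f g = ((a x, jet a 1 x, jet a 2 x), f x,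
     (g x, jet g 1 x, jet g 2 x, jet g 3 x, jet g 4 x))"

definition symmetry_data :: "real \<Rightarrow> vector_field \<Rightarrow> nine_reals" where
  "symmetry_data x V = initial_values x (\<lambda>t. fst (V (t, 0))) (\<lambda>t. snd (V (t, 1)) - snd (V (t, 0)))
     (\<lambda>t. snd (V (t, 0)))"

lemma symmetry_data_affine_vf:
  assumes "open I" and "x \<in> I" and "smooth_on I a" and "smooth_on I f" and "smooth_on I g"
  shows "symmetry_data x (affine_vf I a f g) = initial_values x a f g"
proof -
  have "jet (\<lambda>t. fst (affine_vf I a f g (t, 0))) k x = jet a k x" for k
    by (rule jet_unique[OF \<open>open I\<close> is_jet_jet[OF \<open>open I\<close> \<open>smooth_on I a\<close>] _ \<open>x \<in> I\<close>])
      (simp add: affine_vf_def)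
  moreover have "jet (\<lambda>t. snd (affine_vf I a f g (t, 0))) k x = jet g k x" for k
    by (rule jet_unique[OF \<open>open I\<close> is_jet_jet[OF \<open>open I\<close> \<open>smooth_on I g\<close>] _ \<open>x \<in> I\<close>])
      (simp add: affine_vf_def)
  ultimately show ?thesis
    unfolding symmetry_data_def initial_values_def using \<open>x \<in> I\<close> by (simp add: affine_vf_def)
qed

lemma initial_values_add:
  assumes "open I" and "x \<in> I" and "smooth_on I a" "smooth_on I f" "smooth_on I g"
    and "smooth_on I a'" "smooth_on I f'" "smooth_on I g'"
  shows "initial_values x (\<lambda>t. a t + a' t) (\<lambda>t. f t + f' t) (\<lambda>t. g t + g' t)
    = initial_values x a f g + initial_values x a' f' g'"
  using assms by (simp add: initial_values_def jet_add[OF \<open>open I\<close>])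

lemma initial_values_scale:
  assumes "open I" and "x \<in> I" and "smooth_on I a" "smooth_on I f" "smooth_on I g"
  shows "initial_values x (\<lambda>t. r * a t) (\<lambda>t. r * f t) (\<lambda>t. r * g t) = r *\<^sub>R initial_values x a f g"
  using assms by (simp add: initial_values_def jet_scale[OF \<open>open I\<close>])

lemma affine_symmetry_add:
  assumes "open I" and 1: "affine_symmetry I c a f g" and 2: "affine_symmetry I c a' f' g'"
  shows "affine_symmetry I c (\<lambda>t. a t + a' t) (\<lambda>t. f t + f' t) (\<lambda>t. g t + g' t)"
proof -
  have sm: "smooth_on I a" "smooth_on I f" "smooth_on I g" "smooth_on I a'" "smooth_on I f'" "smooth_on I g'"
    using 1 2 by (auto simp: affine_symmetry_def)
  note j = jet_add[OF \<open>open I\<close> sm(1,4)] jet_add[OF \<open>open I\<close> sm(2,5)] jet_add[OF \<open>open I\<close> sm(3,6)]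
  have "det4 (\<lambda>j. jet (c j)) (jet (\<lambda>t. a t + a' t)) (jet (\<lambda>t. f t + f' t)) x =
      det4 (\<lambda>j. jet (c j)) (jet a) (jet f) x + det4 (\<lambda>j. jet (c j)) (jet a') (jet f') x"
    "det3 (\<lambda>j. jet (c j)) (jet (\<lambda>t. a t + a' t)) (jet (\<lambda>t. f t + f' t)) x =
      det3 (\<lambda>j. jet (c j)) (jet a) (jet f) x + det3 (\<lambda>j. jet (c j)) (jet a') (jet f') x"
    "det2 (\<lambda>j. jet (c j)) (jet (\<lambda>t. a t + a' t)) (jet (\<lambda>t. f t + f' t)) x =
      det2 (\<lambda>j. jet (c j)) (jet a) (jet f) x + det2 (\<lambda>j. jet (c j)) (jet a') (jet f') x"
    "det1 (\<lambda>j. jet (c j)) (jet (\<lambda>t. a t + a' t)) (jet (\<lambda>t. f t + f' t)) x =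
      det1 (\<lambda>j. jet (c j)) (jet a) (jet f) x + det1 (\<lambda>j. jet (c j)) (jet a') (jet f') x"
    "det0 (\<lambda>j. jet (c j)) (jet (\<lambda>t. a t + a' t)) (jet (\<lambda>t. f t + f' t)) x =
      det0 (\<lambda>j. jet (c j)) (jet a) (jet f) x + det0 (\<lambda>j. jet (c j)) (jet a') (jet f') x"
    "linear_ode 5 c x (\<lambda>k. jet (\<lambda>t. g t + g' t) k x) =
      linear_ode 5 c x (\<lambda>k. jet g k x) + linear_ode 5 c x (\<lambda>k. jet g' k x)" if "x \<in> I" for x
    unfolding det4_def det3_def det2_def det1_def det0_def linear_ode_def j[OF that] sum.distrib[symmetric]
    by (simp_all only: sum.distrib distrib_left) algebra+
  then show ?thesis
    using 1 2 by (auto simp: affine_symmetry_def intro!: smooth_on_add \<open>open I\<close>)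
qed

lemma affine_symmetry_scale:
  assumes "open I" and 1: "affine_symmetry I c a f g"
  shows "affine_symmetry I c (\<lambda>t. r * a t) (\<lambda>t. r * f t) (\<lambda>t. r * g t)"
proof -
  have sm: "smooth_on I a" "smooth_on I f" "smooth_on I g"
    using 1 by (auto simp: affine_symmetry_def)
  note j = jet_scale[OF \<open>open I\<close> sm(1)] jet_scale[OF \<open>open I\<close> sm(2)] jet_scale[OF \<open>open I\<close> sm(3)]
  have "det4 (\<lambda>j. jet (c j)) (jet (\<lambda>t. r * a t)) (jet (\<lambda>t. r * f t)) x = r * det4 (\<lambda>j. jet (c j)) (jet a) (jet f) x"
    "det3 (\<lambda>j. jet (c j)) (jet (\<lambda>t. r * a t)) (jet (\<lambda>t. r * f t)) x = r * det3 (\<lambda>j. jet (c j)) (jet a) (jet f) x"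
    "det2 (\<lambda>j. jet (c j)) (jet (\<lambda>t. r * a t)) (jet (\<lambda>t. r * f t)) x = r * det2 (\<lambda>j. jet (c j)) (jet a) (jet f) x"
    "det1 (\<lambda>j. jet (c j)) (jet (\<lambda>t. r * a t)) (jet (\<lambda>t. r * f t)) x = r * det1 (\<lambda>j. jet (c j)) (jet a) (jet f) x"
    "det0 (\<lambda>j. jet (c j)) (jet (\<lambda>t. r * a t)) (jet (\<lambda>t. r * f t)) x = r * det0 (\<lambda>j. jet (c j)) (jet a) (jet f) x"
    "linear_ode 5 c x (\<lambda>k. jet (\<lambda>t. r * g t) k x) = r * linear_ode 5 c x (\<lambda>k. jet g k x)" if "x \<in> I" for x
    unfolding det4_def det3_def det2_def det1_def det0_def linear_ode_def lessThan_numeral_sums j[OF that]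
    by algebra+
  then show ?thesis
    using 1 by (auto simp: affine_symmetry_def intro!: smooth_on_mult smooth_on_const \<open>open I\<close>)
qed

lemma affine_vf_add: "affine_vf I a f g + affine_vf I a' f' g' =
    affine_vf I (\<lambda>t. a t + a' t) (\<lambda>t. f t + f' t) (\<lambda>t. g t + g' t)"
  by (auto simp: affine_vf_def fun_eq_iff algebra_simps)

lemma affine_vf_scale: "vf_scale r (affine_vf I a f g) =
    affine_vf I (\<lambda>t. r * a t) (\<lambda>t. r * f t) (\<lambda>t. r * g t)"
  by (auto simp: affine_vf_def vf_scale_def fun_eq_iff algebra_simps)

lemma smooth_on_sub:
  fixes f g :: "real \<Rightarrow> real"
  shows "open I \<Longrightarrow> smooth_on I f \<Longrightarrow> smooth_on I g \<Longrightarrow> smooth_on I (\<lambda>x. f x - g x)"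
  using smooth_on_add[of I f "\<lambda>x. - 1 * g x"] smooth_on_mult[OF _ smooth_on_const, of I g "- 1"] by simp

lemma smooth_on_jet: "open I \<Longrightarrow> smooth_on I h \<Longrightarrow> smooth_on I (jet h k)"
  unfolding jet_def[abs_def] by (rule smooth_on_funpow_deriv)

text \<open>Eliminating \<open>f'\<close> and \<open>f''\<close> from \<open>det3\<close> by means of \<open>det4\<close> leaves a third-order equation
  for \<open>a\<close>.\<close>

definition third_order_coeff :: "(nat \<Rightarrow> real \<Rightarrow> real) \<Rightarrow> nat \<Rightarrow> real \<Rightarrow> real" where
  "third_order_coeff c j x =
     (if j = 0 then 2 * jet (c 4) 2 x - jet (c 3) 1 x + 4 / 5 * (c 4 x * jet (c 4) 1 x)
      else if j = 1 then 4 * jet (c 4) 1 x - 2 * c 3 x + 4 / 5 * (c 4 x * c 4 x) else 0) / 10"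

lemma smooth_on_third_order_coeff:
  assumes "open I" and "\<And>j. j < 5 \<Longrightarrow> smooth_on I (c j)"
  shows "smooth_on I (third_order_coeff c j)"
proof -
  have "smooth_on I (\<lambda>x. (1 / 10) * (2 * jet (c 4) 2 x - jet (c 3) 1 x + 4 / 5 * (c 4 x * jet (c 4) 1 x)))"
    "smooth_on I (\<lambda>x. (1 / 10) * (4 * jet (c 4) 1 x - 2 * c 3 x + 4 / 5 * (c 4 x * c 4 x)))"
    by (intro smooth_on_mult smooth_on_add smooth_on_sub smooth_on_const smooth_on_jet assms; simp)+
  then show ?thesis
    unfolding third_order_coeff_def[abs_def]
    by (cases "j = 0"; cases "j = 1") (simp_all add: smooth_on_const)
qed

lemma det3_iff_third_order:
  assumes "open I" and "\<And>j. is_jet I (jet (c j))" and "is_jet I (jet a)" and "is_jet I (jet f)"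
    and det4: "\<forall>x\<in>I. det4 (\<lambda>j. jet (c j)) (jet a) (jet f) x = 0" and "x \<in> I"
  shows "det3 (\<lambda>j. jet (c j)) (jet a) (jet f) x = 0 \<longleftrightarrow>
    jet a 3 x = (\<Sum>j<3. third_order_coeff c j x * jet a j x)"
proof -
  let ?p = "jet (c 4)"
  have d: "(jet h k has_real_derivative jet h (Suc k) x) (at x)" if "is_jet I (jet h)" for h k
    using that \<open>x \<in> I\<close> by (simp add: is_jet_def)
  have d': "(h has_real_derivative jet h 1 x) (at x)" if "is_jet I (jet h)" for h
    using d[OF that, of 0] by simp
  have "- 10 * jet a 3 x + 5 * jet f 2 x + a x * ?p 2 x + 2 * jet a 1 x * ?p 1 x + jet a 2 x * c 4 x = 0"
  proof (rule vanishing_derivative[OF \<open>open I\<close> \<open>x \<in> I\<close>])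
    show "- 10 * jet a 2 t + 5 * jet f 1 t + a t * ?p 1 t + jet a 1 t * c 4 t = 0" if "t \<in> I" for t
      using det4 that by (simp add: det4_def)
    show "((\<lambda>t. - 10 * jet a 2 t + 5 * jet f 1 t + a t * ?p 1 t + jet a 1 t * c 4 t) has_real_derivative
        - 10 * jet a 3 x + 5 * jet f 2 x + a x * ?p 2 x + 2 * jet a 1 x * ?p 1 x + jet a 2 x * c 4 x) (at x)"
      by (rule derivative_eq_intros d d' assms refl | simp add: algebra_simps eval_nat_numeral)+
  qed
  moreover have "- 10 * jet a 2 x + 5 * jet f 1 x + a x * ?p 1 x + jet a 1 x * c 4 x = 0"
    using det4 \<open>x \<in> I\<close> by (simp add: det4_def)
  ultimately have "det3 (\<lambda>j. jet (c j)) (jet a) (jet f) x =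
      10 * (jet a 3 x - (\<Sum>j<3. third_order_coeff c j x * jet a j x))"
    unfolding det3_def lessThan_numeral_sums third_order_coeff_def jet_0 by (simp add: field_simps) algebra
  then show ?thesis by simp
qed

section \<open>Maximality and the vanishing of the invariants\<close>

lemma affine_symmetry_determined:
  assumes I: "open I" "is_interval I" "x0 \<in> I" and c: "\<And>j. smooth_on I (c j)"
    and sym: "affine_symmetry I c a f g" and init: "initial_values x0 a f g = 0" and "x \<in> I"
  shows "a x = 0" and "f x = 0" and "g x = 0"
proof -
  have sm: "smooth_on I a" "smooth_on I f" "smooth_on I g"
    and det4: "\<forall>x\<in>I. det4 (\<lambda>j. jet (c j)) (jet a) (jet f) x = 0"
    and det3: "\<forall>x\<in>I. det3 (\<lambda>j. jet (c j)) (jet a) (jet f) x = 0"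
    and ode: "\<forall>x\<in>I. linear_ode 5 c x (\<lambda>k. jet g k x) = 0"
    using sym by (auto simp: affine_symmetry_def)
  have init': "a x0 = 0" "jet a 1 x0 = 0" "jet a 2 x0 = 0" "f x0 = 0" "g x0 = 0" "jet g 1 x0 = 0"
    "jet g 2 x0 = 0" "jet g 3 x0 = 0" "jet g 4 x0 = 0"
    using init by (simp_all add: initial_values_def zero_prod_def)
  have less3: "j = 0 \<or> j = 1 \<or> j = 2" if "j < 3" for j :: nat using that by auto
  have less5: "j = 0 \<or> j = 1 \<or> j = 2 \<or> j = 3 \<or> j = 4" if "j < 5" for j :: nat using that by auto
  have a0: "a x = 0" if "x \<in> I" for x
  proof (rule linear_ode_solution_unique[OF I _ sm(1) _ _ that, of 3 "third_order_coeff c"])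
    show "smooth_on I (third_order_coeff c j)" for j
      by (rule smooth_on_third_order_coeff[OF I(1) c])
    show "(deriv ^^ 3) a x = (\<Sum>j<3. third_order_coeff c j x * (deriv ^^ j) a x)" if "x \<in> I" for x
      using det3 det3_iff_third_order[OF I(1) is_jet_jet[OF I(1) c] is_jet_jet[OF I(1) sm(1)]
          is_jet_jet[OF I(1) sm(2)] det4 that] that
      unfolding jet_def[of a, symmetric] by blast
    show "(deriv ^^ j) a x0 = 0" if "j < 3" for j
      using less3[OF that] init' unfolding jet_def[of a, symmetric] by auto
  qed simp
  then show "a x = 0" using \<open>x \<in> I\<close> .
  have jet_a: "jet a k x = 0" if "x \<in> I" for k x
    using jet_unique[OF I(1), of "\<lambda>k x. 0" a x k] a0 that by (simp add: is_jet_def)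
  show "f x = 0"
  proof (rule linear_ode_solution_unique[OF I _ sm(2) _ _ \<open>x \<in> I\<close>, of 1 "\<lambda>j x. 0"])
    show "(deriv ^^ 1) f x = (\<Sum>j<1. 0 * (deriv ^^ j) f x)" if "x \<in> I" for x
      using bspec[OF det4 that] jet_a[OF that] jet_a[OF that, of 0]
      unfolding jet_def[of f, symmetric] det4_def by simp
  qed (use init' in \<open>simp_all add: smooth_on_const\<close>)
  show "g x = 0"
  proof (rule linear_ode_solution_unique[OF I _ sm(3) _ _ \<open>x \<in> I\<close>, of 5 "\<lambda>j x. - 1 * c j x"])
    show "smooth_on I (\<lambda>x. - 1 * c j x)" for j
      by (intro smooth_on_mult smooth_on_const c I(1))
    show "(deriv ^^ 5) g x = (\<Sum>j<5. - 1 * c j x * (deriv ^^ j) g x)" if "x \<in> I" for x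
      using bspec[OF ode that] unfolding jet_def[of g, symmetric] linear_ode_def
      by (simp add: sum_negf)
    show "(deriv ^^ j) g x0 = 0" if "j < 5" for j
      using less5[OF that] init' unfolding jet_def[of g, symmetric] by auto
  qed simp
qed

lemma maximal_iff_data_surj:
  assumes I: "open I" "is_interval I" "x0 \<in> I" and c: "\<And>j. smooth_on I (c j)"
  shows "has_maximal_symmetry_algebra 5 I c \<longleftrightarrow>
    (\<forall>v. \<exists>a f g. affine_symmetry I c a f g \<and> initial_values x0 a f g = v)"
proof -
  let ?S = "{affine_vf I a f g | a f g. affine_symmetry I c a f g}"
  have S: "symmetry_algebra 5 I (linear_ode 5 c) = ?S"
    using symmetry_algebra_eq[OF I(1) c] .
  have data: "symmetry_data x0 (affine_vf I a f g) = initial_values x0 a f g"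
    if "affine_symmetry I c a f g" for a f g
    using symmetry_data_affine_vf[OF I(1,3)] that by (simp add: affine_symmetry_def)
  have zero: "affine_symmetry I c (\<lambda>_. 0) (\<lambda>_. 0) (\<lambda>_. 0)"
  proof -
    have "jet (\<lambda>_. 0) k x = 0" if "x \<in> I" for k x
      using jet_unique[OF I(1), of "\<lambda>k x. 0" "\<lambda>_. 0" x k] that by (simp add: is_jet_def)
    then show ?thesis
      by (simp add: affine_symmetry_def smooth_on_const det4_def det3_def det2_def det1_def det0_def
          linear_ode_def)
  qed
  have "vf.dim ?S = DIM(nine_reals) \<longleftrightarrow> symmetry_data x0 ` ?S = UNIV"
  proof (rule dim_eq_DIM_iff)
    show "vf.subspace ?S"
    proof (rule vf.subspaceI)
      show "0 \<in> ?S"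
        using zero by (force simp: affine_vf_def fun_eq_iff zero_prod_def)
      show "V + W \<in> ?S" if "V \<in> ?S" "W \<in> ?S" for V W
        using that affine_symmetry_add[OF I(1)] affine_vf_add by blast
      show "vf_scale r V \<in> ?S" if "V \<in> ?S" for r V
        using that affine_symmetry_scale[OF I(1)] affine_vf_scale by blast
    qed
  next
    fix V W assume "V \<in> ?S" "W \<in> ?S"
    then obtain a f g a' f' g' where V: "V = affine_vf I a f g" "affine_symmetry I c a f g"
      and W: "W = affine_vf I a' f' g'" "affine_symmetry I c a' f' g'" by blast
    show "symmetry_data x0 (V + W) = symmetry_data x0 V + symmetry_data x0 W"
      using V(2) W(2) data[OF V(2)] data[OF W(2)] data[OF affine_symmetry_add[OF I(1) V(2) W(2)]]
        initial_values_add[OF I(1,3), of a f g a' f' g']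
      unfolding V(1) W(1) affine_vf_add by (simp add: affine_symmetry_def)
  next
    fix r V assume "V \<in> ?S"
    then obtain a f g where V: "V = affine_vf I a f g" "affine_symmetry I c a f g" by blast
    show "symmetry_data x0 (vf_scale r V) = r *\<^sub>R symmetry_data x0 V"
      using V(2) data[OF V(2)] data[OF affine_symmetry_scale[OF I(1) V(2)]]
        initial_values_scale[OF I(1,3), of a f g r]
      unfolding V(1) affine_vf_scale by (simp add: affine_symmetry_def)
  next
    fix V assume "V \<in> ?S" "symmetry_data x0 V = 0"
    then obtain a f g where V: "V = affine_vf I a f g" "affine_symmetry I c a f g"
      and "initial_values x0 a f g = 0"
      using data by force
    note z = affine_symmetry_determined[OF I c V(2) this(3)]
    show "V = 0"
      using z by (auto simp: V(1) affine_vf_def fun_eq_iff zero_prod_def)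
  qed
  moreover have "DIM(nine_reals) = 5 + 4" by simp
  moreover have "symmetry_data x0 ` ?S = UNIV \<longleftrightarrow>
      (\<forall>v. \<exists>a f g. affine_symmetry I c a f g \<and> initial_values x0 a f g = v)" (is "_ \<longleftrightarrow> ?R")
  proof
    assume onto: "symmetry_data x0 ` ?S = UNIV"
    show ?R
    proof
      fix v
      have "v \<in> symmetry_data x0 ` ?S" using onto by simp
      then obtain V where V: "v = symmetry_data x0 V" "V \<in> ?S" by (rule imageE)
      then obtain a f g where "V = affine_vf I a f g" "affine_symmetry I c a f g" by blast
      then show "\<exists>a f g. affine_symmetry I c a f g \<and> initial_values x0 a f g = v"
        using data V(1) by metis
    qed
  next
    assume R: ?R
    have "v \<in> symmetry_data x0 ` ?S" for v
    proof -
      obtain a f g where "affine_symmetry I c a f g" "initial_values x0 a f g = v" using R by blast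
      then show ?thesis
        by (intro image_eqI[of _ _ "affine_vf I a f g"]) (auto simp: data)
    qed
    then show "symmetry_data x0 ` ?S = UNIV" by blast
  qed
  ultimately show ?thesis
    unfolding has_maximal_symmetry_algebra_def S by (simp only:)
qed

text \<open>Initial values \<open>a(x) = 0\<close>, \<open>a'(x) = 1\<close> turn \<open>a w' + m a' w = 0\<close> into \<open>w(x) = 0\<close>. The invariant of
  weight 3 has to vanish before that of weight 4 can be treated, and so on.\<close>

lemma invariants_vanish_if_data_surj:
  assumes I: "open I" and c: "\<And>j. smooth_on I (c j)"
    and surj: "\<And>x v. x \<in> I \<Longrightarrow> \<exists>a f g. affine_symmetry I c a f g \<and> initial_values x a f g = v"
  shows "\<forall>x\<in>I. c 2 x = forced_c2 (\<lambda>j. jet (c j)) x \<and> c 1 x = forced_c1 (\<lambda>j. jet (c j)) x \<and>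
    c 0 x = forced_c0 (\<lambda>j. jet (c j)) x"
proof -
  let ?C = "\<lambda>j. jet (c j)"
  have C: "is_jet I (?C j)" for j by (rule is_jet_jet[OF I c])
  have C': "(c j has_real_derivative ?C j 1 x) (at x)" if "x \<in> I" for j x
    using C[of j] that unfolding is_jet_def by (metis One_nat_def jet_0)
  have sym: "\<exists>a f. is_jet I (jet a) \<and> is_jet I (jet f) \<and>
      (\<forall>x\<in>I. det4 ?C (jet a) (jet f) x = 0) \<and> (\<forall>x\<in>I. det3 ?C (jet a) (jet f) x = 0) \<and>
      det2 ?C (jet a) (jet f) x = 0 \<and> det1 ?C (jet a) (jet f) x = 0 \<and> det0 ?C (jet a) (jet f) x = 0 \<and>
      jet a 0 x = 0 \<and> jet a 1 x = 1" if x: "x \<in> I" for x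
  proof -
    obtain a f g where *: "affine_symmetry I c a f g"
        "initial_values x a f g = ((0, 1, 0), 0, (0, 0, 0, 0, 0))"
      using surj[OF x] by blast
    then show ?thesis
      using is_jet_jet[OF I, of a] is_jet_jet[OF I, of f] x
      by (intro exI[of _ a] exI[of _ f]) (simp add: affine_symmetry_def initial_values_def)
  qed
  have inv2: "c 2 x = forced_c2 ?C x" if x: "x \<in> I" for x
  proof -
    obtain a f where *: "is_jet I (jet a)" "is_jet I (jet f)" "\<forall>x\<in>I. det4 ?C (jet a) (jet f) x = 0"
      "\<forall>x\<in>I. det3 ?C (jet a) (jet f) x = 0" "det2 ?C (jet a) (jet f) x = 0" "jet a 0 x = 0" "jet a 1 x = 1"
      using sym[OF x] by blast
    have d: "\<exists>d. ((\<lambda>x. ?C 2 0 x - forced_c2 ?C x) has_real_derivative d) (at x)"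
      unfolding jet_0 using DERIV_diff[OF C'[OF x] forced_c2_deriv[of I ?C x, OF C x]] by blast
    then show ?thesis
      using det2_eq[of I ?C "jet a" "jet f" x, OF I C *(1-4) x] *(5-7) by (elim exE) simp
  qed
  have inv1: "c 1 x = forced_c1 ?C x" if x: "x \<in> I" for x
  proof -
    obtain a f where *: "is_jet I (jet a)" "is_jet I (jet f)" "\<forall>x\<in>I. det4 ?C (jet a) (jet f) x = 0"
      "\<forall>x\<in>I. det3 ?C (jet a) (jet f) x = 0" "det1 ?C (jet a) (jet f) x = 0" "jet a 0 x = 0" "jet a 1 x = 1"
      using sym[OF x] by blast
    have d: "\<exists>d. ((\<lambda>x. ?C 1 0 x - forced_c1 ?C x) has_real_derivative d) (at x)"
      unfolding jet_0 using DERIV_diff[OF C'[OF x] forced_c1_deriv[of I ?C x, OF C x]] by blast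
    then show ?thesis
      using det1_eq[of I ?C "jet a" "jet f" x, OF I C *(1-4) x] inv2[OF x] *(5-7) by (elim exE) simp
  qed
  have inv0: "c 0 x = forced_c0 ?C x" if x: "x \<in> I" for x
  proof -
    obtain a f where *: "is_jet I (jet a)" "is_jet I (jet f)" "\<forall>x\<in>I. det4 ?C (jet a) (jet f) x = 0"
      "\<forall>x\<in>I. det3 ?C (jet a) (jet f) x = 0" "det0 ?C (jet a) (jet f) x = 0" "jet a 0 x = 0" "jet a 1 x = 1"
      using sym[OF x] by blast
    have d: "\<exists>d. ((\<lambda>x. ?C 0 0 x - forced_c0 ?C x) has_real_derivative d) (at x)"
      unfolding jet_0 using DERIV_diff[OF C'[OF x] forced_c0_deriv[of I ?C x, OF C x]] by blast
    then show ?thesis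
      using det0_eq[of I ?C "jet a" "jet f" x, OF I C *(1-4) x] inv2[OF x] inv1[OF x] *(5-7)
      by (elim exE) simp
  qed
  show ?thesis using inv2 inv1 inv0 by blast
qed

lemma data_surj_if_invariants_vanish:
  assumes I: "open I" "is_interval I" "x0 \<in> I" and c: "\<And>j. smooth_on I (c j)"
    and van: "\<forall>x\<in>I. c 2 x = forced_c2 (\<lambda>j. jet (c j)) x \<and> c 1 x = forced_c1 (\<lambda>j. jet (c j)) x \<and>
      c 0 x = forced_c0 (\<lambda>j. jet (c j)) x"
  shows "\<exists>a f g. affine_symmetry I c a f g \<and> initial_values x0 a f g = v"
proof -
  let ?C = "\<lambda>j. jet (c j)"
  have C: "is_jet I (?C j)" for j by (rule is_jet_jet[OF I(1) c])
  obtain \<alpha>0 \<alpha>1 \<alpha>2 \<phi> \<gamma>0 \<gamma>1 \<gamma>2 \<gamma>3 \<gamma>4 where v: "v = ((\<alpha>0, \<alpha>1, \<alpha>2), \<phi>, (\<gamma>0, \<gamma>1, \<gamma>2, \<gamma>3, \<gamma>4))"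
    by (metis surj_pair)
  obtain a where a: "smooth_on I a"
    and a3: "\<And>x. x \<in> I \<Longrightarrow> (deriv ^^ 3) a x = (\<Sum>j<3. third_order_coeff c j x * (deriv ^^ j) a x)"
    and ai: "\<And>j. j < 3 \<Longrightarrow> (deriv ^^ j) a x0 = [\<alpha>0, \<alpha>1, \<alpha>2] ! j"
  proof (rule linear_ode_solution_exists[OF I, where n = 3 and a = "third_order_coeff c"
        and b = "\<lambda>j. [\<alpha>0, \<alpha>1, \<alpha>2] ! j"])
    show "smooth_on I (third_order_coeff c j)" for j
      by (rule smooth_on_third_order_coeff[OF I(1) c])
  qed auto
  obtain g where g: "smooth_on I g"
    and g5: "\<And>x. x \<in> I \<Longrightarrow> (deriv ^^ 5) g x = (\<Sum>j<5. (- 1 * c j x) * (deriv ^^ j) g x)"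
    and gi: "\<And>j. j < 5 \<Longrightarrow> (deriv ^^ j) g x0 = [\<gamma>0, \<gamma>1, \<gamma>2, \<gamma>3, \<gamma>4] ! j"
  proof (rule linear_ode_solution_exists[OF I, where n = 5 and a = "\<lambda>j x. - 1 * c j x"
        and b = "\<lambda>j. [\<gamma>0, \<gamma>1, \<gamma>2, \<gamma>3, \<gamma>4] ! j"])
    show "smooth_on I (\<lambda>x. - 1 * c j x)" for j
      by (intro smooth_on_mult smooth_on_const c I(1))
  qed auto
  (* The equation det4 = 0 has the integral f = 2 a' - a c 4 / 5 + constant. *)
  define \<kappa> where "\<kappa> = \<phi> - (2 * jet a 1 x0 - 1 / 5 * (a x0 * c 4 x0))"
  define f where "f x = 2 * jet a 1 x - 1 / 5 * (a x * c 4 x) + \<kappa>" for x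
  have f: "smooth_on I f"
    unfolding f_def[abs_def]
    by (intro smooth_on_add smooth_on_sub smooth_on_mult smooth_on_const smooth_on_jet a c I(1))
  note jets = is_jet_jet[OF I(1) a] is_jet_jet[OF I(1) f]
  have d: "(jet h k has_real_derivative jet h (Suc k) x) (at x)" if "smooth_on I h" "x \<in> I" for h k x
    using is_jet_jet[OF I(1) that(1)] that(2) by (simp add: is_jet_def)
  have det4: "\<forall>x\<in>I. det4 ?C (jet a) (jet f) x = 0"
  proof
    fix x assume x: "x \<in> I"
    have "(f has_real_derivative 2 * jet a 2 x - 1 / 5 * (a x * jet (c 4) 1 x + jet a 1 x * c 4 x)) (at x)"
      unfolding f_def[abs_def]
      by (rule derivative_eq_intros d[OF a x] d[OF a x, of 0, unfolded jet_0] d[OF c x, of 4 0, unfolded jet_0] refl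
          | simp add: algebra_simps eval_nat_numeral)+
    moreover have "(f has_real_derivative jet f 1 x) (at x)"
      using d[OF f x, of 0] by simp
    ultimately have "jet f 1 x = 2 * jet a 2 x - 1 / 5 * (a x * jet (c 4) 1 x + jet a 1 x * c 4 x)"
      by (rule DERIV_unique[rotated])
    then show "det4 ?C (jet a) (jet f) x = 0"
      by (simp add: det4_def algebra_simps)
  qed
  have det3: "\<forall>x\<in>I. det3 ?C (jet a) (jet f) x = 0"
  proof
    fix x assume x: "x \<in> I"
    show "det3 ?C (jet a) (jet f) x = 0"
      using det3_iff_third_order[OF I(1) C jets det4 x] a3[OF x] by (simp add: jet_def)
  qed
  have C': "(c j has_real_derivative ?C j 1 x) (at x)" if "x \<in> I" for j x
    using d[OF c that, of j 0] by simp
  have det2: "det2 ?C (jet a) (jet f) x = 0" if x: "x \<in> I" for x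
  proof -
    obtain e where e: "((\<lambda>x. ?C 2 0 x - forced_c2 ?C x) has_real_derivative e) (at x)"
      unfolding jet_0 using DERIV_diff[OF C'[OF x] forced_c2_deriv[of I ?C x, OF C x]] by blast
    have "e = 0"
      by (rule vanishing_derivative[OF I(1) x _ e]) (use van in simp)
    then show ?thesis
      using det2_eq[of I ?C "jet a" "jet f" x, OF I(1) C jets det4 det3 x e] van x by simp
  qed
  have det1: "det1 ?C (jet a) (jet f) x = 0" if x: "x \<in> I" for x
  proof -
    obtain e where e: "((\<lambda>x. ?C 1 0 x - forced_c1 ?C x) has_real_derivative e) (at x)"
      unfolding jet_0 using DERIV_diff[OF C'[OF x] forced_c1_deriv[of I ?C x, OF C x]] by blast
    have "e = 0"
      by (rule vanishing_derivative[OF I(1) x _ e]) (use van in simp)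
    then show ?thesis
      using det1_eq[of I ?C "jet a" "jet f" x, OF I(1) C jets det4 det3 x e] van x by simp
  qed
  have det0: "det0 ?C (jet a) (jet f) x = 0" if x: "x \<in> I" for x
  proof -
    obtain e where e: "((\<lambda>x. ?C 0 0 x - forced_c0 ?C x) has_real_derivative e) (at x)"
      unfolding jet_0 using DERIV_diff[OF C'[OF x] forced_c0_deriv[of I ?C x, OF C x]] by blast
    have "e = 0"
      by (rule vanishing_derivative[OF I(1) x _ e]) (use van in simp)
    then show ?thesis
      using det0_eq[of I ?C "jet a" "jet f" x, OF I(1) C jets det4 det3 x e] van x by simp
  qed
  have "linear_ode 5 c x (\<lambda>k. jet g k x) = 0" if x: "x \<in> I" for x
    using g5[OF x] by (simp add: linear_ode_def jet_def sum_negf)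
  then have "affine_symmetry I c a f g"
    using a f g det4 det3 det2 det1 det0 by (simp add: affine_symmetry_def)
  moreover have "initial_values x0 a f g = v"
  proof -
    have "jet a 0 x0 = \<alpha>0" "jet a 1 x0 = \<alpha>1" "jet a 2 x0 = \<alpha>2"
      using ai[of 0] ai[of 1] ai[of 2] by (simp_all add: jet_def)
    moreover have "jet g 0 x0 = \<gamma>0" "jet g 1 x0 = \<gamma>1" "jet g 2 x0 = \<gamma>2" "jet g 3 x0 = \<gamma>3" "jet g 4 x0 = \<gamma>4"
      using gi[of 0] gi[of 1] gi[of 2] gi[of 3] gi[of 4] by (simp_all add: jet_def)
    moreover have "f x0 = \<phi>" by (simp add: f_def \<kappa>_def)
    ultimately show ?thesis by (simp add: initial_values_def v)
  qed
  ultimately show ?thesis by blast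
qed

lemma jet_1: "jet h 1 = deriv h"
  by (simp add: jet_def)

lemma numeral_mult_divide_cancel: "(numeral n :: real) * (w / numeral n) = w"
  by simp

lemma maximal_iff_invariants_vanish:
  assumes I: "open I" "is_interval I" "I \<noteq> {}" and c: "\<And>j. smooth_on I (c j)"
  shows "has_maximal_symmetry_algebra 5 I c \<longleftrightarrow>
    (\<forall>x\<in>I. c 2 x = forced_c2 (\<lambda>j. jet (c j)) x \<and> c 1 x = forced_c1 (\<lambda>j. jet (c j)) x \<and>
      c 0 x = forced_c0 (\<lambda>j. jet (c j)) x)" (is "_ \<longleftrightarrow> ?vanish")
proof
  assume "has_maximal_symmetry_algebra 5 I c"
  then have "\<exists>a f g. affine_symmetry I c a f g \<and> initial_values x a f g = v" if "x \<in> I" for x v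
    using maximal_iff_data_surj[of I x c, OF I(1,2) that c] by blast
  then show ?vanish
    by (rule invariants_vanish_if_data_surj[OF I(1) c])
next
  assume ?vanish
  moreover obtain x0 where "x0 \<in> I" using I(3) by blast
  ultimately show "has_maximal_symmetry_algebra 5 I c"
    using data_surj_if_invariants_vanish[of I x0 c, OF I(1,2) _ c]
      maximal_iff_data_surj[of I x0 c, OF I(1,2) _ c] by blast
qed

theorem mainTheorem7:
  fixes I :: "real set" and c :: "nat \<Rightarrow> real \<Rightarrow> real"
  assumes "open I" and "is_interval I" and "I \<noteq> {}"
    and "\<And>j. j < 5 \<Longrightarrow> smooth_on I (c j)"
  shows "has_maximal_symmetry_algebra 5 I c \<longleftrightarrow>
    (\<forall>x\<in>I.
       50 * c 2 x =
         30 * c 3 x * c 4 x - 8 * c 4 x ^ 3 + 75 * deriv (c 3) x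
         - 60 * c 4 x * deriv (c 4) x - 50 * (deriv ^^ 2) (c 4) x
     \<and> 1250 * c 1 x =
         200 * c 3 x ^ 2 - 18 * c 4 x ^ 4 + 750 * c 4 x * deriv (c 3) x
         - 580 * c 4 x ^ 2 * deriv (c 4) x - 850 * (deriv (c 4) x) ^ 2
         - 10 * c 3 x * (c 4 x ^ 2 + 5 * deriv (c 4) x)
         + 1125 * (deriv ^^ 2) (c 3) x - 1400 * c 4 x * (deriv ^^ 2) (c 4) x
         - 1000 * (deriv ^^ 3) (c 4) x
     \<and> 6250 * c 0 x =
         200 * c 3 x ^ 2 * c 4 x + 14 * c 4 x ^ 5 - 25 * c 4 x ^ 2 * deriv (c 3) x
         + 40 * c 4 x ^ 3 * deriv (c 4) x - 125 * deriv (c 3) x * deriv (c 4) x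
         - 750 * c 4 x * (deriv (c 4) x) ^ 2 + 1125 * c 4 x * (deriv ^^ 2) (c 3) x
         - 850 * c 4 x ^ 2 * (deriv ^^ 2) (c 4) x
         - 2750 * deriv (c 4) x * (deriv ^^ 2) (c 4) x
         + 1250 * (deriv ^^ 3) (c 3) x - 2000 * c 4 x * (deriv ^^ 3) (c 4) x
         - 1250 * (deriv ^^ 4) (c 4) x
         - 10 * c 3 x * (11 * c 4 x ^ 3 - 100 * deriv (c 3) x
             + 85 * c 4 x * deriv (c 4) x + 75 * (deriv ^^ 2) (c 4) x))"
proof -
  (* Only c 0, ..., c 4 enter the equation; the others are replaced by smooth functions. *)
  define b where "b j = (if j < 5 then c j else (\<lambda>_. 0))" for j
  have b: "smooth_on I (b j)" for j
    using assms(4) by (simp add: b_def smooth_on_const)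
  have bc: "b 0 = c 0" "b 1 = c 1" "b 2 = c 2" "b 3 = c 3" "b 4 = c 4"
    by (simp_all add: b_def)
  have "linear_ode 5 c = linear_ode 5 b"
    by (simp add: linear_ode_def b_def)
  then have "has_maximal_symmetry_algebra 5 I c \<longleftrightarrow> has_maximal_symmetry_algebra 5 I b"
    by (simp only: has_maximal_symmetry_algebra_def)
  also have "\<dots> \<longleftrightarrow> (\<forall>x\<in>I. c 2 x = forced_c2 (\<lambda>j. jet (b j)) x \<and> c 1 x = forced_c1 (\<lambda>j. jet (b j)) x \<and>
      c 0 x = forced_c0 (\<lambda>j. jet (b j)) x)"
    using maximal_iff_invariants_vanish[of I b, OF assms(1-3) b] unfolding bc .
  also have "\<dots> \<longleftrightarrow> (\<forall>x\<in>I. 50 * c 2 x = 50 * forced_c2 (\<lambda>j. jet (b j)) x \<and>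
      1250 * c 1 x = 1250 * forced_c1 (\<lambda>j. jet (b j)) x \<and> 6250 * c 0 x = 6250 * forced_c0 (\<lambda>j. jet (b j)) x)"
    by simp
  finally show ?thesis
    unfolding forced_c2_def forced_c1_def forced_c0_def bc jet_0 jet_1 numeral_mult_divide_cancel
    unfolding jet_def .
qed

end
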